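(* Let $\mu,\nu$ be compactly supported probability measures on $\mathbb{R}$, absolutely continuous with respect to Lebesgue measure, and let $\mathcal F=F_\mu-F_\nu$. Then there exists an optimal plan $\gamma\in\mathcal O_1(\mu,\nu)$ with $\operatorname{Ent}(\gamma\llcorner(\mathbb{R}\setminus A)^2|\mu\otimes\nu)<\infty$ if and only if $$-\int_{A^+\cup A^-}\log|\mathcal F(x)|\,d\mu(x)<+\infty.$$ In that case, the minimum of $\gamma\mapsto\operatorname{Ent}(\gamma\llcorner(\mathbb{R}\setminus A)^2|\mu\otimes\nu)$ over $\mathcal O_1(\mu,\nu)$ is attained by the plan which equals $(\mathrm{id},\mathrm{id})_\#(\mu\llcorner A)$ on $A\times A$ and, on each $I^2$ with $I$ a connected component of $A^+$ (resp. $A^-$), equals $\gamma_0^I=(\rho_1\otimes\rho_2)\llcorner\{y>x\}$ (resp. $(\rho_1\otimes\rho_2)\llcorner\{y<x\}$), where $\rho_1,\rho_2$ are nonnegative measures on $I=(a,b)$ with $G\cdot\rho_1=\mu$, $F\cdot\rho_2=\nu$ on $I$, $F,G$ continuous and positive on $I$, and $G(x)=\rho_2([x,b))$, $F(y)=\rho_1((a,y])$ (resp. $F(y)=\rho_1([y,b))$, $G(x)=\rho_2((a,x])$). Moreover, for every such interval $I$, $$\operatorname{Ent}(\gamma_0^I|\mu\otimes\nu)=-\int_I\log|\mathcal F(x)|\,d\mu(x)-\mu(I),$$ this identity holding also when both sides are $+\infty$.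
   Context: $F_\rho(x)=\rho((-\infty,x])$. $A=\{F_\mu=F_\nu\}$, $A^+=\{F_\mu>F_\nu\}$, $A^-=\{F_\mu<F_\nu\}$; the maximal intervals of $A^\pm$ are exactly the maximal positivity/negativity intervals of $\mathcal F$. $\Pi(\mu,\nu)$: probability measures on $\mathbb{R}^2$ with marginals $\mu,\nu$; $\mathcal O_1(\mu,\nu)$ is the set of minimizers of $\int|y-x|\,d\gamma$ over $\Pi(\mu,\nu)$. $\operatorname{Ent}(\gamma|\rho)=\int\log\frac{d\gamma}{d\rho}d\gamma$ if $\gamma\ll\rho$, $+\infty$ otherwise; $\gamma\llcorner E$ denotes restriction. $G\cdot\rho_1$ denotes the measure with density $G$ w.r.t. $\rho_1$. *)

theory Defs
  imports "HOL-Probability.Probability"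
begin

definition Fcal :: "real measure \<Rightarrow> real measure \<Rightarrow> real \<Rightarrow> real" where
  "Fcal mu nu x = cdf mu x - cdf nu x"

definition Aeq :: "real measure \<Rightarrow> real measure \<Rightarrow> real set" where
  "Aeq mu nu = {x. cdf mu x = cdf nu x}"

definition Aplus :: "real measure \<Rightarrow> real measure \<Rightarrow> real set" where
  "Aplus mu nu = {x. cdf mu x > cdf nu x}"

definition Aminus :: "real measure \<Rightarrow> real measure \<Rightarrow> real set" where
  "Aminus mu nu = {x. cdf mu x < cdf nu x}"

definition restr :: "'a measure \<Rightarrow> 'a set \<Rightarrow> 'a measure" where
  "restr M E = density M (indicator E)"

definition coupling :: "real measure \<Rightarrow> real measure \<Rightarrow> (real \<times> real) measure \<Rightarrow> bool" where
  "coupling mu nu g \<longleftrightarrow> prob_space g \<and> sets g = sets (borel \<Otimes>\<^sub>M borel) \<and>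
     distr g borel fst = mu \<and> distr g borel snd = nu"

definition transport_cost :: "(real \<times> real) measure \<Rightarrow> ennreal" where
  "transport_cost g = (\<integral>\<^sup>+ p. ennreal \<bar>snd p - fst p\<bar> \<partial>g)"

definition O1 :: "real measure \<Rightarrow> real measure \<Rightarrow> (real \<times> real) measure set" where
  "O1 mu nu = {g. coupling mu nu g \<and>
     (\<forall>g'. coupling mu nu g' \<longrightarrow> transport_cost g \<le> transport_cost g')}"

(* Ent(gamma|rho) = int log (d gamma / d rho) d gamma if gamma << rho, +infinity otherwise.
   The integral is the difference of the integrals of positive and negative parts
   (with the ereal convention infinity - infinity = infinity). *)
definition Ent :: "'a measure \<Rightarrow> 'a measure \<Rightarrow> ereal" where
  "Ent g r = (if sets g = sets r \<and> absolutely_continuous r g then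
      (let h = (\<lambda>x. ln (enn2real (RN_deriv r g x))) in
        enn2ereal (\<integral>\<^sup>+ x. ennreal (h x) \<partial>g) - enn2ereal (\<integral>\<^sup>+ x. ennreal (- h x) \<partial>g))
    else \<infinity>)"

(* data (rho1, rho2, F, G) on a component I = (a,b) of A^+ *)
definition pos_data :: "real measure \<Rightarrow> real measure \<Rightarrow> real \<Rightarrow> real \<Rightarrow> real measure \<Rightarrow> real measure
    \<Rightarrow> (real \<Rightarrow> real) \<Rightarrow> (real \<Rightarrow> real) \<Rightarrow> bool" where
  "pos_data mu nu a b r1 r2 F G \<longleftrightarrow>
     sets r1 = sets borel \<and> sets r2 = sets borel \<and>
     emeasure r1 (UNIV - {a<..<b}) = 0 \<and> emeasure r2 (UNIV - {a<..<b}) = 0 \<and>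
     continuous_on {a<..<b} F \<and> continuous_on {a<..<b} G \<and>
     (\<forall>x\<in>{a<..<b}. F x > 0 \<and> G x > 0) \<and>
     density r1 (\<lambda>x. ennreal (G x)) = restr mu {a<..<b} \<and>
     density r2 (\<lambda>x. ennreal (F x)) = restr nu {a<..<b} \<and>
     (\<forall>x\<in>{a<..<b}. ennreal (G x) = emeasure r2 {x..<b}) \<and>
     (\<forall>y\<in>{a<..<b}. ennreal (F y) = emeasure r1 {a<..y})"

(* data on a component I = (a,b) of A^- *)
definition neg_data :: "real measure \<Rightarrow> real measure \<Rightarrow> real \<Rightarrow> real \<Rightarrow> real measure \<Rightarrow> real measure
    \<Rightarrow> (real \<Rightarrow> real) \<Rightarrow> (real \<Rightarrow> real) \<Rightarrow> bool" where
  "neg_data mu nu a b r1 r2 F G \<longleftrightarrow>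
     sets r1 = sets borel \<and> sets r2 = sets borel \<and>
     emeasure r1 (UNIV - {a<..<b}) = 0 \<and> emeasure r2 (UNIV - {a<..<b}) = 0 \<and>
     continuous_on {a<..<b} F \<and> continuous_on {a<..<b} G \<and>
     (\<forall>x\<in>{a<..<b}. F x > 0 \<and> G x > 0) \<and>
     density r1 (\<lambda>x. ennreal (G x)) = restr mu {a<..<b} \<and>
     density r2 (\<lambda>x. ennreal (F x)) = restr nu {a<..<b} \<and>
     (\<forall>y\<in>{a<..<b}. ennreal (F y) = emeasure r1 {y..<b}) \<and>
     (\<forall>x\<in>{a<..<b}. ennreal (G x) = emeasure r2 {a<..x})"

definition gamma0_pos :: "real measure \<Rightarrow> real measure \<Rightarrow> (real \<times> real) measure" where
  "gamma0_pos r1 r2 = restr (r1 \<Otimes>\<^sub>M r2) {p. snd p > fst p}"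

definition gamma0_neg :: "real measure \<Rightarrow> real measure \<Rightarrow> (real \<times> real) measure" where
  "gamma0_neg r1 r2 = restr (r1 \<Otimes>\<^sub>M r2) {p. snd p < fst p}"

end

(* A coupling moves mass P(t) upwards and N(t) downwards across each point t, with P - N = Fcal; its cost
   is the integral of P + N, so optimality means P = max 0 Fcal and N = max 0 (- Fcal) at every t. In
   particular an optimal plan never crosses a zero of Fcal. On a component of A+ let H be a primitive of
   d mu / Fcal. Then F = exp H and G = Fcal / F solve the system for (rho1, rho2), and the density
   1 / (G x * F y) of the candidate plan equals exp (- (H y - H x)) / Fcal x. The integral of H y - H x
   against ANY optimal plan is, by Tonelli, the integral of P(t) / Fcal t = 1 against mu, that is mu I.
   Hence the cross entropy of every optimal plan against the candidate is the same number
   - integral of ln Fcal d mu - mu I, and Gibbs' inequality gives minimality. On A- exchange mu and nu. *)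
theory Submission
  imports Defs "HOL-Real_Asymp.Real_Asymp"
begin

section \<open>Substitution in Stieltjes integrals\<close>


text \<open>The calculus is done against the measures themselves: d f(M) = f'(M) dM for a continuous
  M takes the place of differentiation. The weight 1 / \<open>Fcal\<close> need not be integrable up
  to the ends of a component. Hence H starts at an interior point and rho1, rho2 may have infinite
  mass. That F vanishes at the left end a comes from \<open>Fcal\<close> t \<le> mu(a,t], which
  forces H to minus infinity there. A solution (F, G) is never unique (scale F by c and G by 1/c),
  and there may be infinitely many components. The density is therefore written through
  \<open>log_ratio\<close>, which involves no choice, so that one Borel function on the plane
  describes the whole plan. That mu and nu agree on A is read off from the marginals of this
  function. For each fixed zero of \<open>Fcal\<close>, optimality excludes crossing up to a null
  set; as the zeros may be uncountable, treating all of them at once needs a countable reduction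
  (\<open>AE_no_crossing\<close>). To allow infinite entropies, the logarithm of the density is kept
  as u - l with u = - ln |Fcal| \<ge> 0 and l = \<open>log_ratio\<close>. Only the integral of u can
  be infinite, so no difference of infinities occurs.\<close>

lemma set_lebesgue_integral_split_Ioc:
  fixes f :: "real \<Rightarrow> real"
  assumes "u \<le> v" "v \<le> w" "set_integrable m {u<..w} f" and [measurable_cong]: "sets m = sets borel"
  shows "(LINT t:{u<..w}|m. f t) = (LINT t:{u<..v}|m. f t) + (LINT t:{v<..w}|m. f t)"
proof -
  have eq: "{u<..w} = {u<..v} \<union> {v<..w}"
    using assms by auto
  show ?thesis
    unfolding eq
    by (rule set_integral_Un; (rule set_integrable_subset[OF assms(3)])?) (use assms(1,2) in auto)
qed

text \<open>The chain rule for a continuous \<open>M\<close> with dM = \<open>m1\<close> -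
  \<open>m2\<close>. The defect \<open>D\<close> is additive over adjacent intervals and, near each
  point, at most \<open>e\<close> times the mass of the interval; bisection carries this bound to
  the whole interval. Two measures occur because \<open>Fcal\<close> is a difference of distribution
  functions, to which the rule is applied with f = ln.\<close>

lemma signed_integral_substitution:
  fixes m1 m2 :: "real measure" and M f g :: "real \<Rightarrow> real"
  assumes sets: "sets m1 = sets borel" "sets m2 = sets borel"
    and xy: "x \<le> y"
    and fin: "emeasure m1 {x<..y} < \<infinity>" "emeasure m2 {x<..y} < \<infinity>"
    and cM: "continuous_on {x..y} M"
    and M: "\<And>u v. x \<le> u \<Longrightarrow> u \<le> v \<Longrightarrow> v \<le> y \<Longrightarrow> M v - M u = measure m1 {u<..v} - measure m2 {u<..v}"
    and f: "\<And>t. t \<in> {x..y} \<Longrightarrow> (f has_real_derivative g (M t)) (at (M t))"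
    and cg: "continuous_on (M ` {x..y}) g"
  shows "set_integrable m1 {x<..y} (\<lambda>t. g (M t))"
    and "(LINT t:{x<..y}|m1. g (M t)) - (LINT t:{x<..y}|m2. g (M t)) = f (M y) - f (M x)"
proof -
  define h where "h = (\<lambda>t. g (M t))"
  have ch: "continuous_on {x..y} h"
    unfolding h_def by (rule continuous_on_compose2[OF cg cM]) auto
  have int: "set_integrable m {x<..y} h" if "sets m = sets borel" "emeasure m {x<..y} < \<infinity>" for m
  proof -
    note [measurable_cong] = that(1)
    have "bounded (h ` {x..y})"
      by (intro compact_imp_bounded compact_continuous_image ch) auto
    then obtain B where B: "\<And>t. t \<in> {x..y} \<Longrightarrow> norm (h t) \<le> B"
      unfolding bounded_iff by (metis image_eqI)
    have "continuous_on {x<..y} h"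
      by (rule continuous_on_subset[OF ch]) auto
    then have meas: "(\<lambda>t. indicat_real {x<..y} t *\<^sub>R h t) \<in> borel_measurable borel"
      by (intro borel_measurable_continuous_on_indicator) auto
    show ?thesis
      unfolding set_integrable_def
    proof (rule integrableI_bounded_set[where A="{x<..y}" and B=B])
      show "(\<lambda>t. indicat_real {x<..y} t *\<^sub>R h t) \<in> borel_measurable m"
        using meas by (simp cong: measurable_cong_sets add: that)
      show "AE t in m. t \<in> {x<..y} \<longrightarrow> norm (indicat_real {x<..y} t *\<^sub>R h t) \<le> B"
        using B by auto
    qed (use that in auto)
  qed
  note i1 = int[OF sets(1) fin(1)] and i2 = int[OF sets(2) fin(2)]
  define D where "D = (\<lambda>u v. (LINT t:{u<..v}|m1. h t) - (LINT t:{u<..v}|m2. h t) - (f (M v) - f (M u)))"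
  have close: "\<bar>(LINT t:{u<..v}|m. h t) - c * measure m {u<..v}\<bar> \<le> e * measure m {u<..v}"
    if m: "sets m = sets borel" "emeasure m {x<..y} < \<infinity>" and uv: "x \<le> u" "v \<le> y"
      and h: "\<And>t. u \<le> t \<Longrightarrow> t \<le> v \<Longrightarrow> \<bar>h t - c\<bar> \<le> e" for m u v c e
  proof -
    note [measurable_cong] = m(1)
    have sub: "{u<..v} \<subseteq> {x<..y}"
      using uv by auto
    have ih: "set_integrable m {u<..v} h"
      by (rule set_integrable_subset[OF int[OF m]]) (use sub in \<open>auto simp: m\<close>)
    have finm: "emeasure m {u<..v} < \<infinity>"
      using emeasure_mono[OF sub, of m] m by (auto simp: order.strict_trans1)
    have ic: "set_integrable m {u<..v} (\<lambda>_. c')" for c' :: real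
      using finm by (simp add: set_integrable_def m)
    have cint: "(LINT t:{u<..v}|m. c') = c' * measure m {u<..v}" for c' :: real
      using finm by (simp add: set_lebesgue_integral_def m mult.commute)
    have hb: "h t - c \<le> e" "- e \<le> h t - c" if "t \<in> {u<..v}" for t
      using h[of t] that by auto
    have "(LINT t:{u<..v}|m. h t) - c * measure m {u<..v} = (LINT t:{u<..v}|m. h t - c)"
      by (subst set_integral_diff(2)[OF ih ic]) (simp add: cint)
    moreover have "(LINT t:{u<..v}|m. h t - c) \<le> (LINT t:{u<..v}|m. e)"
      by (rule set_integral_mono[OF set_integral_diff(1)[OF ih ic] ic]) (use hb in auto)
    moreover have "(LINT t:{u<..v}|m. - e) \<le> (LINT t:{u<..v}|m. h t - c)"
      by (rule set_integral_mono[OF ic set_integral_diff(1)[OF ih ic]]) (use hb in auto)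
    ultimately show ?thesis
      by (simp add: cint abs_le_iff)
  qed
  \<comment> \<open>The guard makes the claim vacuous for intervals sticking out of
    \<open>{x..y}\<close>: \<open>Bolzano\<close> quantifies over all short intervals around a
    point, also at the two ends.\<close>
  have small: "x \<le> x \<and> y \<le> y \<longrightarrow> \<bar>D x y\<bar> \<le> e * (measure m1 {x<..y} + measure m2 {x<..y})" if "e > 0" for e
    using xy
  proof (rule Bolzano[where P="\<lambda>u v. x \<le> u \<and> v \<le> y \<longrightarrow> \<bar>D u v\<bar> \<le> e * (measure m1 {u<..v} + measure m2 {u<..v})"], goal_cases)
    case trans: (1 a b c)
    show ?case
    proof
      assume ac: "x \<le> a \<and> c \<le> y"
      have sub: "{a<..c} \<subseteq> {x<..y}"
        using ac by auto
      have ia: "set_integrable m1 {a<..c} h" "set_integrable m2 {a<..c} h"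
        by (rule set_integrable_subset[OF i1] set_integrable_subset[OF i2], use sub in \<open>auto simp: sets\<close>)+
      have eq: "{a<..c} = {a<..b} \<union> {b<..c}"
        using trans by auto
      have me: "measure m {a<..c} = measure m {a<..b} + measure m {b<..c}"
        if "sets m = sets borel" "emeasure m {x<..y} < \<infinity>" for m
      proof -
        have "{a<..b} \<subseteq> {x<..y}" "{b<..c} \<subseteq> {x<..y}"
          using ac trans by auto
        then have "emeasure m {a<..b} < \<infinity>" "emeasure m {b<..c} < \<infinity>"
          using that by (auto intro!: le_less_trans[OF emeasure_mono[of _ "{x<..y}" m]])
        then show ?thesis
          unfolding eq by (intro measure_Union) (auto simp: that)
      qed
      have "D a c = D a b + D b c"
        unfolding D_def
        using set_lebesgue_integral_split_Ioc[OF trans(3,4) ia(1) sets(1)]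
          set_lebesgue_integral_split_Ioc[OF trans(3,4) ia(2) sets(2)] by simp
      moreover have "\<bar>D a b\<bar> \<le> e * (measure m1 {a<..b} + measure m2 {a<..b})"
        "\<bar>D b c\<bar> \<le> e * (measure m1 {b<..c} + measure m2 {b<..c})"
        using trans ac by auto
      ultimately show "\<bar>D a c\<bar> \<le> e * (measure m1 {a<..c} + measure m2 {a<..c})"
        unfolding me[OF sets(1) fin(1)] me[OF sets(2) fin(2)] by (simp add: algebra_simps abs_le_iff)
    qed
  next
    case local: (2 s)
    \<comment> \<open>Half of \<open>e\<close> pays for the mean value step, the other half for
      replacing \<open>h\<close> by the constant \<open>h s\<close> in the two integrals.\<close>
    obtain d where d: "d > 0" "\<And>t. t \<in> {x..y} \<Longrightarrow> \<bar>t - s\<bar> < d \<Longrightarrow> \<bar>h t - h s\<bar> < e / 2"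
      using ch[unfolded continuous_on_iff, rule_format, of s "e / 2"] local \<open>e > 0\<close> by (auto simp: dist_real_def)
    have "\<bar>D u v\<bar> \<le> e * (measure m1 {u<..v} + measure m2 {u<..v})"
      if uv: "u \<le> s" "s \<le> v" "v - u < d" "x \<le> u" "v \<le> y" for u v
    proof -
      have hs: "\<bar>h t - h s\<bar> \<le> e / 2" if "u \<le> t" "t \<le> v" for t
      proof -
        have "t \<in> {x..y}" "\<bar>t - s\<bar> < d"
          using that uv by auto
        from d(2)[OF this] show ?thesis
          by linarith
      qed
      have "\<bar>f (M v) - f (M u) - h s * (M v - M u)\<bar> \<le> e / 2 * \<bar>M v - M u\<bar>"
      proof -
        have cuv: "continuous_on {u..v} M"
          by (rule continuous_on_subset[OF cM]) (use uv in auto)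
        \<comment> \<open>\<open>f\<close> is known to be differentiable only at values of
          \<open>M\<close>. Every number between \<open>M u\<close> and \<open>M v\<close> is such a
          value, so the mean value theorem applies and its point is \<open>M t\<close> with t close
          to s. \<open>M\<close> need not be monotone, hence min and max.\<close>
        have img: "\<exists>t\<in>{u..v}. M t = z" if "min (M u) (M v) \<le> z" "z \<le> max (M u) (M v)" for z
        proof (cases "M u \<le> M v")
          case True
          then show ?thesis
            using IVT'[of M u z v] cuv that uv by auto
        next
          case False
          then show ?thesis
            using IVT2'[of M v z u] cuv that uv by auto
        qed
        have der: "(f has_real_derivative g z) (at z)" if "min (M u) (M v) \<le> z" "z \<le> max (M u) (M v)" for z
          using img[OF that] f uv by auto
        have "\<exists>z. min (M u) (M v) \<le> z \<and> z \<le> max (M u) (M v) \<and> f (M v) - f (M u) = (M v - M u) * g z"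
        proof (cases "M u" "M v" rule: linorder_cases)
          case less
          then obtain z where "M u < z" "z < M v" "f (M v) - f (M u) = (M v - M u) * g z"
            using MVT2[of "M u" "M v" f g] der by auto
          then show ?thesis by (intro exI[of _ z]) auto
        next
          case greater
          then obtain z where "M v < z" "z < M u" "f (M u) - f (M v) = (M u - M v) * g z"
            using MVT2[of "M v" "M u" f g] der by auto
          then show ?thesis by (intro exI[of _ z]) (auto simp: algebra_simps)
        qed auto
        then obtain z where z: "min (M u) (M v) \<le> z" "z \<le> max (M u) (M v)"
          "f (M v) - f (M u) = (M v - M u) * g z"
          by blast
        obtain t where t: "t \<in> {u..v}" "M t = z"
          using img z by blast
        have "\<bar>g z - h s\<bar> \<le> e / 2"
          using hs[of t] t by (auto simp: h_def)
        then have "\<bar>g z - h s\<bar> * \<bar>M v - M u\<bar> \<le> e / 2 * \<bar>M v - M u\<bar>"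
          by (rule mult_right_mono) simp
        moreover have "f (M v) - f (M u) - h s * (M v - M u) = (g z - h s) * (M v - M u)"
          using z(3) by (simp add: algebra_simps)
        ultimately show ?thesis
          by (simp only: abs_mult)
      qed
      moreover have "\<bar>M v - M u\<bar> \<le> measure m1 {u<..v} + measure m2 {u<..v}"
        using M[of u v] uv by (auto simp: abs_le_iff intro: order_trans[OF _ add_increasing2] order_trans[OF _ add_increasing])
      then have "e / 2 * \<bar>M v - M u\<bar> \<le> e / 2 * (measure m1 {u<..v} + measure m2 {u<..v})"
        using \<open>e > 0\<close> by (intro mult_left_mono) auto
      moreover have "\<bar>(LINT t:{u<..v}|m1. h t) - h s * measure m1 {u<..v}\<bar> \<le> e / 2 * measure m1 {u<..v}"
        using hs uv by (intro close sets fin) auto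
      moreover have "\<bar>(LINT t:{u<..v}|m2. h t) - h s * measure m2 {u<..v}\<bar> \<le> e / 2 * measure m2 {u<..v}"
        using hs uv by (intro close sets fin) auto
      moreover have "h s * (M v - M u) = h s * measure m1 {u<..v} - h s * measure m2 {u<..v}"
        using M[of u v] uv by (simp add: right_diff_distrib[symmetric])
      moreover have "e * (measure m1 {u<..v} + measure m2 {u<..v})
          = 2 * (e / 2 * measure m1 {u<..v}) + 2 * (e / 2 * measure m2 {u<..v})"
        "e / 2 * (measure m1 {u<..v} + measure m2 {u<..v})
          = e / 2 * measure m1 {u<..v} + e / 2 * measure m2 {u<..v}"
        by (simp_all add: distrib_left)
      ultimately show ?thesis
        unfolding D_def by linarith
    qed
    then show ?case
      using \<open>d > 0\<close> by blast
  qed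
  define T where "T = measure m1 {x<..y} + measure m2 {x<..y}"
  have "\<bar>D x y\<bar> \<le> 0 + e" if "e > 0" for e
  proof -
    have "T \<ge> 0"
      by (simp add: T_def)
    \<comment> \<open>\<open>T\<close> can be 0, hence the denominator \<open>T + 1\<close>.\<close>
    then have "0 < e / (T + 1)" "e / (T + 1) * T \<le> e"
      using \<open>e > 0\<close> by (auto simp: field_simps)
    then show ?thesis
      using small[of "e / (T + 1)"] by (auto simp: T_def)
  qed
  then have "\<bar>D x y\<bar> \<le> 0"
    by (rule field_le_epsilon)
  then show "(LINT t:{x<..y}|m1. g (M t)) - (LINT t:{x<..y}|m2. g (M t)) = f (M y) - f (M x)"
    by (simp add: D_def h_def)
  show "set_integrable m1 {x<..y} (\<lambda>t. g (M t))"
    using i1 by (simp add: h_def)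
qed

text \<open>The case of a single measure, where \<open>M\<close> is nondecreasing:
  \<open>null_measure borel\<close> plays the part of \<open>m2\<close>.\<close>

lemma nn_integral_substitution_Ioc:
  fixes m :: "real measure" and M f g :: "real \<Rightarrow> real"
  assumes sets: "sets m = sets borel"
    and xy: "x \<le> y"
    and fin: "emeasure m {x<..y} < \<infinity>"
    and cM: "continuous_on {x..y} M"
    and M: "\<And>u v. x \<le> u \<Longrightarrow> u \<le> v \<Longrightarrow> v \<le> y \<Longrightarrow> M v - M u = measure m {u<..v}"
    and f: "\<And>t. t \<in> {x..y} \<Longrightarrow> (f has_real_derivative g (M t)) (at (M t))"
    and cg: "continuous_on (M ` {x..y}) g"
    and pos: "\<And>t. t \<in> {x..y} \<Longrightarrow> 0 \<le> g (M t)"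
  shows "(\<integral>\<^sup>+t\<in>{x<..y}. ennreal (g (M t)) \<partial>m) = ennreal (f (M y) - f (M x))"
proof -
  note sub = signed_integral_substitution[OF sets _ xy fin _ cM _ f cg, of "null_measure borel"]
  have int: "set_integrable m {x<..y} (\<lambda>t. g (M t))"
    by (rule sub) (auto simp: M)
  have "(LINT t:{x<..y}|m. g (M t)) - (LINT t:{x<..y}|null_measure borel. g (M t)) = f (M y) - f (M x)"
    by (rule sub) (auto simp: M)
  moreover have "(LINT t:{x<..y}|(null_measure borel :: real measure). g (M t)) = 0"
    unfolding set_lebesgue_integral_def by (rule integral_eq_zero_AE, rule AE_I[where N=UNIV]) auto
  ultimately have "(LINT t:{x<..y}|m. g (M t)) = f (M y) - f (M x)"
    by simp
  moreover have "(\<integral>\<^sup>+t\<in>{x<..y}. ennreal (g (M t)) \<partial>m) = (\<integral>\<^sup>+t. ennreal (indicator {x<..y} t *\<^sub>R g (M t)) \<partial>m)"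
    by (intro nn_integral_cong) (auto simp: indicator_def)
  moreover have "\<dots> = ennreal (LINT t:{x<..y}|m. g (M t))"
    unfolding set_lebesgue_integral_def
    by (rule nn_integral_eq_integral) (use int pos in \<open>auto simp: set_integrable_def indicator_def\<close>)
  ultimately show ?thesis
    by simp
qed

section \<open>Positivity intervals\<close>


text \<open>Positivity of \<open>h\<close> on \<open>I\<close> permits division, so \<open>r\<close>
  is recovered from \<open>m\<close>. This expresses rho1 through \<open>mu\<close> and G, and rho2
  through \<open>nu\<close> and F.\<close>

lemma density_inverse_on:
  fixes r m :: "real measure" and h :: "real \<Rightarrow> real"
  assumes sets: "sets r = sets borel" "sets m = sets borel"
    and I[measurable]: "I \<in> sets borel"
    and h: "continuous_on I h" "\<And>x. x \<in> I \<Longrightarrow> 0 < h x"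
    and null: "emeasure r (UNIV - I) = 0"
    and dens: "density r (\<lambda>x. ennreal (h x)) = restr m I"
  shows "r = density m (\<lambda>x. ennreal (indicator I x / h x))"
    and "\<And>f. f \<in> borel_measurable borel \<Longrightarrow>
      (\<integral>\<^sup>+x. f x * indicator I x \<partial>m) = (\<integral>\<^sup>+x. ennreal (indicator I x * h x) * f x \<partial>r)"
proof -
  note [measurable_cong] = sets
  have [measurable]: "(\<lambda>x. indicator I x * h x) \<in> borel_measurable borel"
    using borel_measurable_continuous_on_indicator[OF I h(1)] by simp
  have "(\<lambda>x. indicator I x *\<^sub>R (1 / h x)) \<in> borel_measurable borel"
    using h by (intro borel_measurable_continuous_on_indicator) (auto intro!: continuous_intros simp: less_imp_neq[symmetric])
  then have [measurable]: "(\<lambda>x. indicator I x / h x) \<in> borel_measurable borel"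
    by simp
  have AE_I: "AE x in r. x \<in> I"
    by (rule AE_I[where N="UNIV - I"]) (auto simp: sets null)
  \<comment> \<open>\<open>h\<close> is controlled only on \<open>I\<close>; replacing it by 0
    elsewhere changes nothing, since \<open>r\<close> has no mass there.\<close>
  have dens': "density r (\<lambda>x. ennreal (h x)) = density r (\<lambda>x. ennreal (indicator I x * h x))"
    unfolding density_def
  proof (intro arg_cong[where f="measure_of (space r) (sets r)"] ext nn_integral_cong_AE)
    fix A show "AE x in r. ennreal (h x) * indicator A x = ennreal (indicator I x * h x) * indicator A x"
      using AE_I by eventually_elim auto
  qed
  show *: "(\<integral>\<^sup>+x. f x * indicator I x \<partial>m) = (\<integral>\<^sup>+x. ennreal (indicator I x * h x) * f x \<partial>r)"
    if [measurable]: "f \<in> borel_measurable borel" for f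
  proof -
    have "(\<integral>\<^sup>+x. f x * indicator I x \<partial>m) = (\<integral>\<^sup>+x. f x \<partial>restr m I)"
      unfolding restr_def by (subst nn_integral_density) (auto simp: mult.commute)
    also have "\<dots> = (\<integral>\<^sup>+x. ennreal (indicator I x * h x) * f x \<partial>r)"
      unfolding dens[symmetric] dens' by (subst nn_integral_density) auto
    finally show ?thesis .
  qed
  show "r = density m (\<lambda>x. ennreal (indicator I x / h x))"
  proof (rule measure_eqI)
    show "sets r = sets (density m (\<lambda>x. ennreal (indicator I x / h x)))"
      by (simp add: sets)
    fix A assume "A \<in> sets r"
    then have [measurable]: "A \<in> sets borel"
      by (simp add: sets)
    have "emeasure (density m (\<lambda>x. ennreal (indicator I x / h x))) A
        = (\<integral>\<^sup>+x. ennreal (indicator I x / h x) * indicator A x \<partial>m)"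
      by (rule emeasure_density) auto
    also have "\<dots> = (\<integral>\<^sup>+x. (ennreal (indicator I x / h x) * indicator A x) * indicator I x \<partial>m)"
      by (intro nn_integral_cong) (auto simp: indicator_def)
    also have "\<dots> = (\<integral>\<^sup>+x. ennreal (indicator I x * h x) * (ennreal (indicator I x / h x) * indicator A x) \<partial>r)"
      by (rule *) auto
    also have "\<dots> = (\<integral>\<^sup>+x. indicator A x \<partial>r)"
      using AE_I
    proof (intro nn_integral_cong_AE, eventually_elim)
      case (elim x)
      then show ?case
        using h(2)[of x] by (auto simp: indicator_def ennreal_mult[symmetric])
    qed
    also have "\<dots> = emeasure r A"
      by simp
    finally show "emeasure r A = emeasure (density m (\<lambda>x. ennreal (indicator I x / h x))) A" ..
  qed
qed

text \<open>The conditions are symmetric in \<open>mu\<close> and \<open>nu\<close>, so each result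
  on positive \<open>Fcal\<close> transfers to negative \<open>Fcal\<close> through
  \<open>swap\<close>. Absolute continuity and compact support are present as the absence of atoms
  and as \<open>vanish\<close>.\<close>

locale transport_pair =
  fixes mu nu :: "real measure"
  assumes prob_mu: "prob_space mu" and prob_nu: "prob_space nu"
    and sets_mu: "sets mu = sets borel" and sets_nu: "sets nu = sets borel"
    and atomless_mu: "\<And>x. emeasure mu {x} = 0" and atomless_nu: "\<And>x. emeasure nu {x} = 0"
    and vanish: "\<exists>R. \<forall>t. R < \<bar>t\<bar> \<longrightarrow> Fcal mu nu t = 0"
begin

sublocale mu: real_distribution mu
  using prob_mu sets_mu by (auto simp: real_distribution_def real_distribution_axioms_def dest: sets_eq_imp_space_eq)

sublocale nu: real_distribution nu
  using prob_nu sets_nu by (auto simp: real_distribution_def real_distribution_axioms_def dest: sets_eq_imp_space_eq)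

lemma Fcal_swap: "Fcal nu mu t = - Fcal mu nu t"
  by (simp add: Fcal_def)

lemma Aminus_swap: "Aminus mu nu = Aplus nu mu" "Aplus mu nu = Aminus nu mu" "Aeq mu nu = Aeq nu mu"
  by (auto simp: Aminus_def Aplus_def Aeq_def)

lemma Aplus_iff: "t \<in> Aplus mu nu \<longleftrightarrow> 0 < Fcal mu nu t"
  and Aminus_iff: "t \<in> Aminus mu nu \<longleftrightarrow> Fcal mu nu t < 0"
  and Aeq_iff: "t \<in> Aeq mu nu \<longleftrightarrow> Fcal mu nu t = 0"
  by (auto simp: Aplus_def Aminus_def Aeq_def Fcal_def)

lemma swap: "transport_pair nu mu"
  using prob_mu prob_nu sets_mu sets_nu atomless_mu atomless_nu vanish
  by unfold_locales (auto simp: Fcal_swap)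

lemma continuous_Fcal: "continuous_on S (Fcal mu nu)"
  unfolding Fcal_def
  by (intro continuous_at_imp_continuous_on ballI continuous_intros)
    (simp_all add: mu.isCont_cdf nu.isCont_cdf measure_def atomless_mu atomless_nu)

lemma Fcal_measurable [measurable]: "Fcal mu nu \<in> borel_measurable borel"
  by (rule borel_measurable_continuous_onI[OF continuous_Fcal])

lemma sets_A [measurable]:
  "Aplus mu nu \<in> sets borel" "Aminus mu nu \<in> sets borel" "Aeq mu nu \<in> sets borel"
proof -
  have "Aplus mu nu = {t \<in> space borel. 0 < Fcal mu nu t}" "Aminus mu nu = {t \<in> space borel. Fcal mu nu t < 0}"
    "Aeq mu nu = {t \<in> space borel. Fcal mu nu t = 0}"
    by (auto simp: Aplus_iff Aminus_iff Aeq_iff)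
  then show "Aplus mu nu \<in> sets borel" "Aminus mu nu \<in> sets borel" "Aeq mu nu \<in> sets borel"
    by simp_all
qed

lemma Fcal_diff: "u \<le> v \<Longrightarrow> Fcal mu nu v - Fcal mu nu u = measure mu {u<..v} - measure nu {u<..v}"
  using mu.cdf_diff_eq[of u v] nu.cdf_diff_eq[of u v] by (cases "u = v") (auto simp: Fcal_def)

definition positivity_interval :: "real \<Rightarrow> real \<Rightarrow> bool" where
  "positivity_interval a b \<longleftrightarrow> a < b \<and> Fcal mu nu a = 0 \<and> Fcal mu nu b = 0 \<and> (\<forall>t\<in>{a<..<b}. 0 < Fcal mu nu t)"

text \<open>If \<open>Fcal\<close> were positive at an end point, adding that point would give a
  larger connected subset of \<open>Aplus mu nu\<close>; negative values are excluded by
  continuity.\<close>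

lemma component_positivity_interval:
  assumes "{a<..<b} \<in> components (Aplus mu nu)"
  shows "positivity_interval a b"
proof -
  have ab: "a < b"
    using in_components_nonempty[OF assms] by auto
  have sub: "{a<..<b} \<subseteq> Aplus mu nu"
    using in_components_subset[OF assms] .
  have maximal: "T \<subseteq> {a<..<b}" if "connected T" "T \<subseteq> Aplus mu nu" "T \<inter> {a<..<b} \<noteq> {}" for T
    using components_maximal[OF assms that(1,2)] that(3) by auto
  have nonneg: "0 \<le> Fcal mu nu c" if "c = a \<or> c = b" for c
  proof -
    have "c \<in> closure {a<..<b}"
      using that ab by auto
    then show ?thesis
      by (rule continuous_ge_on_closure[OF continuous_Fcal]) (use sub in \<open>auto simp: Aplus_iff less_imp_le\<close>)
  qed
  have "Fcal mu nu a = 0"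
  proof (rule ccontr)
    assume "Fcal mu nu a \<noteq> 0"
    then have "connected {a..<b}" "{a..<b} \<subseteq> Aplus mu nu"
      using nonneg[of a] sub by (auto simp: Aplus_iff less_eq_real_def)
    moreover have "(a + b) / 2 \<in> {a..<b} \<inter> {a<..<b}"
      using ab by auto
    ultimately have "{a..<b} \<subseteq> {a<..<b}"
      by (intro maximal) blast+
    then show False
      using ab by auto
  qed
  moreover have "Fcal mu nu b = 0"
  proof (rule ccontr)
    assume "Fcal mu nu b \<noteq> 0"
    then have "connected {a<..b}" "{a<..b} \<subseteq> Aplus mu nu"
      using nonneg[of b] sub by (auto simp: Aplus_iff less_eq_real_def)
    moreover have "(a + b) / 2 \<in> {a<..b} \<inter> {a<..<b}"
      using ab by auto
    ultimately have "{a<..b} \<subseteq> {a<..<b}"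
      by (intro maximal) blast+
    then show False
      using ab by auto
  qed
  ultimately show ?thesis
    using ab sub by (auto simp: positivity_interval_def Aplus_iff)
qed

lemma positivity_interval_exists:
  assumes x: "0 < Fcal mu nu x"
  obtains a b where "positivity_interval a b" "x \<in> {a<..<b}"
proof -
  obtain R where R: "\<And>t. R < \<bar>t\<bar> \<Longrightarrow> Fcal mu nu t = 0"
    using vanish by auto
  define K where "K = {t. Fcal mu nu t \<le> 0}"
  have K: "closed K"
    unfolding K_def by (intro closed_Collect_le continuous_Fcal continuous_intros)
  \<comment> \<open>Large enough for \<open>Fcal\<close> to vanish at both signs of \<open>r\<close>
    and for \<open>x\<close> to lie between them, so the sets defining \<open>a\<close> and
    \<open>b\<close> are nonempty.\<close>
  define r where "r = \<bar>R\<bar> + \<bar>x\<bar> + 1"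
  have r: "- r \<in> K \<inter> {..x}" "r \<in> K \<inter> {x..}"
    using R[of r] R[of "- r"] by (auto simp: K_def r_def)
  define a where "a = Sup (K \<inter> {..x})"
  define b where "b = Inf (K \<inter> {x..})"
  have bdd: "bdd_above (K \<inter> {..x})" "bdd_below (K \<inter> {x..})"
    by (auto intro: bdd_aboveI[of _ x] bdd_belowI[of _ x])
  have a: "a \<in> K \<inter> {..x}"
    unfolding a_def using r bdd K by (intro closed_contains_Sup) auto
  have b: "b \<in> K \<inter> {x..}"
    unfolding b_def using r bdd K by (intro closed_contains_Inf) auto
  have x': "x \<notin> K"
    using x by (auto simp: K_def)
  have ax: "a < x" and xb: "x < b"
    using a b x' by (auto simp: less_eq_real_def)
  have pos: "0 < Fcal mu nu t" if "t \<in> {a<..<b}" for t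
  proof (rule ccontr)
    assume "\<not> 0 < Fcal mu nu t"
    then have "t \<in> K"
      by (auto simp: K_def)
    then show False
      using cSup_upper[OF _ bdd(1), of t] cInf_lower[OF _ bdd(2), of t] that
      by (cases "t \<le> x") (auto simp: a_def b_def)
  qed
  have "0 \<le> Fcal mu nu c" if "c = a \<or> c = b" for c
  proof -
    have "c \<in> closure {a<..<b}"
      using that ax xb by auto
    then show ?thesis
      by (rule continuous_ge_on_closure[OF continuous_Fcal]) (use pos in \<open>auto simp: less_imp_le\<close>)
  qed
  then have "Fcal mu nu a = 0" "Fcal mu nu b = 0"
    using a b by (auto simp: K_def intro: antisym)
  with ax xb pos show ?thesis
    by (intro that[of a b]) (auto simp: positivity_interval_def)
qed

end

section \<open>Densities on a positivity interval\<close>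


context transport_pair
begin

text \<open>The integrand is \<open>0\<close> on \<open>Aeq mu nu\<close>, because \<open>1 / 0 = 0\<close>.\<close>
definition log_ratio :: "real \<Rightarrow> real \<Rightarrow> ennreal" where
  "log_ratio x y = (\<integral>\<^sup>+t. ennreal (1 / \<bar>Fcal mu nu t\<bar>) * indicator ({x..<y} \<union> {y..<x}) t \<partial>mu)"

text \<open>The pairs joined without touching a zero of \<open>Fcal\<close>, together with the
  diagonal for mass that stays in place. Asking for the closed segment makes the set open off the
  diagonal, hence Borel whatever the number of components.\<close>

definition admissible :: "(real \<times> real) set" where
  "admissible = {(x, y). (x < y \<longrightarrow> {x..y} \<subseteq> Aplus mu nu) \<and> (y < x \<longrightarrow> {y..x} \<subseteq> Aminus mu nu)}"

text \<open>The density of the optimal plan off \<open>Aeq mu nu\<close>. By the identities of the locale \<open>interval_data\<close>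
  below it equals \<open>1 / (G x * F y)\<close>; this expression does not depend on the choice of \<open>F\<close> and \<open>G\<close>.\<close>
definition kernel :: "real \<Rightarrow> real \<Rightarrow> ennreal" where
  "kernel x y = ennreal (exp (- enn2real (log_ratio x y)) / \<bar>Fcal mu nu x\<bar>)
     * indicator (admissible - {(x, y). x = y}) (x, y)"

end

text \<open>The data are arbitrary, because the theorem speaks of every solution of the system. The
  product of F and G and the ratios F y / F x and G x / G y turn out to depend on \<open>mu\<close>
  and \<open>nu\<close> alone.\<close>

locale interval_data = transport_pair +
  fixes a b :: real and r1 r2 :: "real measure" and F G :: "real \<Rightarrow> real"
  assumes interval: "positivity_interval a b"
    and data: "pos_data mu nu a b r1 r2 F G"
begin

lemma ab: "a < b" and Fcal_ends: "Fcal mu nu a = 0" "Fcal mu nu b = 0"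
  and Fcal_pos: "\<And>t. a < t \<Longrightarrow> t < b \<Longrightarrow> 0 < Fcal mu nu t"
  using interval by (auto simp: positivity_interval_def)

lemma sets_r [measurable_cong, simp]: "sets r1 = sets borel" "sets r2 = sets borel"
  and cF: "continuous_on {a<..<b} F" and cG: "continuous_on {a<..<b} G"
  and F_pos: "\<And>t. a < t \<Longrightarrow> t < b \<Longrightarrow> 0 < F t" and G_pos: "\<And>t. a < t \<Longrightarrow> t < b \<Longrightarrow> 0 < G t"
  and G_eq: "\<And>x. a < x \<Longrightarrow> x < b \<Longrightarrow> emeasure r2 {x..<b} = ennreal (G x)"
  and F_eq: "\<And>x. a < x \<Longrightarrow> x < b \<Longrightarrow> emeasure r1 {a<..x} = ennreal (F x)"
  using data by (auto simp: pos_data_def)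

lemma dens:
  "density r1 (\<lambda>x. ennreal (G x)) = restr mu {a<..<b}" "density r2 (\<lambda>x. ennreal (F x)) = restr nu {a<..<b}"
  "emeasure r1 (UNIV - {a<..<b}) = 0" "emeasure r2 (UNIV - {a<..<b}) = 0"
  using data by (auto simp: pos_data_def)

lemma r1_eq: "r1 = density mu (\<lambda>x. ennreal (indicator {a<..<b} x / G x))"
  and mu_r1: "\<And>f. f \<in> borel_measurable borel \<Longrightarrow>
    (\<integral>\<^sup>+x. f x * indicator {a<..<b} x \<partial>mu) = (\<integral>\<^sup>+x. ennreal (indicator {a<..<b} x * G x) * f x \<partial>r1)"
  by (rule density_inverse_on[OF _ _ _ cG _ dens(3,1)]; simp add: G_pos sets_mu)+

lemma r2_eq: "r2 = density nu (\<lambda>x. ennreal (indicator {a<..<b} x / F x))"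
  and nu_r2: "\<And>f. f \<in> borel_measurable borel \<Longrightarrow>
    (\<integral>\<^sup>+x. f x * indicator {a<..<b} x \<partial>nu) = (\<integral>\<^sup>+x. ennreal (indicator {a<..<b} x * F x) * f x \<partial>r2)"
  by (rule density_inverse_on[OF _ _ _ cF _ dens(4,2)]; simp add: F_pos sets_nu)+

lemma inverse_measurable [measurable]:
  "(\<lambda>x. indicator {a<..<b} x / G x) \<in> borel_measurable borel"
  "(\<lambda>x. indicator {a<..<b} x / F x) \<in> borel_measurable borel"
proof -
  have "(\<lambda>x. indicator {a<..<b} x *\<^sub>R (1 / G x)) \<in> borel_measurable borel"
    "(\<lambda>x. indicator {a<..<b} x *\<^sub>R (1 / F x)) \<in> borel_measurable borel"
    using G_pos F_pos
    by (intro borel_measurable_continuous_on_indicator continuous_intros cF cG;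
        force simp: less_imp_neq[symmetric])+
  then show "(\<lambda>x. indicator {a<..<b} x / G x) \<in> borel_measurable borel"
    "(\<lambda>x. indicator {a<..<b} x / F x) \<in> borel_measurable borel"
    by simp_all
qed

lemma FG_measurable [measurable]:
  "(\<lambda>x. indicator {a<..<b} x * G x) \<in> borel_measurable borel"
  "(\<lambda>x. indicator {a<..<b} x * F x) \<in> borel_measurable borel"
  using borel_measurable_continuous_on_indicator[OF _ cF] borel_measurable_continuous_on_indicator[OF _ cG]
  by simp_all

lemma nn_integral_r1: "f \<in> borel_measurable borel \<Longrightarrow>
    (\<integral>\<^sup>+x. f x \<partial>r1) = (\<integral>\<^sup>+x. ennreal (indicator {a<..<b} x / G x) * f x \<partial>mu)"
  by (subst r1_eq) (subst nn_integral_density; simp add: sets_mu cong: measurable_cong_sets)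

lemma nn_integral_r2: "f \<in> borel_measurable borel \<Longrightarrow>
    (\<integral>\<^sup>+x. f x \<partial>r2) = (\<integral>\<^sup>+x. ennreal (indicator {a<..<b} x / F x) * f x \<partial>nu)"
  by (subst r2_eq) (subst nn_integral_density; simp add: sets_nu cong: measurable_cong_sets)

text \<open>The masses can be infinite, as \<open>G\<close> and \<open>F\<close> may tend to 0 at an
  end of the interval. Tonelli only asks for sigma-finiteness, which a finite density over a
  probability measure provides.\<close>

lemma sigma_finite_r: "sigma_finite_measure r1" "sigma_finite_measure r2"
proof -
  show "sigma_finite_measure r1"
    by (subst r1_eq, subst mu.sigma_finite_iff_density_finite) (simp_all add: sets_mu cong: measurable_cong_sets)
  show "sigma_finite_measure r2"
    by (subst r2_eq, subst nu.sigma_finite_iff_density_finite) (simp_all add: sets_nu cong: measurable_cong_sets)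
qed

lemma atomless_r: "emeasure r1 {x} = 0" "emeasure r2 {x} = 0"
proof -
  have "{x} \<in> null_sets mu" "{x} \<in> null_sets nu"
    by (auto simp: null_sets_def sets_mu sets_nu atomless_mu atomless_nu)
  then have "(\<integral>\<^sup>+t. f t * indicator {x} t \<partial>mu) = 0" "(\<integral>\<^sup>+t. f t * indicator {x} t \<partial>nu) = 0" for f :: "real \<Rightarrow> ennreal"
    by (simp_all only: nn_integral_null_set)
  moreover have "emeasure r1 {x} = (\<integral>\<^sup>+t. indicator {x} t \<partial>r1)" "emeasure r2 {x} = (\<integral>\<^sup>+t. indicator {x} t \<partial>r2)"
    by simp_all
  ultimately show "emeasure r1 {x} = 0" "emeasure r2 {x} = 0"
    by (simp_all only: nn_integral_r1 nn_integral_r2 borel_measurable_indicator borel_singleton sets.empty_sets)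
qed

lemma r1_Ioc:
  assumes "a < x" "x \<le> y" "y < b"
  shows "emeasure r1 {x<..y} = ennreal (F y - F x)" "F x \<le> F y"
proof -
  have "emeasure r1 {a<..y} = emeasure r1 ({a<..x} \<union> {x<..y})"
    using assms by (intro arg_cong[where f="emeasure r1"]) auto
  also have "\<dots> = emeasure r1 {a<..x} + emeasure r1 {x<..y}"
    by (intro plus_emeasure[symmetric]) auto
  finally have *: "ennreal (F y) = ennreal (F x) + emeasure r1 {x<..y}"
    using assms by (simp add: F_eq)
  have "0 \<le> F y"
    using F_pos[of y] assms by simp
  moreover have "ennreal (F x) \<le> ennreal (F y)"
    unfolding * by simp
  ultimately show "F x \<le> F y"
    by (simp only: ennreal_le_iff)
  have "emeasure r1 {x<..y} = ennreal (F y) - ennreal (F x)"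
    unfolding * by simp
  then show "emeasure r1 {x<..y} = ennreal (F y - F x)"
    using F_pos[of x] assms by (simp add: ennreal_minus less_imp_le)
qed

lemma r2_Ioo:
  assumes "a < x" "x < b"
  shows "emeasure r2 {x<..<b} = ennreal (G x)"
proof -
  have "emeasure r2 {x..<b} = emeasure r2 ({x} \<union> {x<..<b})"
    using assms by (intro arg_cong[where f="emeasure r2"]) auto
  also have "\<dots> = emeasure r2 {x} + emeasure r2 {x<..<b}"
    by (intro plus_emeasure[symmetric]) auto
  finally show ?thesis
    using assms by (simp add: G_eq atomless_r)
qed

lemma r1_Ioo:
  assumes "a < x" "x < b"
  shows "emeasure r1 {a<..<x} = ennreal (F x)"
proof -
  have "emeasure r1 {a<..x} = emeasure r1 ({x} \<union> {a<..<x})"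
    using assms by (intro arg_cong[where f="emeasure r1"]) auto
  also have "\<dots> = emeasure r1 {x} + emeasure r1 {a<..<x}"
    by (intro plus_emeasure[symmetric]) auto
  finally show ?thesis
    using assms by (simp add: F_eq atomless_r)
qed

lemma r2_Ioc:
  assumes "a < x" "x \<le> y" "y < b"
  shows "emeasure r2 {x<..y} = ennreal (G x - G y)" "G y \<le> G x"
proof -
  have "emeasure r2 {x<..<b} = emeasure r2 ({y<..<b} \<union> {x<..y})"
    using assms by (intro arg_cong[where f="emeasure r2"]) auto
  also have "\<dots> = emeasure r2 {y<..<b} + emeasure r2 {x<..y}"
    by (intro plus_emeasure[symmetric]) auto
  finally have *: "ennreal (G x) = ennreal (G y) + emeasure r2 {x<..y}"
    using assms by (simp add: r2_Ioo)
  have "0 \<le> G x"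
    using G_pos[of x] assms by simp
  moreover have "ennreal (G y) \<le> ennreal (G x)"
    unfolding * by simp
  ultimately show "G y \<le> G x"
    by (simp only: ennreal_le_iff)
  have "emeasure r2 {x<..y} = ennreal (G x) - ennreal (G y)"
    unfolding * by simp
  then show "emeasure r2 {x<..y} = ennreal (G x - G y)"
    using G_pos[of y] assms by (simp add: ennreal_minus less_imp_le)
qed

text \<open>Both sides are compared through the \<open>r1 \<otimes> r2\<close>-mass of \<open>{(x, y). a < x \<le> y \<le> T}\<close>, which the
  Tonelli theorem turns into \<open>nu {a<..T}\<close>.\<close>
lemma FG_eq:
  assumes T: "a < T" "T < b"
  shows "F T * G T = Fcal mu nu T"
proof -
  interpret r1: sigma_finite_measure r1 by (rule sigma_finite_r)
  interpret r2: sigma_finite_measure r2 by (rule sigma_finite_r)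
  interpret r: pair_sigma_finite r1 r2 ..
  have "emeasure nu {a<..T} = (\<integral>\<^sup>+x. indicator {a<..T} x \<partial>nu)"
    by (simp add: sets_nu)
  also have "\<dots> = (\<integral>\<^sup>+x. indicator {a<..T} x * indicator {a<..<b} x \<partial>nu)"
    using T by (intro nn_integral_cong) (auto simp: indicator_def)
  also have "\<dots> = (\<integral>\<^sup>+y. ennreal (indicator {a<..<b} y * F y) * indicator {a<..T} y \<partial>r2)"
    by (rule nu_r2) simp
  also have "\<dots> = (\<integral>\<^sup>+y. (\<integral>\<^sup>+x. indicator {a<..y} x * indicator {a<..T} y \<partial>r1) \<partial>r2)"
  proof (intro nn_integral_cong)
    fix y
    show "ennreal (indicator {a<..<b} y * F y) * indicator {a<..T} y = (\<integral>\<^sup>+x. indicator {a<..y} x * indicator {a<..T} y \<partial>r1)"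
      using T by (cases "y \<in> {a<..T}") (auto simp: F_eq)
  qed
  also have "\<dots> = (\<integral>\<^sup>+x. (\<integral>\<^sup>+y. indicator {a<..y} x * indicator {a<..T} y \<partial>r2) \<partial>r1)"
    by (rule r.Fubini') (simp add: indicator_def cong: if_cong)
  also have "\<dots> = (\<integral>\<^sup>+x. indicator {a<..T} x * emeasure r2 {x..T} \<partial>r1)"
  proof (intro nn_integral_cong)
    fix x
    have "(\<integral>\<^sup>+y. indicator {a<..y} x * indicator {a<..T} y \<partial>r2) = (\<integral>\<^sup>+y. indicator {a<..T} x * indicator {x..T} y \<partial>r2)"
      by (intro nn_integral_cong) (auto simp: indicator_def)
    then show "(\<integral>\<^sup>+y. indicator {a<..y} x * indicator {a<..T} y \<partial>r2) = indicator {a<..T} x * emeasure r2 {x..T}"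
      by (simp add: nn_integral_cmult)
  qed
  finally have nu: "emeasure nu {a<..T} = (\<integral>\<^sup>+x. indicator {a<..T} x * emeasure r2 {x..T} \<partial>r1)" .
  have [measurable]: "(\<lambda>x. emeasure r2 {x..T}) \<in> borel_measurable r1"
  proof -
    have "(\<lambda>x. \<integral>\<^sup>+y. indicator {x..T} y \<partial>r2) \<in> borel_measurable r1"
      by (rule r2.borel_measurable_nn_integral) (simp add: indicator_def cong: if_cong)
    then show ?thesis by simp
  qed
  have "emeasure mu {a<..T} = (\<integral>\<^sup>+x. indicator {a<..T} x \<partial>mu)"
    by (simp add: sets_mu)
  also have "\<dots> = (\<integral>\<^sup>+x. indicator {a<..T} x * indicator {a<..<b} x \<partial>mu)"
    using T by (intro nn_integral_cong) (auto simp: indicator_def)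
  also have "\<dots> = (\<integral>\<^sup>+x. ennreal (indicator {a<..<b} x * G x) * indicator {a<..T} x \<partial>r1)"
    by (rule mu_r1) simp
  \<comment> \<open>Cutting \<open>{x..<b}\<close> at \<open>T\<close> separates the part of
    \<open>G x\<close> that accounts for \<open>nu {a<..T}\<close> from the constant
    \<open>G T\<close>, whose integral is \<open>F T * G T\<close>.\<close>
  also have "\<dots> = (\<integral>\<^sup>+x. indicator {a<..T} x * emeasure r2 {x..T} + indicator {a<..T} x * ennreal (G T) \<partial>r1)"
  proof (intro nn_integral_cong)
    fix x
    have "emeasure r2 {x..<b} = emeasure r2 ({x..T} \<union> {T<..<b})" if "x \<le> T"
      using T that by (intro arg_cong[where f="emeasure r2"]) auto
    also have "\<dots> = emeasure r2 {x..T} + emeasure r2 {T<..<b}"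
      by (intro plus_emeasure[symmetric]) auto
    finally show "ennreal (indicator {a<..<b} x * G x) * indicator {a<..T} x =
      indicator {a<..T} x * emeasure r2 {x..T} + indicator {a<..T} x * ennreal (G T)"
      using T by (auto simp: indicator_def r2_Ioo G_eq)
  qed
  also have "\<dots> = emeasure nu {a<..T} + emeasure r1 {a<..T} * ennreal (G T)"
    unfolding nu by (subst nn_integral_add) (auto simp: nn_integral_multc)
  also have "\<dots> = emeasure nu {a<..T} + ennreal (F T * G T)"
    using T by (simp add: F_eq ennreal_mult less_imp_le F_pos G_pos)
  finally have "measure mu {a<..T} = measure nu {a<..T} + F T * G T"
    using T F_pos[of T] G_pos[of T]
    by (simp add: mu.emeasure_eq_measure nu.emeasure_eq_measure less_imp_le flip: ennreal_plus)
  then show ?thesis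
    using Fcal_diff[of a T] T Fcal_ends by simp
qed

text \<open>d ln F = dr1 / F = dmu / (G F) = dmu / Fcal by \<open>FG_eq\<close>, and the last
  expression no longer involves the chosen data.\<close>

lemma ln_F_diff:
  assumes "a < x" "x \<le> y" "y < b"
  shows "(\<integral>\<^sup>+t\<in>{x<..y}. ennreal (1 / Fcal mu nu t) \<partial>mu) = ennreal (ln (F y) - ln (F x))"
proof -
  have "(\<integral>\<^sup>+t\<in>{x<..y}. ennreal (1 / F t) \<partial>r1) = ennreal (ln (F y) - ln (F x))"
  proof (rule nn_integral_substitution_Ioc)
    show "continuous_on {x..y} F"
      by (rule continuous_on_subset[OF cF]) (use assms in auto)
    show "F v - F u = measure r1 {u<..v}" if "x \<le> u" "u \<le> v" "v \<le> y" for u v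
      using r1_Ioc[of u v] that assms by (simp add: measure_def)
    show "continuous_on (F ` {x..y}) ((/) 1)"
      using F_pos assms by (intro continuous_intros) (force simp: less_imp_neq[symmetric])
  qed (use assms F_pos r1_Ioc[of x y] in \<open>auto intro!: derivative_eq_intros simp: less_imp_le\<close>)
  moreover have "(\<integral>\<^sup>+t\<in>{x<..y}. ennreal (1 / F t) \<partial>r1)
      = (\<integral>\<^sup>+t. ennreal (indicator {a<..<b} t / F t) * indicator {x<..y} t \<partial>r1)"
    using assms by (intro nn_integral_cong) (auto simp: indicator_def)
  moreover have "\<dots> = (\<integral>\<^sup>+t. ennreal (indicator {a<..<b} t / G t) * (ennreal (indicator {a<..<b} t / F t) * indicator {x<..y} t) \<partial>mu)"
    by (rule nn_integral_r1) simp
  moreover have "\<dots> = (\<integral>\<^sup>+t\<in>{x<..y}. ennreal (1 / Fcal mu nu t) \<partial>mu)"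
    using assms F_pos G_pos
    by (intro nn_integral_cong) (auto simp: indicator_def less_imp_le mult.commute simp flip: FG_eq ennreal_mult)
  ultimately show ?thesis
    by simp
qed

text \<open>The mirror image: - d ln G = dr2 / G = dnu / (F G) = dnu / Fcal.\<close>

lemma ln_G_diff:
  assumes "a < x" "x \<le> y" "y < b"
  shows "(\<integral>\<^sup>+t\<in>{x<..y}. ennreal (1 / Fcal mu nu t) \<partial>nu) = ennreal (ln (G x) - ln (G y))"
proof -
  \<comment> \<open>\<open>G\<close> is nonincreasing, so the substitution is made with - G and f s
    = - ln (- s).\<close>
  have "(\<integral>\<^sup>+t\<in>{x<..y}. ennreal (- 1 / (- G t)) \<partial>r2) = ennreal ((- ln (- (- G y))) - (- ln (- (- G x))))"
  proof (rule nn_integral_substitution_Ioc[where f="\<lambda>s. - ln (- s)" and M="\<lambda>t. - G t"])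
    show "continuous_on {x..y} (\<lambda>t. - G t)"
      by (intro continuous_intros continuous_on_subset[OF cG]) (use assms in auto)
    show "(- G v) - (- G u) = measure r2 {u<..v}" if "x \<le> u" "u \<le> v" "v \<le> y" for u v
      using r2_Ioc[of u v] that assms by (simp add: measure_def)
    show "continuous_on ((\<lambda>t. - G t) ` {x..y}) ((/) (- 1))"
      using G_pos assms by (intro continuous_intros) (force simp: less_imp_neq[symmetric])
  qed (use assms G_pos r2_Ioc[of x y] in \<open>auto intro!: derivative_eq_intros simp: less_imp_le\<close>)
  moreover have "(\<integral>\<^sup>+t\<in>{x<..y}. ennreal (- 1 / (- G t)) \<partial>r2)
      = (\<integral>\<^sup>+t. ennreal (indicator {a<..<b} t / G t) * indicator {x<..y} t \<partial>r2)"
    using assms by (intro nn_integral_cong) (auto simp: indicator_def)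
  moreover have "\<dots> = (\<integral>\<^sup>+t. ennreal (indicator {a<..<b} t / F t) * (ennreal (indicator {a<..<b} t / G t) * indicator {x<..y} t) \<partial>nu)"
    by (rule nn_integral_r2) simp
  moreover have "\<dots> = (\<integral>\<^sup>+t\<in>{x<..y}. ennreal (1 / Fcal mu nu t) \<partial>nu)"
    using assms F_pos G_pos
    by (intro nn_integral_cong) (auto simp: indicator_def less_imp_le mult.commute simp flip: FG_eq ennreal_mult)
  ultimately show ?thesis
    by simp
qed

end

section \<open>The kernel of the optimal plan\<close>


text \<open>A closed segment inside an open set extends a little beyond both ends, so the set is the
  union of the open squares over the intervals contained in \<open>U\<close>.\<close>

lemma open_intervals_inside:
  fixes U :: "real set"
  assumes U: "open U"
  shows "open {(x, y). {min x y..max x y} \<subseteq> U}"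
proof -
  have "{(x, y). {min x y..max x y} \<subseteq> U} = (\<Union>(p, q)\<in>{(p, q). {p<..<q} \<subseteq> U}. {p<..<q} \<times> {p<..<q})"
  proof (intro set_eqI iffI; clarify)
    fix x y assume xy: "{min x y..max x y} \<subseteq> U"
    then have "min x y \<in> U" "max x y \<in> U"
      by auto
    then obtain d e where d: "d > 0" "ball (min x y) d \<subseteq> U" and e: "e > 0" "ball (max x y) e \<subseteq> U"
      using U by (metis open_contains_ball)
    have "t \<in> U" if "min x y - d < t" "t < max x y + e" for t
    proof -
      consider "t < min x y" | "t \<in> {min x y..max x y}" | "max x y < t"
        by fastforce
      then show ?thesis
      proof cases
        case 1
        then have "t \<in> ball (min x y) d"
          using that by (simp add: dist_real_def)
        then show ?thesis using d by auto
      next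
        case 3
        then have "t \<in> ball (max x y) e"
          using that by (simp add: dist_real_def)
        then show ?thesis using e by auto
      qed (use xy in auto)
    qed
    then have "{min x y - d<..<max x y + e} \<subseteq> U"
      by auto
    moreover have "x \<in> {min x y - d<..<max x y + e}" "y \<in> {min x y - d<..<max x y + e}"
      using d e by auto
    ultimately show "(x, y) \<in> (\<Union>(p, q)\<in>{(p, q). {p<..<q} \<subseteq> U}. {p<..<q} \<times> {p<..<q})"
      by blast
  next
    fix x y p q :: real and t assume *: "{p<..<q} \<subseteq> U" "x \<in> {p<..<q}" "y \<in> {p<..<q}" "t \<in> {min x y..max x y}"
    then have "t \<in> {p<..<q}"
      by auto
    then show "t \<in> U" using * by blast
  qed
  then show ?thesis
    by (auto intro!: open_UN open_Times)
qed

section \<open>Borel measurability of the kernel\<close>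

context transport_pair
begin

lemma open_A: "open (Aplus mu nu)" "open (Aminus mu nu)"
proof -
  have "Aplus mu nu = {t. 0 < Fcal mu nu t}" "Aminus mu nu = {t. Fcal mu nu t < 0}"
    by (auto simp: Aplus_iff Aminus_iff)
  then show "open (Aplus mu nu)" "open (Aminus mu nu)"
    by (auto intro!: open_Collect_less continuous_Fcal continuous_intros)
qed

lemma sets_admissible [measurable]: "admissible \<in> sets (borel \<Otimes>\<^sub>M borel)"
proof -
  have eq: "admissible = {(x, y). x = y} \<union> ({p. fst p < snd p} \<inter> {(x, y). {min x y..max x y} \<subseteq> Aplus mu nu})
      \<union> ({p. snd p < fst p} \<inter> {(x, y). {min x y..max x y} \<subseteq> Aminus mu nu})"
    by (auto simp: admissible_def min_def max_def split: if_splits)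
  have diag: "{(x::real, y). x = y} = {p. fst p = snd p}"
    by auto
  have "closed {(x::real, y). x = y}"
    unfolding diag by (intro closed_Collect_eq continuous_intros)
  moreover have "open {p :: real \<times> real. fst p < snd p}" "open {p :: real \<times> real. snd p < fst p}"
    by (intro open_Collect_less continuous_intros)+
  ultimately have "admissible \<in> sets borel"
    unfolding eq
    by (intro sets.Un borel_closed borel_open open_Int open_intervals_inside open_A)
  then show ?thesis
    by (subst borel_prod)
qed

lemma sets_diagonal [measurable]: "{(x::real, y). x = y} \<in> sets (borel \<Otimes>\<^sub>M borel)"
proof -
  have "{(x::real, y). x = y} = {p \<in> space (borel \<Otimes>\<^sub>M borel). fst p = snd p}"
    by (auto simp: space_pair_measure)
  then show ?thesis
    by simp
qed

lemma log_ratio_measurable [measurable]: "(\<lambda>p. log_ratio (fst p) (snd p)) \<in> borel_measurable (borel \<Otimes>\<^sub>M borel)"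
proof -
  have "(\<lambda>p. \<integral>\<^sup>+t. ennreal (1 / \<bar>Fcal mu nu t\<bar>) * (if fst p \<le> t \<and> t < snd p \<or> snd p \<le> t \<and> t < fst p then 1 else 0) \<partial>mu)
      \<in> borel_measurable (borel \<Otimes>\<^sub>M borel)"
    by (rule mu.borel_measurable_nn_integral) simp
  also have "(\<lambda>p. \<integral>\<^sup>+t. ennreal (1 / \<bar>Fcal mu nu t\<bar>) * (if fst p \<le> t \<and> t < snd p \<or> snd p \<le> t \<and> t < fst p then 1 else 0) \<partial>mu)
      = (\<lambda>p. log_ratio (fst p) (snd p))"
    unfolding log_ratio_def by (intro ext nn_integral_cong) (auto simp: indicator_def)
  finally show ?thesis .
qed

lemma kernel_measurable [measurable]: "(\<lambda>p. kernel (fst p) (snd p)) \<in> borel_measurable (borel \<Otimes>\<^sub>M borel)"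
  unfolding kernel_def prod.collapse by measurable

lemma kernel_measurable_comp [measurable (raw)]:
  assumes [measurable]: "f \<in> borel_measurable M" "g \<in> borel_measurable M"
  shows "(\<lambda>z. kernel (f z) (g z)) \<in> borel_measurable M"
proof -
  have "(\<lambda>z. (f z, g z)) \<in> M \<rightarrow>\<^sub>M borel \<Otimes>\<^sub>M borel"
    by simp
  from measurable_compose[OF this kernel_measurable] show ?thesis
    by simp
qed

lemma AE_not_point: "AE t in mu. t \<noteq> x" "AE t in nu. t \<noteq> x"
  by (rule AE_I[where N="{x}"]; simp add: atomless_mu atomless_nu sets_mu sets_nu)+

end

section \<open>The kernel on a single positivity interval\<close>

context interval_data
begin

lemma log_ratio_eq:
  assumes "a < x" "x \<le> y" "y < b"
  shows "log_ratio x y = ennreal (ln (F y) - ln (F x))"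
proof -
  have "log_ratio x y = (\<integral>\<^sup>+t\<in>{x<..y}. ennreal (1 / Fcal mu nu t) \<partial>mu)"
    unfolding log_ratio_def
    \<comment> \<open>\<open>log_ratio\<close> integrates over \<open>{x..<y}\<close>, the
      substitution rule over \<open>{x<..y}\<close>; they differ by end points, which have no
      mass.\<close>
    using AE_not_point(1)[of x] AE_not_point(1)[of y]
  proof (intro nn_integral_cong_AE, eventually_elim)
    case (elim t)
    then show ?case
      using Fcal_pos[of t] assms by (auto simp: indicator_def)
  qed
  then show ?thesis
    using ln_F_diff[OF assms] by simp
qed

text \<open>For the exchanged pair the weight is integrated against \<open>nu\<close>, so
  \<open>G\<close> takes the place of \<open>F\<close>.\<close>

lemma log_ratio_swap_eq:
  assumes "a < x" "x \<le> y" "y < b"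
  shows "transport_pair.log_ratio nu mu y x = ennreal (ln (G x) - ln (G y))"
proof -
  interpret sw: transport_pair nu mu by (rule swap)
  have "sw.log_ratio y x = (\<integral>\<^sup>+t\<in>{x<..y}. ennreal (1 / Fcal mu nu t) \<partial>nu)"
    unfolding sw.log_ratio_def
    using AE_not_point(2)[of x] AE_not_point(2)[of y]
  proof (intro nn_integral_cong_AE, eventually_elim)
    case (elim t)
    then show ?case
      using Fcal_pos[of t] assms by (auto simp: indicator_def Fcal_swap)
  qed
  then show ?thesis
    using ln_G_diff[OF assms] by simp
qed

lemma r_mono: "a < x \<Longrightarrow> x \<le> y \<Longrightarrow> y < b \<Longrightarrow> F x \<le> F y" "a < x \<Longrightarrow> x \<le> y \<Longrightarrow> y < b \<Longrightarrow> G y \<le> G x"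
  using r1_Ioc(2) r2_Ioc(2) by blast+

lemma admissible_fst_iff:
  assumes "a < x" "x < b"
  shows "(x, y) \<in> admissible - {(x, y). x = y} \<longleftrightarrow> y \<in> {x<..<b}"
proof
  assume *: "(x, y) \<in> admissible - {(x, y). x = y}"
  have "\<not> y < x"
  proof
    assume "y < x"
    then have "{y..x} \<subseteq> Aminus mu nu"
      using * by (auto simp: admissible_def)
    then have "x \<in> Aminus mu nu"
      using \<open>y < x\<close> by auto
    then show False
      using Fcal_pos[of x] assms by (simp add: Aminus_iff)
  qed
  moreover have "b \<notin> {x..y} \<or> y \<le> x"
    using * Fcal_ends by (force simp: admissible_def Aplus_iff)
  ultimately show "y \<in> {x<..<b}"
    using * assms by auto
next
  assume "y \<in> {x<..<b}"
  then show "(x, y) \<in> admissible - {(x, y). x = y}"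
    using assms by (auto simp: admissible_def Aplus_iff intro!: Fcal_pos)
qed

lemma admissible_snd_iff:
  assumes "a < y" "y < b"
  shows "(x, y) \<in> admissible - {(x, y). x = y} \<longleftrightarrow> x \<in> {a<..<y}"
proof
  assume *: "(x, y) \<in> admissible - {(x, y). x = y}"
  have "\<not> y < x"
    using * assms Fcal_pos[of y] by (force simp: admissible_def Aminus_iff)
  moreover have "a \<notin> {x..y} \<or> y \<le> x"
    using * Fcal_ends by (force simp: admissible_def Aplus_iff)
  ultimately show "x \<in> {a<..<y}"
    using * assms by auto
next
  assume "x \<in> {a<..<y}"
  then show "(x, y) \<in> admissible - {(x, y). x = y}"
    using assms by (auto simp: admissible_def Aplus_iff intro!: Fcal_pos)
qed

text \<open>exp (- (ln F y - ln F x)) / Fcal x = (F x / F y) / (F x * G x).\<close>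

lemma kernel_eq:
  assumes "a < x" "x < y" "y < b"
  shows "kernel x y = ennreal (1 / (G x * F y))"
proof -
  have pos: "0 < F x" "0 < F y" "0 < G x"
    using assms by (auto intro: F_pos G_pos)
  have "ln (F x) \<le> ln (F y)"
    using r_mono[of x y] assms pos by simp
  then have "enn2real (log_ratio x y) = ln (F y) - ln (F x)"
    using log_ratio_eq[of x y] assms by simp
  then have "exp (- enn2real (log_ratio x y)) = F x / F y"
    using pos by (simp add: exp_diff)
  moreover have "(x, y) \<in> admissible - {(x, y). x = y}"
    using admissible_fst_iff[of x y] assms by simp
  ultimately show ?thesis
    unfolding kernel_def using pos assms by (simp add: FG_eq[symmetric])
qed

text \<open>The formula for \<open>kernel\<close> singles out \<open>mu\<close> and the first
  argument. For the exchanged pair it reads (G y / G x) / (F y * G y), the same number; this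
  invariance carries the results to negativity intervals.\<close>

lemma kernel_swap_eq:
  assumes "a < x" "x < y" "y < b"
  shows "transport_pair.kernel nu mu y x = ennreal (1 / (G x * F y))"
proof -
  interpret sw: transport_pair nu mu by (rule swap)
  have pos: "0 < G x" "0 < F y" "0 < G y"
    using assms by (auto intro: F_pos G_pos)
  have "ln (G y) \<le> ln (G x)"
    using r_mono[of x y] assms pos by simp
  then have "enn2real (sw.log_ratio y x) = ln (G x) - ln (G y)"
    using log_ratio_swap_eq[of x y] assms by simp
  then have "exp (- enn2real (sw.log_ratio y x)) = G y / G x"
    using pos by (simp add: exp_diff)
  moreover have "(y, x) \<in> sw.admissible - {(x, y). x = y}"
    using admissible_fst_iff[of x y] assms
    by (auto simp: sw.admissible_def admissible_def Aminus_swap[symmetric])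
  ultimately show ?thesis
    unfolding sw.kernel_def using pos assms by (simp add: Fcal_swap FG_eq[symmetric])
qed

lemma kernel_swap:
  assumes "a < x \<and> x < b \<or> a < y \<and> y < b"
  shows "transport_pair.kernel nu mu y x = kernel x y"
proof -
  interpret sw: transport_pair nu mu by (rule swap)
  have iff: "(y, x) \<in> sw.admissible - {(x, y). x = y} \<longleftrightarrow> (x, y) \<in> admissible - {(x, y). x = y}"
    by (auto simp: sw.admissible_def admissible_def Aminus_swap[symmetric])
  show ?thesis
  proof (cases "(x, y) \<in> admissible - {(x, y). x = y}")
    case True
    then have "a < x" "x < y" "y < b"
      using admissible_fst_iff[of x y] admissible_snd_iff[of y x] assms by auto
    then show ?thesis
      by (simp add: kernel_eq kernel_swap_eq)
  next
    case False
    then have "indicator (admissible - {(x, y). x = y}) (x, y) = (0 :: ennreal)"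
      "indicator (sw.admissible - {(x, y). x = y}) (y, x) = (0 :: ennreal)"
      using iff by (simp_all only: indicator_simps not_False_eq_True)
    then show ?thesis
      unfolding kernel_def sw.kernel_def by simp
  qed
qed

lemma kernel_fst:
  assumes "a < x" "x < b"
  shows "kernel x y = ennreal (1 / (G x * F y)) * indicator {x<..<b} y"
proof (cases "y \<in> {x<..<b}")
  case True
  then show ?thesis using kernel_eq[of x y] assms by simp
next
  case False
  then have "indicator (admissible - {(x, y). x = y}) (x, y) = (0 :: ennreal)"
    using admissible_fst_iff[OF assms, of y] by (simp only: indicator_simps not_False_eq_True)
  then show ?thesis
    unfolding kernel_def using False by simp
qed

lemma kernel_snd:
  assumes "a < y" "y < b"
  shows "kernel x y = ennreal (1 / (G x * F y)) * indicator {a<..<y} x"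
proof (cases "x \<in> {a<..<y}")
  case True
  then show ?thesis using kernel_eq[of x y] assms by simp
next
  case False
  then have "indicator (admissible - {(x, y). x = y}) (x, y) = (0 :: ennreal)"
    using admissible_snd_iff[OF assms, of x] by (simp only: indicator_simps not_False_eq_True)
  then show ?thesis
    unfolding kernel_def using False by simp
qed

text \<open>dnu / F = dr2, and \<open>r2 {x<..<b}\<close> is \<open>G x\<close>, which cancels the
  remaining factor 1 / G x.\<close>

lemma kernel_marginal_fst:
  assumes x: "a < x" "x < b"
  shows "(\<integral>\<^sup>+y. kernel x y \<partial>nu) = 1"
proof -
  have "(\<integral>\<^sup>+y. kernel x y \<partial>nu)
      = (\<integral>\<^sup>+y. ennreal (indicator {a<..<b} y / F y) * (ennreal (1 / G x) * indicator {x<..<b} y) \<partial>nu)"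
    using x G_pos[OF x] by (intro nn_integral_cong) (auto simp: kernel_fst indicator_def F_pos less_imp_le mult.commute simp flip: ennreal_mult)
  also have "\<dots> = (\<integral>\<^sup>+y. ennreal (1 / G x) * indicator {x<..<b} y \<partial>r2)"
    by (rule nn_integral_r2[symmetric]) simp
  also have "\<dots> = ennreal (1 / G x) * ennreal (G x)"
    using r2_Ioo[OF x] by (simp add: nn_integral_cmult)
  also have "\<dots> = 1"
    using G_pos[OF x] by (simp flip: ennreal_mult)
  finally show ?thesis .
qed

lemma kernel_marginal_snd:
  assumes y: "a < y" "y < b"
  shows "(\<integral>\<^sup>+x. kernel x y \<partial>mu) = 1"
proof -
  have "(\<integral>\<^sup>+x. kernel x y \<partial>mu)
      = (\<integral>\<^sup>+x. ennreal (indicator {a<..<b} x / G x) * (ennreal (1 / F y) * indicator {a<..<y} x) \<partial>mu)"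
    using y F_pos[OF y] by (intro nn_integral_cong) (auto simp: kernel_snd indicator_def G_pos less_imp_le simp flip: ennreal_mult)
  also have "\<dots> = (\<integral>\<^sup>+x. ennreal (1 / F y) * indicator {a<..<y} x \<partial>r1)"
    by (rule nn_integral_r1[symmetric]) simp
  also have "\<dots> = ennreal (1 / F y) * ennreal (F y)"
    using r1_Ioo[OF y] by (simp add: nn_integral_cmult)
  also have "\<dots> = 1"
    using F_pos[OF y] by (simp flip: ennreal_mult)
  finally show ?thesis .
qed

text \<open>Since dr1 = dmu / G and dr2 = dnu / F, the density of the product is 1 / (G x * F y),
  which is the kernel. As the kernel is free of choices, so is
  \<open>gamma0_pos r1 r2\<close>.\<close>

lemma gamma0_pos_eq:
  "gamma0_pos r1 r2 = density (mu \<Otimes>\<^sub>M nu) (\<lambda>p. kernel (fst p) (snd p) * indicator ({a<..<b} \<times> {a<..<b}) p)"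
proof -
  note [measurable_cong] = sets_mu sets_nu
  have prod: "r1 \<Otimes>\<^sub>M r2 = density (mu \<Otimes>\<^sub>M nu) (\<lambda>(x, y). ennreal (indicator {a<..<b} x / G x) * ennreal (indicator {a<..<b} y / F y))"
    by (subst r1_eq, subst r2_eq, rule pair_measure_density)
      (use sigma_finite_r(2) r2_eq nu.sigma_finite_measure_axioms in \<open>auto cong: measurable_cong_sets\<close>)
  have [measurable]: "{p :: real \<times> real. fst p < snd p} \<in> sets (mu \<Otimes>\<^sub>M nu)"
  proof -
    have "{p :: real \<times> real. fst p < snd p} = {p \<in> space (borel \<Otimes>\<^sub>M borel). fst p < snd p}"
      by (auto simp: space_pair_measure)
    then show ?thesis by simp
  qed
  have "gamma0_pos r1 r2 = density (mu \<Otimes>\<^sub>M nu) (\<lambda>p. (case p of (x, y) \<Rightarrow> ennreal (indicator {a<..<b} x / G x) * ennreal (indicator {a<..<b} y / F y))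
       * indicator {p. fst p < snd p} p)"
    unfolding gamma0_pos_def restr_def prod by (rule density_density_eq) auto
  also have "\<dots> = density (mu \<Otimes>\<^sub>M nu) (\<lambda>p. kernel (fst p) (snd p) * indicator ({a<..<b} \<times> {a<..<b}) p)"
    by (intro arg_cong[where f="density (mu \<Otimes>\<^sub>M nu)"] ext)
      (auto simp: kernel_fst indicator_def F_pos G_pos less_imp_le simp flip: ennreal_mult)
  finally show ?thesis .
qed

text \<open>A positivity interval of \<open>Fcal mu nu\<close> is a negativity interval of
  \<open>Fcal nu mu\<close>, with \<open>r1\<close> and \<open>r2\<close> in exchanged roles. Stated
  for the pair (\<open>nu\<close>, \<open>mu\<close>), this serves the components of A-.\<close>

lemma gamma0_neg_eq:
  "gamma0_neg r2 r1 = density (nu \<Otimes>\<^sub>M mu) (\<lambda>p. transport_pair.kernel nu mu (fst p) (snd p) * indicator ({a<..<b} \<times> {a<..<b}) p)"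
proof -
  note [measurable_cong] = sets_mu sets_nu
  have prod: "r2 \<Otimes>\<^sub>M r1 = density (nu \<Otimes>\<^sub>M mu) (\<lambda>(y, x). ennreal (indicator {a<..<b} y / F y) * ennreal (indicator {a<..<b} x / G x))"
    by (subst r1_eq, subst r2_eq, rule pair_measure_density)
      (use sigma_finite_r(1) r1_eq mu.sigma_finite_measure_axioms in \<open>auto cong: measurable_cong_sets\<close>)
  have [measurable]: "{p :: real \<times> real. snd p < fst p} \<in> sets (nu \<Otimes>\<^sub>M mu)"
  proof -
    have "{p :: real \<times> real. snd p < fst p} = {p \<in> space (borel \<Otimes>\<^sub>M borel). snd p < fst p}"
      by (auto simp: space_pair_measure)
    then show ?thesis by simp
  qed
  have "gamma0_neg r2 r1 = density (nu \<Otimes>\<^sub>M mu) (\<lambda>p. (case p of (y, x) \<Rightarrow> ennreal (indicator {a<..<b} y / F y) * ennreal (indicator {a<..<b} x / G x))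
       * indicator {p. snd p < fst p} p)"
    unfolding gamma0_neg_def restr_def prod by (rule density_density_eq) auto
  also have "\<dots> = density (nu \<Otimes>\<^sub>M mu) (\<lambda>p. transport_pair.kernel nu mu (fst p) (snd p) * indicator ({a<..<b} \<times> {a<..<b}) p)"
    by (intro arg_cong[where f="density (nu \<Otimes>\<^sub>M mu)"] ext)
      (auto simp: kernel_swap kernel_fst indicator_def F_pos G_pos less_imp_le mult.commute simp flip: ennreal_mult)
  finally show ?thesis .
qed

end

section \<open>Existence of the densities\<close>


text \<open>The weight may blow up at both ends, so the weighted measure is controlled on compact
  subintervals only. There \<open>w\<close> is bounded by some C, and the mass of
  \<open>{u<..v}\<close> by C times an increment of the continuous \<open>cdf rho\<close>, which
  makes \<open>H\<close> continuous.\<close>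

lemma weighted_distribution_function:
  fixes rho :: "real measure" and w :: "real \<Rightarrow> real"
  assumes rho: "real_distribution rho" and atomless: "\<And>x. emeasure rho {x} = 0"
    and ab: "a < b"
    and w: "continuous_on {a<..<b} w" "\<And>t. a < t \<Longrightarrow> t < b \<Longrightarrow> 0 < w t"
  obtains H where "continuous_on {a<..<b} H"
    "\<And>x y. a < x \<Longrightarrow> x \<le> y \<Longrightarrow> y < b \<Longrightarrow> H x \<le> H y"
    "\<And>x y. a < x \<Longrightarrow> x \<le> y \<Longrightarrow> y < b \<Longrightarrow>
      (\<integral>\<^sup>+t. ennreal (indicator {a<..<b} t * w t) * indicator {x<..y} t \<partial>rho) = ennreal (H y - H x)"
proof -
  interpret rho: real_distribution rho by (rule rho)
  define m where "m = density rho (\<lambda>t. ennreal (indicator {a<..<b} t * w t))"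
  have [measurable]: "(\<lambda>t. indicator {a<..<b} t * w t) \<in> borel_measurable borel"
    using borel_measurable_continuous_on_indicator[OF _ w(1)] by simp
  have [simp, measurable_cong]: "sets m = sets borel"
    by (simp add: m_def)
  have em: "emeasure m A = (\<integral>\<^sup>+t. ennreal (indicator {a<..<b} t * w t) * indicator A t \<partial>rho)" if "A \<in> sets borel" for A
    using that unfolding m_def by (subst emeasure_density) auto
  have bound: "\<exists>C. \<forall>u v. x \<le> u \<longrightarrow> u \<le> v \<longrightarrow> v \<le> y \<longrightarrow> emeasure m {u<..v} \<le> ennreal (C * (cdf rho v - cdf rho u))"
    if xy: "a < x" "y < b" for x y
  proof -
    have "compact (w ` {x..y})"
      by (intro compact_continuous_image continuous_on_subset[OF w(1)]) (use xy in auto)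
    then obtain C where C: "\<And>t. t \<in> {x..y} \<Longrightarrow> norm (w t) \<le> C"
      using compact_imp_bounded bounded_iff by (metis image_eqI)
    have "emeasure m {u<..v} \<le> ennreal (C * (cdf rho v - cdf rho u))" if uv: "x \<le> u" "u \<le> v" "v \<le> y" for u v
    proof -
      have "0 \<le> C"
        using C[of u] uv by auto
      have "emeasure m {u<..v} \<le> (\<integral>\<^sup>+t. ennreal C * indicator {u<..v} t \<partial>rho)"
      proof (subst em, simp, intro nn_integral_mono)
        fix t
        show "ennreal (indicator {a<..<b} t * w t) * indicator {u<..v} t \<le> ennreal C * indicator {u<..v} t"
          using C[of t] uv xy \<open>0 \<le> C\<close> by (auto simp: indicator_def intro!: ennreal_leI)
      qed
      also have "\<dots> = ennreal (C * (cdf rho v - cdf rho u))"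
        using rho.cdf_diff_eq[of u v] uv \<open>0 \<le> C\<close>
        by (cases "u = v") (auto simp: nn_integral_cmult rho.emeasure_eq_measure ennreal_mult)
      finally show ?thesis .
    qed
    then show ?thesis by blast
  qed
  have fin: "emeasure m {x<..y} < \<infinity>" if xy: "a < x" "y < b" for x y
  proof (cases "x \<le> y")
    case True
    then obtain C where "emeasure m {x<..y} \<le> ennreal (C * (cdf rho y - cdf rho x))"
      using bound[OF xy] by blast
    then show ?thesis
      by (rule le_less_trans) simp
  qed auto
  have add: "measure m {x<..z} = measure m {x<..y} + measure m {y<..z}"
    if "a < x" "x \<le> y" "y \<le> z" "z < b" for x y z
  proof -
    have eq: "{x<..z} = {x<..y} \<union> {y<..z}"
      using that by auto
    show ?thesis
      unfolding eq using fin[of x y] fin[of y z] that by (intro measure_Union) auto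
  qed
  define c where "c = (a + b) / 2"
  \<comment> \<open>The mass between \<open>a\<close> and t may be infinite, so \<open>H\<close> is
    measured from the midpoint, with a sign.\<close>
  define H where "H t = (if c \<le> t then measure m {c<..t} else - measure m {t<..c})" for t
  have c: "a < c" "c < b"
    using ab by (auto simp: c_def)
  have H: "H y - H x = measure m {x<..y}" if "a < x" "x \<le> y" "y < b" for x y
    using add[of x y c] add[of x c y] add[of c x y] that c by (auto simp: H_def)
  show ?thesis
  proof (rule that[of H])
    show mono: "H x \<le> H y" if "a < x" "x \<le> y" "y < b" for x y
      using H[OF that] measure_nonneg[of m "{x<..y}"] by linarith
    show "(\<integral>\<^sup>+t. ennreal (indicator {a<..<b} t * w t) * indicator {x<..y} t \<partial>rho) = ennreal (H y - H x)"
      if "a < x" "x \<le> y" "y < b" for x y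
      using fin[of x y] that by (simp add: H emeasure_eq_ennreal_measure flip: em)
    have "isCont H t" if t: "a < t" "t < b" for t
    proof -
      define x where "x = (a + t) / 2"
      define y where "y = (t + b) / 2"
      have xy: "a < x" "x < t" "t < y" "y < b"
        using t by (auto simp: x_def y_def)
      obtain C where C: "\<And>u v. x \<le> u \<Longrightarrow> u \<le> v \<Longrightarrow> v \<le> y \<Longrightarrow> emeasure m {u<..v} \<le> ennreal (C * (cdf rho v - cdf rho u))"
        using bound[of x y] xy by auto
      have le: "\<bar>H v - H u\<bar> \<le> \<bar>C\<bar> * \<bar>cdf rho v - cdf rho u\<bar>" if "x \<le> u" "u \<le> v" "v \<le> y" for u v
      proof -
        have "ennreal (measure m {u<..v}) \<le> ennreal (C * (cdf rho v - cdf rho u))"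
          using C[OF that] fin[of u v] that xy by (simp add: emeasure_eq_ennreal_measure)
        then have "measure m {u<..v} \<le> max 0 (C * (cdf rho v - cdf rho u))"
          by (metis ennreal_le_iff2 max.coboundedI1 max.coboundedI2 measure_nonneg order_antisym_conv)
        also have "\<dots> \<le> \<bar>C\<bar> * \<bar>cdf rho v - cdf rho u\<bar>"
          by (simp flip: abs_mult)
        finally show ?thesis
          using H[of u v] that xy by simp
      qed
      have "((\<lambda>s. H s - H t) \<longlongrightarrow> 0) (at t)"
      proof (rule Lim_null_comparison)
        have "eventually (\<lambda>s. s \<in> {x<..<y}) (at t)"
          using xy by (intro eventually_at_in_open') auto
        then show "eventually (\<lambda>s. norm (H s - H t) \<le> \<bar>C\<bar> * \<bar>cdf rho s - cdf rho t\<bar>) (at t)"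
        proof eventually_elim
          case (elim s)
          then show ?case
            using le[of s t] le[of t s] xy by (cases "s \<le> t") (auto simp: abs_minus_commute)
        qed
        have "isCont (cdf rho) t"
          by (simp add: rho.isCont_cdf measure_def atomless)
        then have "((\<lambda>s. \<bar>C\<bar> * \<bar>cdf rho s - cdf rho t\<bar>) \<longlongrightarrow> \<bar>C\<bar> * \<bar>cdf rho t - cdf rho t\<bar>) (at t)"
          unfolding isCont_def by (intro tendsto_intros)
        then show "((\<lambda>s. \<bar>C\<bar> * \<bar>cdf rho s - cdf rho t\<bar>) \<longlongrightarrow> 0) (at t)"
          by simp
      qed
      then show ?thesis
        unfolding isCont_def by (simp add: LIM_zero_iff)
    qed
    then show "continuous_on {a<..<b} H"
      by (intro continuous_at_imp_continuous_on) auto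
  qed
qed

text \<open>\<open>{a<..y}\<close> is an increasing union of intervals whose masses are increments
  of \<open>F\<close>; the limit 0 at \<open>a\<close> turns these increments into
  \<open>F y\<close> itself.\<close>

lemma emeasure_Ioc_limit:
  fixes r :: "real measure" and F :: "real \<Rightarrow> real"
  assumes sets: "sets r = sets borel" and y: "a < y"
    and F: "\<And>x. a < x \<Longrightarrow> x \<le> y \<Longrightarrow> emeasure r {x<..y} = ennreal (F y - F x)"
    and lim: "(F \<longlongrightarrow> 0) (at_right a)"
  shows "emeasure r {a<..y} = ennreal (F y)"
proof -
  define x where "x n = a + (y - a) / (real n + 1)" for n
  have x: "a < x n" "x n \<le> y" for n
    using y mult_right_mono[of a y "real n"] by (auto simp: x_def field_simps)
  have xlim: "x \<longlonglongrightarrow> a"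
    unfolding x_def by real_asymp
  moreover have "x n \<noteq> a" for n
    using x(1)[of n] by simp
  ultimately have "filterlim x (at_right a) sequentially"
    using x by (auto simp: filterlim_at)
  then have "(\<lambda>n. F (x n)) \<longlonglongrightarrow> 0"
    by (rule filterlim_compose[OF lim])
  then have "(\<lambda>n. ennreal (F y - F (x n))) \<longlonglongrightarrow> ennreal (F y - 0)"
    by (intro tendsto_intros)
  moreover have "(\<lambda>n. emeasure r {x n<..y}) \<longlonglongrightarrow> emeasure r (\<Union>n. {x n<..y})"
  proof (rule Lim_emeasure_incseq)
    have mono: "x n \<le> x m" if "m \<le> n" for m n
      using y that unfolding x_def by (intro add_left_mono divide_left_mono) auto
    then show "incseq (\<lambda>n. {x n<..y})"
      by (auto simp: incseq_def intro: le_less_trans[OF mono])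
  qed (auto simp: sets)
  moreover have "(\<Union>n. {x n<..y}) = {a<..y}"
  proof (intro equalityI subsetI)
    fix t assume t: "t \<in> {a<..y}"
    then have "eventually (\<lambda>n. x n < t) sequentially"
      by (intro order_tendstoD(2)[OF xlim]) auto
    then obtain n where "x n < t"
      by (auto simp: eventually_sequentially)
    then show "t \<in> (\<Union>n. {x n<..y})"
      using t by auto
  qed (use x in \<open>auto intro: less_trans\<close>)
  ultimately show ?thesis
    using LIMSEQ_unique x by (simp add: F) blast
qed

lemma emeasure_Ioo_limit:
  fixes r :: "real measure" and G :: "real \<Rightarrow> real"
  assumes sets: "sets r = sets borel" and x: "x < b"
    and G: "\<And>y. x \<le> y \<Longrightarrow> y < b \<Longrightarrow> emeasure r {x<..y} = ennreal (G x - G y)"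
    and lim: "(G \<longlongrightarrow> 0) (at_left b)"
  shows "emeasure r {x<..<b} = ennreal (G x)"
proof -
  define y where "y n = b - (b - x) / (real n + 1)" for n
  have y: "x \<le> y n" "y n < b" for n
    using x mult_right_mono[of x b "real n"] by (auto simp: y_def field_simps)
  have ylim: "y \<longlonglongrightarrow> b"
    unfolding y_def by real_asymp
  have "filterlim y (at_left b) sequentially"
    using ylim y by (auto simp: filterlim_at intro!: always_eventually less_imp_neq)
  then have "(\<lambda>n. G (y n)) \<longlonglongrightarrow> 0"
    by (rule filterlim_compose[OF lim])
  then have "(\<lambda>n. ennreal (G x - G (y n))) \<longlonglongrightarrow> ennreal (G x - 0)"
    by (intro tendsto_intros)
  moreover have "(\<lambda>n. emeasure r {x<..y n}) \<longlonglongrightarrow> emeasure r (\<Union>n. {x<..y n})"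
  proof (rule Lim_emeasure_incseq)
    have mono: "y m \<le> y n" if "m \<le> n" for m n
      using x that unfolding y_def by (intro diff_left_mono divide_left_mono) auto
    then show "incseq (\<lambda>n. {x<..y n})"
      by (auto simp: incseq_def intro: order_trans[OF _ mono])
  qed (auto simp: sets)
  moreover have "(\<Union>n. {x<..y n}) = {x<..<b}"
  proof (intro equalityI subsetI)
    fix t assume t: "t \<in> {x<..<b}"
    then have "eventually (\<lambda>n. t < y n) sequentially"
      by (intro order_tendstoD(1)[OF ylim]) auto
    then obtain n where "t < y n"
      by (auto simp: eventually_sequentially)
    then show "t \<in> (\<Union>n. {x<..y n})"
      using t by (auto intro: less_imp_le)
  qed (use y in \<open>auto intro: le_less_trans\<close>)
  ultimately show ?thesis
    using LIMSEQ_unique y by (simp add: G) blast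
qed

section \<open>Solving the system on a positivity interval\<close>

context transport_pair
begin

text \<open>d ln Fcal = (dmu - dnu) / Fcal, so with primitives H of dmu / Fcal and J of dnu / Fcal
  the function ln Fcal - H + J is a constant \<open>k\<close>. Writing Fcal as exp H times exp (k -
  J) gives dF = F dmu / Fcal = dmu / G and - dG = dnu / F, the equations for \<open>r1\<close> and
  \<open>r2\<close>. What remains are the limits of F at \<open>a\<close> and of G at
  \<open>b\<close>.\<close>

lemma pos_data_exists:
  assumes interval: "positivity_interval a b"
  shows "\<exists>r1 r2 F G. pos_data mu nu a b r1 r2 F G"
proof -
  have ab: "a < b" and ends: "Fcal mu nu a = 0" "Fcal mu nu b = 0"
    and pos: "\<And>t. a < t \<Longrightarrow> t < b \<Longrightarrow> 0 < Fcal mu nu t"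
    using interval by (auto simp: positivity_interval_def)
  define w where "w t = 1 / Fcal mu nu t" for t
  have cw: "continuous_on {a<..<b} w"
    unfolding w_def using pos by (intro continuous_intros continuous_Fcal) (auto simp: less_imp_neq[symmetric])
  have wpos: "0 < w t" if "a < t" "t < b" for t
    using pos[OF that] by (simp add: w_def)
  have [measurable]: "w \<in> borel_measurable borel"
    unfolding w_def by measurable
  obtain H where H: "continuous_on {a<..<b} H" "\<And>x y. a < x \<Longrightarrow> x \<le> y \<Longrightarrow> y < b \<Longrightarrow> H x \<le> H y"
    "\<And>x y. a < x \<Longrightarrow> x \<le> y \<Longrightarrow> y < b \<Longrightarrow>
      (\<integral>\<^sup>+t. ennreal (indicator {a<..<b} t * w t) * indicator {x<..y} t \<partial>mu) = ennreal (H y - H x)"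
    by (rule weighted_distribution_function[OF mu.real_distribution_axioms atomless_mu ab cw wpos]) blast+
  obtain J where J: "continuous_on {a<..<b} J" "\<And>x y. a < x \<Longrightarrow> x \<le> y \<Longrightarrow> y < b \<Longrightarrow> J x \<le> J y"
    "\<And>x y. a < x \<Longrightarrow> x \<le> y \<Longrightarrow> y < b \<Longrightarrow>
      (\<integral>\<^sup>+t. ennreal (indicator {a<..<b} t * w t) * indicator {x<..y} t \<partial>nu) = ennreal (J y - J x)"
    by (rule weighted_distribution_function[OF nu.real_distribution_axioms atomless_nu ab cw wpos]) blast+
  have ln_Fcal: "ln (Fcal mu nu y) - ln (Fcal mu nu x) = (H y - H x) - (J y - J x)"
    if xy: "a < x" "x \<le> y" "y < b" for x y
  proof -
    have sub: "(LINT t:{x<..y}|mu. 1 / Fcal mu nu t) - (LINT t:{x<..y}|nu. 1 / Fcal mu nu t)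
        = ln (Fcal mu nu y) - ln (Fcal mu nu x)"
    proof (rule signed_integral_substitution(2)[where f=ln and M="Fcal mu nu"])
      show "continuous_on (Fcal mu nu ` {x..y}) ((/) 1)"
        using pos xy by (intro continuous_intros) (force simp: less_imp_neq[symmetric])
    qed (use xy pos in \<open>auto simp: sets_mu sets_nu continuous_Fcal Fcal_diff mu.emeasure_eq_measure nu.emeasure_eq_measure intro!: derivative_eq_intros\<close>)
    have *: "(LINT t:{x<..y}|rho. 1 / Fcal mu nu t) = K y - K x"
      if rho: "sets rho = sets borel" and K: "K x \<le> K y"
        "(\<integral>\<^sup>+t. ennreal (indicator {a<..<b} t * w t) * indicator {x<..y} t \<partial>rho) = ennreal (K y - K x)"
      for rho and K :: "real \<Rightarrow> real"
    proof -
      note [measurable_cong] = rho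
      have "(LINT t:{x<..y}|rho. 1 / Fcal mu nu t) = enn2real (\<integral>\<^sup>+t. ennreal (indicator {x<..y} t *\<^sub>R (1 / Fcal mu nu t)) \<partial>rho)"
        unfolding set_lebesgue_integral_def
        by (rule integral_eq_nn_integral) (use pos xy in \<open>auto simp: indicator_def less_imp_le\<close>)
      also have "(\<integral>\<^sup>+t. ennreal (indicator {x<..y} t *\<^sub>R (1 / Fcal mu nu t)) \<partial>rho)
          = (\<integral>\<^sup>+t. ennreal (indicator {a<..<b} t * w t) * indicator {x<..y} t \<partial>rho)"
        using xy by (intro nn_integral_cong) (auto simp: indicator_def w_def)
      finally show ?thesis
        using K by simp
    qed
    note sub
    moreover note *[OF sets_mu H(2,3)[OF xy]] *[OF sets_nu J(2,3)[OF xy]]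
    ultimately show ?thesis
      by simp
  qed
  define c where "c = (a + b) / 2"
  have c: "a < c" "c < b"
    using ab by (auto simp: c_def)
  define k where "k = ln (Fcal mu nu c) - H c + J c"
  have Fcal_eq: "Fcal mu nu t = exp (H t) * exp (k - J t)" if t: "a < t" "t < b" for t
  proof -
    have "ln (Fcal mu nu t) = H t + (k - J t)"
      using ln_Fcal[of t c] ln_Fcal[of c t] t c by (cases "t \<le> c") (auto simp: k_def)
    then show ?thesis
      using pos[OF t] by (metis exp_add exp_ln)
  qed
  \<comment> \<open>The indicator makes both functions Borel on the whole line, as \<open>H\<close>
    and \<open>J\<close> are controlled only inside the interval.\<close>
  define F where "F t = indicator {a<..<b} t * exp (H t)" for t
  define G where "G t = indicator {a<..<b} t * exp (k - J t)" for t
  have FG: "F t = exp (H t)" "G t = exp (k - J t)" if "a < t" "t < b" for t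
    using that by (auto simp: F_def G_def)
  have [measurable]: "F \<in> borel_measurable borel" "G \<in> borel_measurable borel"
  proof -
    have "(\<lambda>t. indicator {a<..<b} t *\<^sub>R exp (H t)) \<in> borel_measurable borel"
      "(\<lambda>t. indicator {a<..<b} t *\<^sub>R exp (k - J t)) \<in> borel_measurable borel"
      by (intro borel_measurable_continuous_on_indicator continuous_intros H J; simp)+
    then show "F \<in> borel_measurable borel" "G \<in> borel_measurable borel"
      by (simp_all add: F_def[abs_def] G_def[abs_def])
  qed
  have cFG: "continuous_on {a<..<b} F" "continuous_on {a<..<b} G"
  proof -
    show "continuous_on {a<..<b} F"
      by (rule continuous_on_eq[of _ "\<lambda>t. exp (H t)"]) (auto simp: FG intro!: continuous_intros H)
    show "continuous_on {a<..<b} G"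
      by (rule continuous_on_eq[of _ "\<lambda>t. exp (k - J t)"]) (auto simp: FG intro!: continuous_intros J)
  qed
  define r1 where "r1 = density mu (\<lambda>t. ennreal (indicator {a<..<b} t / G t))"
  define r2 where "r2 = density nu (\<lambda>t. ennreal (indicator {a<..<b} t / F t))"
  note [measurable_cong] = sets_mu sets_nu
  have [simp, measurable_cong]: "sets r1 = sets borel" "sets r2 = sets borel"
    by (simp_all add: r1_def r2_def sets_mu sets_nu)
  have r1: "emeasure r1 {x<..y} = ennreal (F y - F x)" if xy: "a < x" "x \<le> y" "y < b" for x y
  proof -
    \<comment> \<open>\<open>m\<close> is dmu / Fcal, with \<open>H\<close> as distribution function
      up to a constant; the substitution rule then integrates exp H against it.\<close>
    define m where "m = density mu (\<lambda>t. ennreal (indicator {a<..<b} t * w t))"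
    have em: "emeasure m {u<..v} = ennreal (H v - H u)" if "a < u" "u \<le> v" "v < b" for u v
      unfolding m_def using H(3)[OF that] by (subst emeasure_density) auto
    have cH: "continuous_on {x..y} H"
      by (rule continuous_on_subset[OF H(1)]) (use xy in auto)
    have "emeasure r1 {x<..y} = (\<integral>\<^sup>+t. ennreal (indicator {a<..<b} t / G t) * indicator {x<..y} t \<partial>mu)"
      unfolding r1_def by (subst emeasure_density) auto
    also have "\<dots> = (\<integral>\<^sup>+t. ennreal (indicator {a<..<b} t * w t) * (ennreal (F t) * indicator {x<..y} t) \<partial>mu)"
      using xy by (intro nn_integral_cong) (auto simp: indicator_def FG w_def Fcal_eq simp flip: ennreal_mult)
    also have "\<dots> = (\<integral>\<^sup>+t\<in>{x<..y}. ennreal (F t) \<partial>m)"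
      unfolding m_def by (subst nn_integral_density) auto
    also have "\<dots> = (\<integral>\<^sup>+t\<in>{x<..y}. ennreal (exp (H t)) \<partial>m)"
      using xy by (intro nn_integral_cong) (auto simp: indicator_def FG)
    also have "\<dots> = ennreal (exp (H y) - exp (H x))"
    proof (rule nn_integral_substitution_Ioc[where f=exp and M=H])
      show "H v - H u = measure m {u<..v}" if "x \<le> u" "u \<le> v" "v \<le> y" for u v
        using em[of u v] H(2)[of u v] that xy by (simp add: measure_def)
    qed (use xy em[of x y] cH in \<open>auto simp: m_def sets_mu intro!: continuous_intros DERIV_exp\<close>)
    finally show ?thesis
      using xy by (simp add: FG)
  qed
  have r2: "emeasure r2 {x<..y} = ennreal (G x - G y)" if xy: "a < x" "x \<le> y" "y < b" for x y
  proof -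
    define m where "m = density nu (\<lambda>t. ennreal (indicator {a<..<b} t * w t))"
    have em: "emeasure m {u<..v} = ennreal (J v - J u)" if "a < u" "u \<le> v" "v < b" for u v
      unfolding m_def using J(3)[OF that] by (subst emeasure_density) auto
    have cJ: "continuous_on {x..y} J"
      by (rule continuous_on_subset[OF J(1)]) (use xy in auto)
    have "emeasure r2 {x<..y} = (\<integral>\<^sup>+t. ennreal (indicator {a<..<b} t / F t) * indicator {x<..y} t \<partial>nu)"
      unfolding r2_def by (subst emeasure_density) auto
    also have "\<dots> = (\<integral>\<^sup>+t. ennreal (indicator {a<..<b} t * w t) * (ennreal (G t) * indicator {x<..y} t) \<partial>nu)"
      using xy by (intro nn_integral_cong) (auto simp: indicator_def FG w_def Fcal_eq simp flip: ennreal_mult)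
    also have "\<dots> = (\<integral>\<^sup>+t\<in>{x<..y}. ennreal (G t) \<partial>m)"
      unfolding m_def by (subst nn_integral_density) auto
    also have "\<dots> = (\<integral>\<^sup>+t\<in>{x<..y}. ennreal (exp (k - J t)) \<partial>m)"
      using xy by (intro nn_integral_cong) (auto simp: indicator_def FG)
    also have "\<dots> = ennreal (- exp (k - J y) - - exp (k - J x))"
    proof (rule nn_integral_substitution_Ioc[where f="\<lambda>s. - exp (k - s)" and g="\<lambda>s. exp (k - s)" and M=J])
      show "J v - J u = measure m {u<..v}" if "x \<le> u" "u \<le> v" "v \<le> y" for u v
        using em[of u v] J(2)[of u v] that xy by (simp add: measure_def)
      show "((\<lambda>s. - exp (k - s)) has_real_derivative exp (k - J t)) (at (J t))" for t
        by (auto intro!: derivative_eq_intros)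
    qed (use xy em[of x y] cJ in \<open>auto simp: m_def sets_nu intro!: continuous_intros\<close>)
    finally show ?thesis
      using xy by (simp add: FG)
  qed
  have limF: "(F \<longlongrightarrow> 0) (at_right a)"
  proof (rule tendsto_sandwich[OF _ _ tendsto_const])
    \<comment> \<open>\<open>M t\<close> is the \<open>mu\<close>-mass of \<open>{a<..t}\<close>,
      which dominates \<open>Fcal t\<close> because \<open>Fcal\<close> vanishes at
      \<open>a\<close>. Hence H c - H x is at least ln (M c / M x), so \<open>F x\<close> is at most
      a multiple of \<open>M x\<close> and tends to 0.\<close>
    define M where "M t = cdf mu t - cdf mu a" for t
    have M_ge: "Fcal mu nu t \<le> M t" if "a \<le> t" for t
      using ends nu.cdf_nondecreasing[OF that] by (simp add: M_def Fcal_def)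
    have cM: "continuous_on S M" for S
      unfolding M_def by (intro continuous_intros continuous_at_imp_continuous_on ballI)
        (simp add: mu.isCont_cdf measure_def atomless_mu)
    have Mpos: "0 < M t" if "a < t" "t < b" for t
      using M_ge[of t] pos[of t] that by linarith
    have "F x \<le> F c * (M x / M c)" if x: "a < x" "x \<le> c" for x
    proof -
      have "(\<integral>\<^sup>+t\<in>{x<..c}. ennreal (1 / M t) \<partial>mu) = ennreal (ln (M c) - ln (M x))"
      proof (rule nn_integral_substitution_Ioc)
        show "M v - M u = measure mu {u<..v}" if "x \<le> u" "u \<le> v" "v \<le> c" for u v
          using mu.cdf_diff_eq[of u v] that by (cases "u = v") (auto simp: M_def)
        show "continuous_on (M ` {x..c}) ((/) 1)"
          using Mpos x c by (intro continuous_intros) (force simp: less_imp_neq[symmetric])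
      qed (use x c Mpos cM in \<open>auto simp: sets_mu mu.emeasure_eq_measure less_imp_le intro!: derivative_eq_intros\<close>)
      then have "ennreal (ln (M c) - ln (M x)) = (\<integral>\<^sup>+t\<in>{x<..c}. ennreal (1 / M t) \<partial>mu)"
        by (rule sym)
      also have "\<dots>
          \<le> (\<integral>\<^sup>+t. ennreal (indicator {a<..<b} t * w t) * indicator {x<..c} t \<partial>mu)"
        using x c M_ge pos Mpos
        by (intro nn_integral_mono) (auto simp: indicator_def w_def intro!: ennreal_leI divide_left_mono mult_pos_pos)
      also have "\<dots> = ennreal (H c - H x)"
        using x c by (intro H) auto
      finally have "ln (M c) - ln (M x) \<le> H c - H x"
        using H(2)[of x c] x c by (auto simp: ennreal_le_iff2)
      then have "exp (H x) \<le> exp (H c + (ln (M x) - ln (M c)))"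
        by simp
      then show ?thesis
        using x c Mpos by (simp add: FG exp_add exp_diff)
    qed
    then show "eventually (\<lambda>x. F x \<le> F c * (M x / M c)) (at_right a)"
      using c by (auto simp: eventually_at_right intro!: exI[of _ c])
    have "(M \<longlongrightarrow> M a) (at_right a)"
      using cM[of UNIV] by (auto simp: continuous_on_def intro: tendsto_within_subset)
    then have "((\<lambda>x. F c * (M x / M c)) \<longlongrightarrow> F c * (M a / M c)) (at_right a)"
      using Mpos[of c] c by (intro tendsto_intros) auto
    then show "((\<lambda>x. F c * (M x / M c)) \<longlongrightarrow> 0) (at_right a)"
      by (simp add: M_def)
  qed (auto simp: F_def)
  have limG: "(G \<longlongrightarrow> 0) (at_left b)"
  proof (rule tendsto_sandwich[OF _ _ tendsto_const])
    \<comment> \<open>At the right end the comparison is with the \<open>nu\<close>-mass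
      \<open>N t\<close> of \<open>{t<..b}\<close>, since \<open>Fcal\<close> vanishes at
      \<open>b\<close>.\<close>
    define N where "N t = cdf nu b - cdf nu t" for t
    have N_ge: "Fcal mu nu t \<le> N t" if "t \<le> b" for t
      using ends mu.cdf_nondecreasing[OF that] by (simp add: N_def Fcal_def)
    have cN: "continuous_on S N" for S
      unfolding N_def by (intro continuous_intros continuous_at_imp_continuous_on ballI)
        (simp add: nu.isCont_cdf measure_def atomless_nu)
    have Npos: "0 < N t" if "a < t" "t < b" for t
      using N_ge[of t] pos[of t] that by linarith
    have "G y \<le> G c * (N y / N c)" if y: "c \<le> y" "y < b" for y
    proof -
      have "(\<integral>\<^sup>+t\<in>{c<..y}. ennreal (- 1 / (- N t)) \<partial>nu) = ennreal ((- ln (- (- N y))) - (- ln (- (- N c))))"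
      proof (rule nn_integral_substitution_Ioc[where f="\<lambda>s. - ln (- s)" and M="\<lambda>t. - N t"])
        show "- N v - - N u = measure nu {u<..v}" if "c \<le> u" "u \<le> v" "v \<le> y" for u v
          using nu.cdf_diff_eq[of u v] that by (cases "u = v") (auto simp: N_def)
        show "continuous_on ((\<lambda>t. - N t) ` {c..y}) ((/) (- 1))"
          using Npos y c by (intro continuous_intros) (force simp: less_imp_neq[symmetric])
        show "continuous_on {c..y} (\<lambda>t. - N t)"
          by (intro continuous_intros cN)
      qed (use y c Npos in \<open>auto simp: sets_nu nu.emeasure_eq_measure less_imp_le intro!: derivative_eq_intros\<close>)
      then have "ennreal ((- ln (- (- N y))) - (- ln (- (- N c)))) = (\<integral>\<^sup>+t\<in>{c<..y}. ennreal (- 1 / (- N t)) \<partial>nu)"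
        by (rule sym)
      also have "\<dots>
          \<le> (\<integral>\<^sup>+t. ennreal (indicator {a<..<b} t * w t) * indicator {c<..y} t \<partial>nu)"
        using y c N_ge pos Npos
        by (intro nn_integral_mono) (auto simp: indicator_def w_def intro!: ennreal_leI divide_left_mono mult_pos_pos)
      also have "\<dots> = ennreal (J y - J c)"
        using y c by (intro J) auto
      finally have "ln (N c) - ln (N y) \<le> J y - J c"
        using J(2)[of c y] y c by (auto simp: ennreal_le_iff2)
      then have "exp (k - J y) \<le> exp ((k - J c) + (ln (N y) - ln (N c)))"
        by simp
      then show ?thesis
        using y c Npos by (simp add: FG exp_add exp_diff)
    qed
    then show "eventually (\<lambda>y. G y \<le> G c * (N y / N c)) (at_left b)"
      using c by (auto simp: eventually_at_left intro!: exI[of _ c])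
    have "(N \<longlongrightarrow> N b) (at_left b)"
      using cN[of UNIV] by (auto simp: continuous_on_def intro: tendsto_within_subset)
    then have "((\<lambda>x. G c * (N x / N c)) \<longlongrightarrow> G c * (N b / N c)) (at_left b)"
      using Npos[of c] c by (intro tendsto_intros) auto
    then show "((\<lambda>x. G c * (N x / N c)) \<longlongrightarrow> 0) (at_left b)"
      by (simp add: N_def)
  qed (auto simp: G_def)
  have "pos_data mu nu a b r1 r2 F G"
    unfolding pos_data_def
  proof (intro conjI ballI)
    show "density r1 (\<lambda>x. ennreal (G x)) = restr mu {a<..<b}"
      unfolding r1_def restr_def
      by (subst density_density_eq)
        (auto intro!: arg_cong[where f="density mu"] simp: indicator_def FG simp flip: ennreal_mult)
    show "density r2 (\<lambda>x. ennreal (F x)) = restr nu {a<..<b}"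
      unfolding r2_def restr_def
      by (subst density_density_eq)
        (auto intro!: arg_cong[where f="density nu"] simp: indicator_def FG simp flip: ennreal_mult)
    show "emeasure r1 (UNIV - {a<..<b}) = 0"
      unfolding r1_def by (subst emeasure_density) (auto simp: nn_integral_0_iff_AE sets_mu indicator_def)
    show "emeasure r2 (UNIV - {a<..<b}) = 0"
      unfolding r2_def by (subst emeasure_density) (auto simp: nn_integral_0_iff_AE sets_nu indicator_def)
    show "ennreal (F y) = emeasure r1 {a<..y}" if "y \<in> {a<..<b}" for y
      using that by (intro emeasure_Ioc_limit[symmetric] limF r1) auto
    show "ennreal (G x) = emeasure r2 {x..<b}" if x: "x \<in> {a<..<b}" for x
    proof -
      have "emeasure r2 {x..<b} = emeasure r2 {x<..<b}"
      proof (rule emeasure_eq_AE)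
        have "AE t in nu. t \<noteq> x"
          by (rule AE_I[where N="{x}"]) (auto simp: atomless_nu sets_nu)
        then have "AE t in r2. t \<noteq> x"
          unfolding r2_def by (subst AE_density) auto
        then show "AE t in r2. t \<in> {x..<b} \<longleftrightarrow> t \<in> {x<..<b}"
          by eventually_elim auto
      qed auto
      then show ?thesis
        using x emeasure_Ioo_limit[of r2 x b G] limG r2 by simp
    qed
  qed (use cFG FG in auto)
  then show ?thesis
    by blast
qed

end

section \<open>Couplings and optimality\<close>


text \<open>Each t in \<open>C\<close> costs a null set, but \<open>C\<close> may be uncountable. A
  point of \<open>C\<close> in [X p, Y p) yields a point of the countable set \<open>D\<close> in
  the same half-open interval. If only the end point \<open>Y p\<close> lies in \<open>C\<close>, it
  is the least point of \<open>C\<close> above some rational, thus one of the countably many values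
  in \<open>E\<close>, and \<open>Y\<close> avoids these almost surely.\<close>

lemma AE_no_crossing:
  fixes X Y :: "'a \<Rightarrow> real"
  assumes [measurable]: "X \<in> borel_measurable M" "Y \<in> borel_measurable M"
    and C: "closed C"
    and cross: "\<And>t. t \<in> C \<Longrightarrow> AE p in M. \<not> (X p \<le> t \<and> t < Y p)"
    and point: "\<And>c. AE p in M. Y p \<noteq> c"
  shows "AE p in M. X p < Y p \<longrightarrow> {X p..Y p} \<inter> C = {}"
proof -
  \<comment> \<open>Intersecting with \<open>C\<close> discards the arbitrary value that
    \<open>Sup\<close> has on the empty set.\<close>
  define D where "D = (\<lambda>q. Sup (C \<inter> {..<q})) ` \<rat> \<inter> C"
  define E where "E = (\<lambda>q. Inf (C \<inter> {q<..})) ` \<rat>"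
  have "countable D" "countable E"
    unfolding D_def E_def by (auto intro: countable_rat)
  then have "AE p in M. \<forall>d\<in>D. \<not> (X p \<le> d \<and> d < Y p)" "AE p in M. \<forall>e\<in>E. Y p \<noteq> e"
    using cross point by (auto simp: AE_ball_countable D_def)
  then show ?thesis
  proof eventually_elim
    case (elim p)
    show ?case
    proof (intro impI equalityI subsetI)
      fix s assume XY: "X p < Y p" and s: "s \<in> {X p..Y p} \<inter> C"
      have no: "s' \<notin> C" if s': "X p \<le> s'" "s' < Y p" for s'
      proof
        assume "s' \<in> C"
        \<comment> \<open>A rational strictly below \<open>Y p\<close> keeps the supremum strictly
          below \<open>Y p\<close>.\<close>
        obtain q where q: "q \<in> \<rat>" "s' < q" "q < Y p"
          using Rats_dense_in_real[OF s'(2)] by auto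
        let ?S = "C \<inter> {..<q}"
        have ne: "?S \<noteq> {}" "bdd_above ?S" and s'S: "s' \<in> ?S"
          using \<open>s' \<in> C\<close> q by (auto intro: bdd_aboveI[of _ q])
        have "Sup ?S \<in> closure ?S"
          by (rule closure_contains_Sup[OF ne])
        also have "closure ?S \<subseteq> C"
          by (rule closure_minimal[OF _ C]) auto
        finally have "Sup ?S \<in> D"
          using q by (auto simp: D_def)
        moreover have "s' \<le> Sup ?S"
          by (rule cSup_upper[OF s'S ne(2)])
        moreover have "Sup ?S \<le> q"
          by (rule cSup_least[OF ne(1)]) auto
        ultimately show False
          using elim(1) s' q by force
      qed
      have sY: "s = Y p"
        using no[of s] s by force
      obtain q where q: "q \<in> \<rat>" "X p < q" "q < Y p"
        using Rats_dense_in_real[OF XY] by auto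
      have "Inf (C \<inter> {q<..}) = Y p"
      proof (rule cInf_eq_minimum)
        show "Y p \<in> C \<inter> {q<..}"
          using s sY q by auto
        show "Y p \<le> c" if "c \<in> C \<inter> {q<..}" for c
          using no[of c] that q by force
      qed
      then have "Y p \<in> E"
        unfolding E_def using q(1) by (metis imageI)
      then show "s \<in> {}"
        using elim(2) by blast
    qed auto
  qed
qed

text \<open>The half-open condition matches \<open>cdf\<close>, which counts \<open>{..t}\<close>:
  the set is \<open>{..t} \<times> UNIV\<close> without \<open>{..t} \<times> {..t}\<close>.\<close>

definition upcross :: "real \<Rightarrow> (real \<times> real) set" where
  "upcross t = {p. fst p \<le> t \<and> t < snd p}"

definition downcross :: "real \<Rightarrow> (real \<times> real) set" where
  "downcross t = {p. snd p \<le> t \<and> t < fst p}"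

lemma sets_cross [measurable]:
  "upcross t \<in> sets (borel \<Otimes>\<^sub>M borel)" "downcross t \<in> sets (borel \<Otimes>\<^sub>M borel)"
proof -
  have "upcross t = {p \<in> space (borel \<Otimes>\<^sub>M borel). fst p \<le> t \<and> t < snd p}"
    "downcross t = {p \<in> space (borel \<Otimes>\<^sub>M borel). snd p \<le> t \<and> t < fst p}"
    by (auto simp: upcross_def downcross_def space_pair_measure)
  then show "upcross t \<in> sets (borel \<Otimes>\<^sub>M borel)" "downcross t \<in> sets (borel \<Otimes>\<^sub>M borel)"
    by simp_all
qed

context transport_pair
begin

lemma abs_Fcal_le_1: "\<bar>Fcal mu nu t\<bar> \<le> 1"
proof -
  have "0 \<le> cdf mu t" "cdf mu t \<le> 1" "0 \<le> cdf nu t" "cdf nu t \<le> 1"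
    by (simp_all add: cdf_def)
  then show ?thesis
    by (auto simp: Fcal_def)
qed

text \<open>This integral is the lower bound for the cost; its finiteness permits cancellation when
  the bound is attained.\<close>

lemma integral_abs_Fcal_finite: "(\<integral>\<^sup>+t. ennreal \<bar>Fcal mu nu t\<bar> \<partial>lborel) < \<infinity>"
proof -
  obtain R where R: "\<And>t. R < \<bar>t\<bar> \<Longrightarrow> Fcal mu nu t = 0"
    using vanish by auto
  have "(\<integral>\<^sup>+t. ennreal \<bar>Fcal mu nu t\<bar> \<partial>lborel) \<le> (\<integral>\<^sup>+t. 1 * indicator {- R..R} t \<partial>lborel)"
  proof (intro nn_integral_mono)
    fix t
    show "ennreal \<bar>Fcal mu nu t\<bar> \<le> 1 * indicator {- R..R} t"
      using R[of t] abs_Fcal_le_1[of t] by (auto simp: indicator_def ennreal_le_1)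
  qed
  also have "\<dots> < \<infinity>"
    by (simp add: nn_integral_cmult emeasure_lborel_Icc_eq)
  finally show ?thesis .
qed

end

section \<open>Mass crossing a level, for an arbitrary coupling\<close>

locale coupled_pair = transport_pair +
  fixes g :: "(real \<times> real) measure"
  assumes coupling: "coupling mu nu g"
begin

sublocale g: prob_space g
  using coupling by (simp add: coupling_def)

lemma sets_g [measurable_cong, simp]: "sets g = sets (borel \<Otimes>\<^sub>M borel)"
  and distr_fst: "distr g borel fst = mu" and distr_snd: "distr g borel snd = nu"
  using coupling by (auto simp: coupling_def)

lemma space_g [simp]: "space g = UNIV"
  using sets_eq_imp_space_eq[OF sets_g] by (simp add: space_pair_measure)

lemma nn_integral_fst: "f \<in> borel_measurable borel \<Longrightarrow> (\<integral>\<^sup>+p. f (fst p) \<partial>g) = (\<integral>\<^sup>+x. f x \<partial>mu)"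
  unfolding distr_fst[symmetric] by (subst nn_integral_distr) auto

lemma nn_integral_snd: "f \<in> borel_measurable borel \<Longrightarrow> (\<integral>\<^sup>+p. f (snd p) \<partial>g) = (\<integral>\<^sup>+x. f x \<partial>nu)"
  unfolding distr_snd[symmetric] by (subst nn_integral_distr) auto

lemma measure_fst: "A \<in> sets borel \<Longrightarrow> measure g (A \<times> UNIV) = measure mu A"
  unfolding distr_fst[symmetric] by (subst measure_distr) (auto simp: vimage_fst)

lemma measure_snd: "A \<in> sets borel \<Longrightarrow> measure g (UNIV \<times> A) = measure nu A"
  unfolding distr_snd[symmetric] by (subst measure_distr) (auto simp: vimage_snd)

lemma AE_fst_iff: "{x. P x} \<in> sets borel \<Longrightarrow> (AE p in g. P (fst p)) \<longleftrightarrow> (AE x in mu. P x)"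
  unfolding distr_fst[symmetric] by (subst AE_distr_iff) auto

lemma AE_snd_iff: "{x. P x} \<in> sets borel \<Longrightarrow> (AE p in g. P (snd p)) \<longleftrightarrow> (AE x in nu. P x)"
  unfolding distr_snd[symmetric] by (subst AE_distr_iff) auto

text \<open>\<open>{..t} \<times> UNIV\<close> and \<open>UNIV \<times> {..t}\<close> have masses
  \<open>cdf mu t\<close> and \<open>cdf nu t\<close>; removing the common part \<open>B\<close>
  leaves the two crossing sets.\<close>

lemma cross_diff: "g.prob (upcross t) - g.prob (downcross t) = Fcal mu nu t"
proof -
  define B where "B = {..t} \<times> {..t}"
  have [measurable]: "B \<in> sets (borel \<Otimes>\<^sub>M borel)"
    unfolding B_def by measurable
  have "({..t} \<times> UNIV) = upcross t \<union> B" "upcross t \<inter> B = {}"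
    "(UNIV \<times> {..t}) = downcross t \<union> B" "downcross t \<inter> B = {}"
    by (auto simp: B_def upcross_def downcross_def)
  then have "g.prob ({..t} \<times> UNIV) = g.prob (upcross t) + g.prob B"
    "g.prob (UNIV \<times> {..t}) = g.prob (downcross t) + g.prob B"
    by (simp_all add: g.finite_measure_Union)
  then show ?thesis
    using measure_fst[of "{..t}"] measure_snd[of "{..t}"] by (simp add: Fcal_def cdf_def)
qed

text \<open>From level t to level s, \<open>upcross\<close> gains only pairs starting in
  \<open>{t<..s}\<close> and loses only pairs ending there. With atomless marginals the crossing
  mass is therefore continuous in the level.\<close>

lemma upcross_le:
  assumes "t \<le> s"
  shows "\<bar>g.prob (upcross s) - g.prob (upcross t)\<bar> \<le> (cdf mu s - cdf mu t) + (cdf nu s - cdf nu t)"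
proof -
  have "g.prob (upcross s) \<le> g.prob (upcross t \<union> ({t<..s} \<times> UNIV))"
  proof (rule g.finite_measure_mono)
    show "upcross s \<subseteq> upcross t \<union> ({t<..s} \<times> UNIV)"
      using assms by (auto simp: upcross_def)
    show "upcross t \<union> ({t<..s} \<times> UNIV) \<in> g.events"
      by measurable
  qed
  also have "\<dots> \<le> g.prob (upcross t) + g.prob ({t<..s} \<times> UNIV)"
    by (intro measure_Un_le) auto
  finally have 1: "g.prob (upcross s) \<le> g.prob (upcross t) + measure mu {t<..s}"
    by (simp add: measure_fst)
  have "g.prob (upcross t) \<le> g.prob (upcross s \<union> (UNIV \<times> {t<..s}))"
  proof (rule g.finite_measure_mono)
    show "upcross t \<subseteq> upcross s \<union> (UNIV \<times> {t<..s})"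
      using assms by (auto simp: upcross_def)
    show "upcross s \<union> (UNIV \<times> {t<..s}) \<in> g.events"
      by measurable
  qed
  also have "\<dots> \<le> g.prob (upcross s) + g.prob (UNIV \<times> {t<..s})"
    by (intro measure_Un_le) auto
  finally have 2: "g.prob (upcross t) \<le> g.prob (upcross s) + measure nu {t<..s}"
    by (simp add: measure_snd)
  show ?thesis
  proof (cases "t = s")
    case False
    then have "measure mu {t<..s} = cdf mu s - cdf mu t" "measure nu {t<..s} = cdf nu s - cdf nu t"
      using mu.cdf_diff_eq[of t s] nu.cdf_diff_eq[of t s] assms by simp_all
    moreover have "0 \<le> measure mu {t<..s}" "0 \<le> measure nu {t<..s}"
      by simp_all
    ultimately show ?thesis
      using 1 2 by linarith
  qed simp
qed

lemma continuous_upcross: "continuous_on UNIV (\<lambda>t. g.prob (upcross t))"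
proof (intro continuous_at_imp_continuous_on ballI)
  fix t :: real
  have "isCont (cdf mu) t" "isCont (cdf nu) t"
    by (simp_all add: mu.isCont_cdf nu.isCont_cdf measure_def atomless_mu atomless_nu)
  then have lim: "((\<lambda>s. \<bar>cdf mu s - cdf mu t\<bar> + \<bar>cdf nu s - cdf nu t\<bar>) \<longlongrightarrow> \<bar>cdf mu t - cdf mu t\<bar> + \<bar>cdf nu t - cdf nu t\<bar>) (at t)"
    unfolding isCont_def by (intro tendsto_intros)
  have "((\<lambda>s. g.prob (upcross s) - g.prob (upcross t)) \<longlongrightarrow> 0) (at t)"
  proof (rule Lim_null_comparison)
    show "eventually (\<lambda>s. norm (g.prob (upcross s) - g.prob (upcross t))
        \<le> \<bar>cdf mu s - cdf mu t\<bar> + \<bar>cdf nu s - cdf nu t\<bar>) (at t)"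
    proof (intro always_eventually allI)
      fix s
      show "norm (g.prob (upcross s) - g.prob (upcross t)) \<le> \<bar>cdf mu s - cdf mu t\<bar> + \<bar>cdf nu s - cdf nu t\<bar>"
        using upcross_le[of s t] upcross_le[of t s] by (cases "s \<le> t") auto
    qed
  qed (use lim in simp)
  then show "isCont (\<lambda>t. g.prob (upcross t)) t"
    unfolding isCont_def by (simp add: LIM_zero_iff)
qed

lemma downcross_eq: "g.prob (downcross t) = g.prob (upcross t) - Fcal mu nu t"
  using cross_diff[of t] by simp

lemma prob_upcross_measurable [measurable]: "(\<lambda>t. g.prob (upcross t)) \<in> borel_measurable borel"
  by (rule borel_measurable_continuous_onI[OF continuous_upcross])

lemma prob_downcross_measurable [measurable]: "(\<lambda>t. g.prob (downcross t)) \<in> borel_measurable borel"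
  unfolding downcross_eq by measurable

text \<open>The distance of the two coordinates is the length of the set of levels that the pair
  crosses, so Tonelli decomposes the cost by levels.\<close>

lemma transport_cost_eq:
  "transport_cost g = (\<integral>\<^sup>+t. ennreal (g.prob (upcross t) + g.prob (downcross t)) \<partial>lborel)"
proof -
  interpret pair_sigma_finite g lborel ..
  have meas [measurable]: "(\<lambda>(p, t). indicator (upcross t \<union> downcross t) p :: ennreal) \<in> borel_measurable (g \<Otimes>\<^sub>M lborel)"
  proof -
    have "(\<lambda>(p, t). indicator (upcross t \<union> downcross t) p :: ennreal)
        = (\<lambda>z. if fst (fst z) \<le> snd z \<and> snd z < snd (fst z) \<or> snd (fst z) \<le> snd z \<and> snd z < fst (fst z) then 1 else 0)"
      by (auto simp: fun_eq_iff indicator_def upcross_def downcross_def)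
    also have "\<dots> \<in> borel_measurable (g \<Otimes>\<^sub>M lborel)"
      by measurable
    finally show ?thesis .
  qed
  have "transport_cost g = (\<integral>\<^sup>+p. (\<integral>\<^sup>+t. indicator (upcross t \<union> downcross t) p \<partial>lborel) \<partial>g)"
    unfolding transport_cost_def
  proof (intro nn_integral_cong)
    fix p :: "real \<times> real"
    have "(\<integral>\<^sup>+t. indicator (upcross t \<union> downcross t) p \<partial>lborel)
        = (\<integral>\<^sup>+t. indicator ({fst p..<snd p} \<union> {snd p..<fst p}) t \<partial>lborel)"
      by (intro nn_integral_cong) (auto simp: indicator_def upcross_def downcross_def)
    also have "\<dots> = emeasure lborel ({fst p..<snd p} \<union> {snd p..<fst p})"
      by simp
    also have "\<dots> = ennreal \<bar>snd p - fst p\<bar>"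
      by (cases "fst p \<le> snd p") auto
    finally show "ennreal \<bar>snd p - fst p\<bar> = (\<integral>\<^sup>+t. indicator (upcross t \<union> downcross t) p \<partial>lborel)" ..
  qed
  also have "\<dots> = (\<integral>\<^sup>+t. (\<integral>\<^sup>+p. indicator (upcross t \<union> downcross t) p \<partial>g) \<partial>lborel)"
    by (rule Fubini'[symmetric]) (rule meas)
  also have "\<dots> = (\<integral>\<^sup>+t. ennreal (g.prob (upcross t) + g.prob (downcross t)) \<partial>lborel)"
  proof (intro nn_integral_cong)
    fix t
    have "upcross t \<inter> downcross t = {}"
      by (auto simp: upcross_def downcross_def)
    then show "(\<integral>\<^sup>+p. indicator (upcross t \<union> downcross t) p \<partial>g) = ennreal (g.prob (upcross t) + g.prob (downcross t))"
      by (simp add: g.emeasure_eq_measure g.finite_measure_Union)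
  qed
  finally show ?thesis .
qed

lemma transport_cost_ge: "(\<integral>\<^sup>+t. ennreal \<bar>Fcal mu nu t\<bar> \<partial>lborel) \<le> transport_cost g"
  unfolding transport_cost_eq
proof (intro nn_integral_mono ennreal_leI)
  fix t
  show "\<bar>Fcal mu nu t\<bar> \<le> g.prob (upcross t) + g.prob (downcross t)"
    using cross_diff[of t] measure_nonneg[of g "upcross t"] measure_nonneg[of g "downcross t"] by linarith
qed

lemma transport_cost_no_cross:
  assumes "\<And>t. g.prob (upcross t) = 0 \<or> g.prob (downcross t) = 0"
  shows "transport_cost g = (\<integral>\<^sup>+t. ennreal \<bar>Fcal mu nu t\<bar> \<partial>lborel)"
  unfolding transport_cost_eq
proof (intro nn_integral_cong arg_cong[where f=ennreal])
  fix t
  show "g.prob (upcross t) + g.prob (downcross t) = \<bar>Fcal mu nu t\<bar>"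
    using cross_diff[of t] assms[of t] measure_nonneg[of g "upcross t"] measure_nonneg[of g "downcross t"] by linarith
qed

text \<open>The excess \<open>h\<close> is nonnegative with integral 0, hence 0 almost everywhere;
  by continuity it is 0 everywhere, as an open null set is empty. The value at every level is wanted
  because levels are later integrated against \<open>mu\<close> instead of Lebesgue measure.\<close>

lemma optimal_cross_sum:
  assumes opt: "transport_cost g \<le> (\<integral>\<^sup>+t. ennreal \<bar>Fcal mu nu t\<bar> \<partial>lborel)"
  shows "g.prob (upcross t) + g.prob (downcross t) = \<bar>Fcal mu nu t\<bar>"
proof -
  define h where "h t = g.prob (upcross t) + g.prob (downcross t) - \<bar>Fcal mu nu t\<bar>" for t
  have h0: "0 \<le> h t" for t
    using cross_diff[of t] measure_nonneg[of g "upcross t"] measure_nonneg[of g "downcross t"]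
    unfolding h_def by linarith
  have ch: "continuous_on UNIV h"
    unfolding h_def downcross_eq by (intro continuous_intros continuous_upcross continuous_Fcal)
  then have [measurable]: "h \<in> borel_measurable borel"
    by (rule borel_measurable_continuous_onI)
  let ?F = "\<integral>\<^sup>+t. ennreal \<bar>Fcal mu nu t\<bar> \<partial>lborel"
  have "?F + (\<integral>\<^sup>+t. ennreal (h t) \<partial>lborel) = (\<integral>\<^sup>+t. ennreal \<bar>Fcal mu nu t\<bar> + ennreal (h t) \<partial>lborel)"
    by (rule nn_integral_add[symmetric]) auto
  also have "\<dots> = transport_cost g"
    unfolding transport_cost_eq
    by (intro nn_integral_cong) (simp add: h0 flip: ennreal_plus, simp add: h_def)
  finally have "?F + (\<integral>\<^sup>+t. ennreal (h t) \<partial>lborel) \<le> ?F + 0"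
    using opt by simp
  then have "(\<integral>\<^sup>+t. ennreal (h t) \<partial>lborel) = 0"
    using integral_abs_Fcal_finite by (simp only: ennreal_add_left_cancel_le) auto
  then have "AE t in lborel. h t = 0"
    by (subst (asm) nn_integral_0_iff_AE) (auto simp: h0 antisym ennreal_eq_0_iff)
  then have null: "{t. h t \<noteq> 0} \<in> null_sets lborel"
    by (subst (asm) AE_iff_null) auto
  have "open {t. h t \<noteq> 0}"
    by (intro open_Collect_neq ch continuous_intros)
  then have "{t. h t \<noteq> 0} = {}"
    using null open_not_negligible null_sets_completionI by (auto simp: negligible_iff_null_sets)
  then show ?thesis
    unfolding h_def by auto
qed

end

text \<open>Optimality is expressed as attaining the lower bound. That this describes exactly
  \<open>O1 mu nu\<close> can be shown only once a plan attaining the bound exists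
  (\<open>O1_iff\<close>).\<close>

locale optimal_pair = coupled_pair +
  assumes optimal: "transport_cost g \<le> (\<integral>\<^sup>+t. ennreal \<bar>Fcal mu nu t\<bar> \<partial>lborel)"
begin

lemma prob_upcross: "g.prob (upcross t) = max 0 (Fcal mu nu t)"
  and prob_downcross: "g.prob (downcross t) = max 0 (- Fcal mu nu t)"
  using optimal_cross_sum[OF optimal, of t] cross_diff[of t] by linarith+

lemma AE_not_upcross:
  assumes "t \<notin> Aplus mu nu"
  shows "AE p in g. \<not> (fst p \<le> t \<and> t < snd p)"
proof (rule AE_I')
  show "upcross t \<in> null_sets g"
    using assms by (auto simp: null_sets_def g.emeasure_eq_measure prob_upcross Aplus_iff)
qed (auto simp: upcross_def)

lemma AE_not_downcross:
  assumes "t \<notin> Aminus mu nu"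
  shows "AE p in g. \<not> (snd p \<le> t \<and> t < fst p)"
proof (rule AE_I')
  show "downcross t \<in> null_sets g"
    using assms by (auto simp: null_sets_def g.emeasure_eq_measure prob_downcross Aminus_iff)
qed (auto simp: downcross_def)

text \<open>\<open>AE_no_crossing\<close> is applied to the closed complement of A+ for upward moves
  and, with the coordinates exchanged, to that of A- for downward moves.\<close>

lemma AE_admissible: "AE p in g. p \<in> admissible"
proof -
  have 1: "AE p in g. fst p < snd p \<longrightarrow> {fst p..snd p} \<inter> (- Aplus mu nu) = {}"
  proof (rule AE_no_crossing)
    show "AE p in g. snd p \<noteq> c" for c
      using AE_not_point(2)[of c] by (subst AE_snd_iff) (auto simp: Collect_neg_eq)
    show "AE p in g. \<not> (fst p \<le> t \<and> t < snd p)" if "t \<in> - Aplus mu nu" for t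
      using that by (intro AE_not_upcross) auto
  qed (use open_A in \<open>auto simp: closed_def\<close>)
  have 2: "AE p in g. snd p < fst p \<longrightarrow> {snd p..fst p} \<inter> (- Aminus mu nu) = {}"
  proof (rule AE_no_crossing)
    show "AE p in g. fst p \<noteq> c" for c
      using AE_not_point(1)[of c] by (subst AE_fst_iff) (auto simp: Collect_neg_eq)
    show "AE p in g. \<not> (snd p \<le> t \<and> t < fst p)" if "t \<in> - Aminus mu nu" for t
      using that by (intro AE_not_downcross) auto
  qed (use open_A in \<open>auto simp: closed_def\<close>)
  from 1 2 show ?thesis
    by eventually_elim (auto simp: admissible_def split_beta)
qed

end

section \<open>The optimal plan\<close>


context transport_pair
begin

sublocale pair: pair_sigma_finite mu nu ..

lemma sets_pair [measurable_cong]: "sets (mu \<Otimes>\<^sub>M nu) = sets (borel \<Otimes>\<^sub>M borel)"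
  by (intro sets_pair_measure_cong sets_mu sets_nu)

lemma nn_integral_pair_fst:
  "f \<in> borel_measurable (borel \<Otimes>\<^sub>M borel) \<Longrightarrow> (\<integral>\<^sup>+p. f p \<partial>(mu \<Otimes>\<^sub>M nu)) = (\<integral>\<^sup>+x. (\<integral>\<^sup>+y. f (x, y) \<partial>nu) \<partial>mu)"
  by (rule nu.nn_integral_fst[symmetric]) (simp cong: measurable_cong_sets add: sets_pair)

lemma nn_integral_pair_snd:
  "f \<in> borel_measurable (borel \<Otimes>\<^sub>M borel) \<Longrightarrow> (\<integral>\<^sup>+p. f p \<partial>(mu \<Otimes>\<^sub>M nu)) = (\<integral>\<^sup>+y. (\<integral>\<^sup>+x. f (x, y) \<partial>mu) \<partial>nu)"
  by (rule pair.nn_integral_snd[symmetric]) (simp cong: measurable_cong_sets add: sets_pair)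

lemma kernel_eq_0:
  assumes "(x, y) \<notin> admissible \<or> x = y"
  shows "kernel x y = 0"
proof -
  have "indicator (admissible - {(x, y). x = y}) (x, y) = (0 :: ennreal)"
    using assms by (auto simp: indicator_def)
  then show ?thesis
    by (simp add: kernel_def)
qed

lemma kernel_eq_0_Aeq:
  assumes "x \<in> Aeq mu nu \<or> y \<in> Aeq mu nu"
  shows "kernel x y = 0"
proof (rule kernel_eq_0, rule ccontr)
  assume "\<not> ((x, y) \<notin> admissible \<or> x = y)"
  then have "{x, y} \<subseteq> Aplus mu nu \<union> Aminus mu nu"
    by (cases x y rule: linorder_cases) (auto simp: admissible_def subset_eq)
  with assms show False
    by (auto simp: Aplus_iff Aminus_iff Aeq_iff)
qed

text \<open>A solution of the system is chosen inside the proof, but the conclusions mention the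
  kernel alone.\<close>

lemma kernel_marginals_Aplus:
  assumes "z \<in> Aplus mu nu"
  shows "(\<integral>\<^sup>+y. kernel z y \<partial>nu) = 1" "(\<integral>\<^sup>+x. kernel x z \<partial>mu) = 1"
    "\<And>w. transport_pair.kernel nu mu w z = kernel z w" "\<And>w. transport_pair.kernel nu mu z w = kernel w z"
proof -
  have "0 < Fcal mu nu z"
    using assms by (simp add: Aplus_iff)
  then obtain a b where abz: "positivity_interval a b" "z \<in> {a<..<b}"
    by (rule positivity_interval_exists)
  obtain r1 r2 F G where "pos_data mu nu a b r1 r2 F G"
    using pos_data_exists[OF abz(1)] by blast
  then interpret interval_data mu nu a b r1 r2 F G
    using abz(1) by unfold_locales
  show "(\<integral>\<^sup>+y. kernel z y \<partial>nu) = 1" "(\<integral>\<^sup>+x. kernel x z \<partial>mu) = 1"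
    "\<And>w. transport_pair.kernel nu mu w z = kernel z w" "\<And>w. transport_pair.kernel nu mu z w = kernel w z"
    using abz by (simp_all add: kernel_marginal_fst kernel_marginal_snd kernel_swap)
qed

text \<open>On A+ a component gives the value 1, on A- the exchanged pair does so by invariance of
  the kernel, and on A the kernel vanishes. So the kernel carries exactly the mass outside A, in
  both marginals.\<close>

lemma kernel_marginals:
  "(\<integral>\<^sup>+y. kernel z y \<partial>nu) = indicator (- Aeq mu nu) z"
  "(\<integral>\<^sup>+x. kernel x z \<partial>mu) = indicator (- Aeq mu nu) z"
proof -
  interpret sw: transport_pair nu mu by (rule swap)
  consider "z \<in> Aplus mu nu" | "z \<in> Aplus nu mu" | "z \<in> Aeq mu nu"
    by (cases "cdf mu z" "cdf nu z" rule: linorder_cases) (auto simp: Aplus_def Aeq_def)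
  then have "(\<integral>\<^sup>+y. kernel z y \<partial>nu) = indicator (- Aeq mu nu) z \<and> (\<integral>\<^sup>+x. kernel x z \<partial>mu) = indicator (- Aeq mu nu) z"
  proof cases
    case 1
    then show ?thesis
      using kernel_marginals_Aplus[OF 1] by (auto simp: Aplus_iff Aeq_iff indicator_def)
  next
    case 2
    then show ?thesis
      using sw.kernel_marginals_Aplus[OF 2] by (auto simp: Aplus_def Aeq_def indicator_def)
  next
    case 3
    then show ?thesis
      by (simp add: kernel_eq_0_Aeq)
  qed
  then show "(\<integral>\<^sup>+y. kernel z y \<partial>nu) = indicator (- Aeq mu nu) z"
    "(\<integral>\<^sup>+x. kernel x z \<partial>mu) = indicator (- Aeq mu nu) z"
    by simp_all
qed

text \<open>An admissible pair with \<open>x \<noteq> y\<close> has both points on the same side of a zero \<open>t\<close> of \<open>Fcal mu nu\<close>, so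
  the kernel carries the mass of \<open>{..t} - Aeq mu nu\<close> from \<open>mu\<close> to \<open>nu\<close>.\<close>
lemma emeasure_Aeq_atMost:
  assumes t: "t \<in> Aeq mu nu"
  shows "emeasure mu (Aeq mu nu \<inter> {..t}) = emeasure nu (Aeq mu nu \<inter> {..t})"
proof -
  have [measurable]: "- Aeq mu nu \<inter> {..t} \<in> sets borel"
    by (intro sets.Int borel_comp sets_A) auto
  have "emeasure mu (- Aeq mu nu \<inter> {..t}) = (\<integral>\<^sup>+x. indicator (- Aeq mu nu \<inter> {..t}) x \<partial>mu)"
    by (simp add: sets_mu)
  also have "\<dots> = (\<integral>\<^sup>+x. indicator {..t} x * (\<integral>\<^sup>+y. kernel x y \<partial>nu) \<partial>mu)"
    unfolding kernel_marginals by (intro nn_integral_cong) (auto simp: indicator_def)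
  also have "\<dots> = (\<integral>\<^sup>+p. indicator {..t} (fst p) * kernel (fst p) (snd p) \<partial>(mu \<Otimes>\<^sub>M nu))"
    by (subst nn_integral_pair_fst) (auto simp: nn_integral_cmult)
  also have "\<dots> = (\<integral>\<^sup>+p. indicator {..t} (snd p) * kernel (fst p) (snd p) \<partial>(mu \<Otimes>\<^sub>M nu))"
  proof (intro nn_integral_cong)
    fix p
    show "indicator {..t} (fst p) * kernel (fst p) (snd p) = indicator {..t} (snd p) * kernel (fst p) (snd p)"
    proof (cases "(fst p, snd p) \<in> admissible \<and> fst p \<noteq> snd p")
      case True
      then have "fst p \<le> t \<longleftrightarrow> snd p \<le> t"
        using t by (cases "fst p < snd p") (force simp: admissible_def Aplus_iff Aminus_iff Aeq_iff)+
      then show ?thesis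
        by (simp add: indicator_def)
    next
      case False
      then have "kernel (fst p) (snd p) = 0"
        by (intro kernel_eq_0) auto
      then show ?thesis
        by simp
    qed
  qed
  also have "\<dots> = (\<integral>\<^sup>+y. indicator {..t} y * (\<integral>\<^sup>+x. kernel x y \<partial>mu) \<partial>nu)"
    by (subst nn_integral_pair_snd) (auto simp: nn_integral_cmult)
  also have "\<dots> = (\<integral>\<^sup>+x. indicator (- Aeq mu nu \<inter> {..t}) x \<partial>nu)"
    unfolding kernel_marginals by (intro nn_integral_cong) (auto simp: indicator_def)
  also have "\<dots> = emeasure nu (- Aeq mu nu \<inter> {..t})"
    by (simp add: sets_nu)
  finally have "mu.prob (- Aeq mu nu \<inter> {..t}) = nu.prob (- Aeq mu nu \<inter> {..t})"
    by (simp add: mu.emeasure_eq_measure nu.emeasure_eq_measure)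
  moreover have "mu.prob {..t} = nu.prob {..t}"
    using t by (simp add: Aeq_def cdf_def)
  moreover have "measure rho {..t} = measure rho (Aeq mu nu \<inter> {..t}) + measure rho (- Aeq mu nu \<inter> {..t})"
    if "real_distribution rho" for rho
  proof -
    interpret rho: real_distribution rho by (rule that)
    have "measure rho ((Aeq mu nu \<inter> {..t}) \<union> (- Aeq mu nu \<inter> {..t})) = measure rho (Aeq mu nu \<inter> {..t}) + measure rho (- Aeq mu nu \<inter> {..t})"
      by (rule rho.finite_measure_Union) auto
    moreover have "(Aeq mu nu \<inter> {..t}) \<union> (- Aeq mu nu \<inter> {..t}) = {..t}"
      by auto
    ultimately show ?thesis
      by simp
  qed
  note this[OF mu.real_distribution_axioms] this[OF nu.real_distribution_axioms]
  ultimately show ?thesis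
    by (simp add: mu.emeasure_eq_measure nu.emeasure_eq_measure)
qed

text \<open>The distribution functions agree at zeros of \<open>Fcal\<close> by
  \<open>emeasure_Aeq_atMost\<close>, and at any other t because \<open>{a<..t}\<close> contains no
  zero when \<open>a\<close> is the left end of the component of t. This equality lets the mass on A
  stay in place.\<close>

lemma restr_Aeq: "restr mu (Aeq mu nu) = restr nu (Aeq mu nu)"
proof (rule cdf_unique')
  interpret sw: transport_pair nu mu by (rule swap)
  have em: "emeasure (restr rho A) B = emeasure rho (A \<inter> B)" "sets (restr rho A) = sets borel"
    if "sets rho = sets borel" "A \<in> sets borel" "B \<in> sets borel" for rho :: "real measure" and A B
    using that by (auto simp: restr_def emeasure_density indicator_inter_arith[symmetric] cong: measurable_cong_sets)
  note em = em[OF sets_mu sets_A(3)] em[OF sets_nu sets_A(3)]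
  have space: "space (restr mu (Aeq mu nu)) = UNIV" "space (restr nu (Aeq mu nu)) = UNIV"
    by (simp_all add: restr_def)
  show "finite_borel_measure (restr mu (Aeq mu nu))"
    by (intro finite_borel_measure.intro finite_measureI finite_borel_measure_axioms.intro)
      (simp_all add: space em, simp_all add: restr_def sets_mu sets_nu)
  show "finite_borel_measure (restr nu (Aeq mu nu))"
    by (intro finite_borel_measure.intro finite_measureI finite_borel_measure_axioms.intro)
      (simp_all add: space em, simp_all add: restr_def sets_mu sets_nu)
  show "cdf (restr mu (Aeq mu nu)) = cdf (restr nu (Aeq mu nu))"
  proof
    fix t
    have "emeasure mu (Aeq mu nu \<inter> {..t}) = emeasure nu (Aeq mu nu \<inter> {..t})"
    proof (cases "t \<in> Aeq mu nu")
      case False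
      then consider "0 < Fcal mu nu t" | "0 < Fcal nu mu t"
        by (cases "cdf mu t" "cdf nu t" rule: linorder_cases) (auto simp: Fcal_def Aeq_def)
      then obtain a where "a \<in> Aeq mu nu" "a < t" "Aeq mu nu \<inter> {a<..t} = {}"
      proof cases
        case 1
        then obtain a b where "positivity_interval a b" "t \<in> {a<..<b}"
          by (rule positivity_interval_exists)
        then show ?thesis
          by (intro that[of a]) (force simp: positivity_interval_def Aeq_iff)+
      next
        case 2
        then obtain a b where "sw.positivity_interval a b" "t \<in> {a<..<b}"
          by (rule sw.positivity_interval_exists)
        then show ?thesis
          by (intro that[of a]) (force simp: sw.positivity_interval_def Fcal_swap Aeq_iff)+
      qed
      moreover from this have "Aeq mu nu \<inter> {..t} = Aeq mu nu \<inter> {..a}"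
        by force
      ultimately show ?thesis
        using emeasure_Aeq_atMost[of a] by simp
    qed (rule emeasure_Aeq_atMost)
    then show "cdf (restr mu (Aeq mu nu)) t = cdf (restr nu (Aeq mu nu)) t"
      by (simp add: cdf_def measure_def em)
  qed
qed

lemma nn_integral_Aeq:
  assumes "f \<in> borel_measurable borel"
  shows "(\<integral>\<^sup>+x. f x * indicator (Aeq mu nu) x \<partial>mu) = (\<integral>\<^sup>+x. f x * indicator (Aeq mu nu) x \<partial>nu)"
proof -
  have "(\<integral>\<^sup>+x. f x \<partial>restr rho (Aeq mu nu)) = (\<integral>\<^sup>+x. f x * indicator (Aeq mu nu) x \<partial>rho)"
    if "sets rho = sets borel" for rho
    unfolding restr_def by (subst nn_integral_density) (use that assms in \<open>auto simp: mult.commute cong: measurable_cong_sets\<close>)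
  from this[OF sets_mu] this[OF sets_nu] show ?thesis
    by (simp add: restr_Aeq)
qed

text \<open>The first coordinate of \<open>mu \<Otimes>\<^sub>M nu\<close> supplies the diagonal part, so that the plan is a single image measure.\<close>
definition plan :: "(real \<times> real) measure" where
  "plan = distr (density (mu \<Otimes>\<^sub>M nu) (\<lambda>p. indicator (Aeq mu nu) (fst p) + kernel (fst p) (snd p)))
     (borel \<Otimes>\<^sub>M borel) (\<lambda>p. if fst p \<in> Aeq mu nu then (fst p, fst p) else p)"

lemma sets_plan [measurable_cong, simp]: "sets plan = sets (borel \<Otimes>\<^sub>M borel)"
  by (simp add: plan_def)

lemma nn_integral_plan:
  assumes [measurable]: "f \<in> borel_measurable (borel \<Otimes>\<^sub>M borel)"
  shows "(\<integral>\<^sup>+p. f p \<partial>plan) = (\<integral>\<^sup>+x. f (x, x) * indicator (Aeq mu nu) x \<partial>mu)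
    + (\<integral>\<^sup>+p. kernel (fst p) (snd p) * f p \<partial>(mu \<Otimes>\<^sub>M nu))"
proof -
  have [measurable]: "(\<lambda>p :: real \<times> real. if fst p \<in> Aeq mu nu then (fst p, fst p) else p) \<in> borel \<Otimes>\<^sub>M borel \<rightarrow>\<^sub>M borel \<Otimes>\<^sub>M borel"
    by measurable
  have "(\<integral>\<^sup>+p. f p \<partial>plan) = (\<integral>\<^sup>+p. (indicator (Aeq mu nu) (fst p) + kernel (fst p) (snd p))
      * f (if fst p \<in> Aeq mu nu then (fst p, fst p) else p) \<partial>(mu \<Otimes>\<^sub>M nu))"
    unfolding plan_def by (subst nn_integral_distr, measurable) (subst nn_integral_density; measurable)
  also have "\<dots> = (\<integral>\<^sup>+p. f (fst p, fst p) * indicator (Aeq mu nu) (fst p) + kernel (fst p) (snd p) * f p \<partial>(mu \<Otimes>\<^sub>M nu))"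
    \<comment> \<open>\<open>kernel\<close> vanishes when the first coordinate lies in A, so its
      share of the mass is not moved by the map.\<close>
    by (intro nn_integral_cong) (auto simp: kernel_eq_0_Aeq indicator_def)
  also have "\<dots> = (\<integral>\<^sup>+p. f (fst p, fst p) * indicator (Aeq mu nu) (fst p) \<partial>(mu \<Otimes>\<^sub>M nu))
      + (\<integral>\<^sup>+p. kernel (fst p) (snd p) * f p \<partial>(mu \<Otimes>\<^sub>M nu))"
    by (rule nn_integral_add) measurable
  also have "(\<integral>\<^sup>+p. f (fst p, fst p) * indicator (Aeq mu nu) (fst p) \<partial>(mu \<Otimes>\<^sub>M nu))
      = (\<integral>\<^sup>+x. f (x, x) * indicator (Aeq mu nu) x \<partial>mu)"
    using nu.emeasure_space_1 by (subst nn_integral_pair_fst) simp_all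
  finally show ?thesis .
qed

lemma nn_integral_plan_fst:
  assumes [measurable]: "f \<in> borel_measurable borel"
  shows "(\<integral>\<^sup>+p. f (fst p) \<partial>plan) = (\<integral>\<^sup>+x. f x \<partial>mu)"
proof -
  have "(\<integral>\<^sup>+p. kernel (fst p) (snd p) * f (fst p) \<partial>(mu \<Otimes>\<^sub>M nu)) = (\<integral>\<^sup>+x. indicator (- Aeq mu nu) x * f x \<partial>mu)"
    by (subst nn_integral_pair_fst) (simp_all add: nn_integral_multc kernel_marginals)
  then have "(\<integral>\<^sup>+p. f (fst p) \<partial>plan) = (\<integral>\<^sup>+x. f x * indicator (Aeq mu nu) x + indicator (- Aeq mu nu) x * f x \<partial>mu)"
    by (subst nn_integral_plan, simp, subst nn_integral_add) auto
  also have "\<dots> = (\<integral>\<^sup>+x. f x \<partial>mu)"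
    by (intro nn_integral_cong) (auto simp: indicator_def)
  finally show ?thesis .
qed

lemma nn_integral_plan_snd:
  assumes [measurable]: "f \<in> borel_measurable borel"
  shows "(\<integral>\<^sup>+p. f (snd p) \<partial>plan) = (\<integral>\<^sup>+x. f x \<partial>nu)"
proof -
  have "(\<integral>\<^sup>+p. kernel (fst p) (snd p) * f (snd p) \<partial>(mu \<Otimes>\<^sub>M nu)) = (\<integral>\<^sup>+x. indicator (- Aeq mu nu) x * f x \<partial>nu)"
    by (subst nn_integral_pair_snd) (simp_all add: nn_integral_multc kernel_marginals)
  then have "(\<integral>\<^sup>+p. f (snd p) \<partial>plan) = (\<integral>\<^sup>+x. f x * indicator (Aeq mu nu) x + indicator (- Aeq mu nu) x * f x \<partial>nu)"
    by (subst nn_integral_plan, simp, subst nn_integral_add) (auto simp: nn_integral_Aeq)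
  also have "\<dots> = (\<integral>\<^sup>+x. f x \<partial>nu)"
    by (intro nn_integral_cong) (auto simp: indicator_def)
  finally show ?thesis .
qed

lemma coupling_plan: "coupling mu nu plan"
  unfolding coupling_def
proof (intro conjI)
  show "distr plan borel fst = mu"
  proof (rule measure_eqI)
    fix B assume B: "B \<in> sets (distr plan borel fst)"
    then have [measurable]: "B \<in> sets borel"
      by simp
    have "emeasure (distr plan borel fst) B = (\<integral>\<^sup>+x. indicator B x \<partial>distr plan borel fst)"
      using B by simp
    also have "\<dots> = (\<integral>\<^sup>+p. indicator B (fst p) \<partial>plan)"
      by (rule nn_integral_distr) measurable
    also have "\<dots> = emeasure mu B"
      by (simp add: nn_integral_plan_fst sets_mu)
    finally show "emeasure (distr plan borel fst) B = emeasure mu B" .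
  qed (simp add: sets_mu)
  show "distr plan borel snd = nu"
  proof (rule measure_eqI)
    fix B assume B: "B \<in> sets (distr plan borel snd)"
    then have [measurable]: "B \<in> sets borel"
      by simp
    have "emeasure (distr plan borel snd) B = (\<integral>\<^sup>+x. indicator B x \<partial>distr plan borel snd)"
      using B by simp
    also have "\<dots> = (\<integral>\<^sup>+p. indicator B (snd p) \<partial>plan)"
      by (rule nn_integral_distr) measurable
    also have "\<dots> = emeasure nu B"
      by (simp add: nn_integral_plan_snd sets_nu)
    finally show "emeasure (distr plan borel snd) B = emeasure nu B" .
  qed (simp add: sets_nu)
  show "prob_space plan"
  proof
    show "emeasure plan (space plan) = 1"
      using nn_integral_plan_fst[of "\<lambda>_. 1"] mu.emeasure_space_1 by simp
  qed
qed simp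

section \<open>Support and optimality of the plan\<close>

lemma emeasure_plan:
  assumes "S \<in> sets (borel \<Otimes>\<^sub>M borel)"
  shows "emeasure plan S = (\<integral>\<^sup>+x. indicator S (x, x) * indicator (Aeq mu nu) x \<partial>mu)
    + (\<integral>\<^sup>+p. kernel (fst p) (snd p) * indicator S p \<partial>(mu \<Otimes>\<^sub>M nu))"
  using nn_integral_plan[of "indicator S"] assms by simp

lemma plan_off_support:
  "emeasure plan (UNIV - (Aeq mu nu \<times> Aeq mu nu \<union> (admissible - {(x, y). x = y}))) = 0"
proof (subst emeasure_plan)
  have "(\<integral>\<^sup>+x. indicator (UNIV - (Aeq mu nu \<times> Aeq mu nu \<union> (admissible - {(x, y). x = y}))) (x, x)
      * indicator (Aeq mu nu) x \<partial>mu) = (\<integral>\<^sup>+x. 0 \<partial>mu)"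
    by (intro nn_integral_cong) (auto simp: indicator_def)
  moreover have "(\<integral>\<^sup>+p. kernel (fst p) (snd p) * indicator (UNIV - (Aeq mu nu \<times> Aeq mu nu \<union> (admissible - {(x, y). x = y}))) p
      \<partial>(mu \<Otimes>\<^sub>M nu)) = (\<integral>\<^sup>+p. 0 \<partial>(mu \<Otimes>\<^sub>M nu))"
    by (intro nn_integral_cong) (auto simp: indicator_def intro!: kernel_eq_0)
  ultimately show "(\<integral>\<^sup>+x. indicator (UNIV - (Aeq mu nu \<times> Aeq mu nu \<union> (admissible - {(x, y). x = y}))) (x, x)
      * indicator (Aeq mu nu) x \<partial>mu) + (\<integral>\<^sup>+p. kernel (fst p) (snd p)
      * indicator (UNIV - (Aeq mu nu \<times> Aeq mu nu \<union> (admissible - {(x, y). x = y}))) p \<partial>(mu \<Otimes>\<^sub>M nu)) = 0"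
    by simp
next
  have "UNIV - (Aeq mu nu \<times> Aeq mu nu \<union> (admissible - {(x, y). x = y}))
      = space (borel \<Otimes>\<^sub>M borel) - (Aeq mu nu \<times> Aeq mu nu \<union> (admissible - {(x, y). x = y}))"
    by (simp add: space_pair_measure)
  also have "\<dots> \<in> sets (borel \<Otimes>\<^sub>M borel)"
    by measurable
  finally show "UNIV - (Aeq mu nu \<times> Aeq mu nu \<union> (admissible - {(x, y). x = y})) \<in> sets (borel \<Otimes>\<^sub>M borel)" .
qed

text \<open>A pair charged by the kernel that crosses t upwards has t in A+, one that crosses
  downwards has t in A-. So each level is crossed in one direction only, and the lower bound for the
  cost is attained.\<close>

lemma optimal_pair_plan: "optimal_pair mu nu plan"
proof -
  interpret coupled_pair mu nu plan
    by unfold_locales (rule coupling_plan)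
  have "prob_space.prob plan (upcross t) = 0 \<or> prob_space.prob plan (downcross t) = 0" for t
  proof (cases "t \<in> Aplus mu nu")
    case True
    then have t: "t \<notin> Aminus mu nu"
      by (auto simp: Aplus_iff Aminus_iff)
    have "kernel (fst p) (snd p) * indicator (downcross t) p = 0" for p
      using t by (cases "p \<in> admissible") (auto simp: indicator_def downcross_def admissible_def subset_eq split_beta intro!: kernel_eq_0)
    moreover have "indicator (downcross t) (x, x) = (0 :: ennreal)" for x
      by (simp add: downcross_def)
    ultimately have "emeasure plan (downcross t) = 0"
      by (simp only: emeasure_plan sets_cross nn_integral_const mult_zero_left add_0)
    then show ?thesis
      by (simp add: measure_def)
  next
    case t: False
    have "kernel (fst p) (snd p) * indicator (upcross t) p = 0" for p
      using t by (cases "p \<in> admissible") (auto simp: indicator_def upcross_def admissible_def subset_eq split_beta intro!: kernel_eq_0)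
    moreover have "indicator (upcross t) (x, x) = (0 :: ennreal)" for x
      by (simp add: upcross_def)
    ultimately have "emeasure plan (upcross t) = 0"
      by (simp only: emeasure_plan sets_cross nn_integral_const mult_zero_left add_0)
    then show ?thesis
      by (simp add: measure_def)
  qed
  then show ?thesis
    using transport_cost_no_cross by unfold_locales simp
qed

text \<open>Since \<open>plan\<close> attains the lower bound, the minimizers are exactly the
  couplings that attain it.\<close>

lemma O1_iff: "g \<in> O1 mu nu \<longleftrightarrow> optimal_pair mu nu g"
proof
  assume "g \<in> O1 mu nu"
  then have g: "coupling mu nu g" "transport_cost g \<le> transport_cost plan"
    using coupling_plan by (auto simp: O1_def)
  moreover have "transport_cost plan \<le> (\<integral>\<^sup>+t. ennreal \<bar>Fcal mu nu t\<bar> \<partial>lborel)"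
    using optimal_pair.optimal[OF optimal_pair_plan] .
  ultimately show "optimal_pair mu nu g"
    by unfold_locales auto
next
  assume "optimal_pair mu nu g"
  then interpret optimal_pair mu nu g .
  have "transport_cost g \<le> transport_cost g'" if "coupling mu nu g'" for g'
  proof -
    interpret g': coupled_pair mu nu g'
      using that by unfold_locales
    show ?thesis
      using optimal g'.transport_cost_ge by (rule order_trans)
  qed
  then show "g \<in> O1 mu nu"
    using coupling by (simp add: O1_def)
qed

lemma restr_plan_off_Aeq:
  assumes W [measurable]: "W \<in> sets borel" and "W \<inter> Aeq mu nu = {}"
  shows "restr plan (W \<times> W) = density (mu \<Otimes>\<^sub>M nu) (\<lambda>p. kernel (fst p) (snd p) * indicator (W \<times> W) p)"
proof (rule measure_eqI)
  show "sets (restr plan (W \<times> W)) = sets (density (mu \<Otimes>\<^sub>M nu) (\<lambda>p. kernel (fst p) (snd p) * indicator (W \<times> W) p))"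
    by (simp add: restr_def sets_pair)
  fix S assume "S \<in> sets (restr plan (W \<times> W))"
  then have [measurable]: "S \<in> sets (borel \<Otimes>\<^sub>M borel)"
    by (simp add: restr_def)
  have "emeasure (restr plan (W \<times> W)) S = (\<integral>\<^sup>+p. indicator (W \<times> W) p * indicator S p \<partial>plan)"
    unfolding restr_def by (rule emeasure_density) measurable
  also have "\<dots> = (\<integral>\<^sup>+x. indicator (W \<times> W) (x, x) * indicator S (x, x) * indicator (Aeq mu nu) x \<partial>mu)
      + (\<integral>\<^sup>+p. kernel (fst p) (snd p) * (indicator (W \<times> W) p * indicator S p) \<partial>(mu \<Otimes>\<^sub>M nu))"
    by (rule nn_integral_plan) measurable
  also have "(\<integral>\<^sup>+x. indicator (W \<times> W) (x, x) * indicator S (x, x) * indicator (Aeq mu nu) x \<partial>mu) = (\<integral>\<^sup>+x. 0 \<partial>mu)"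
    using assms by (intro nn_integral_cong) (auto simp: indicator_def)
  also have "(\<integral>\<^sup>+x. 0 \<partial>mu) + (\<integral>\<^sup>+p. kernel (fst p) (snd p) * (indicator (W \<times> W) p * indicator S p) \<partial>(mu \<Otimes>\<^sub>M nu))
      = (\<integral>\<^sup>+p. kernel (fst p) (snd p) * indicator (W \<times> W) p * indicator S p \<partial>(mu \<Otimes>\<^sub>M nu))"
    by (simp add: mult.assoc)
  also have "\<dots> = emeasure (density (mu \<Otimes>\<^sub>M nu) (\<lambda>p. kernel (fst p) (snd p) * indicator (W \<times> W) p)) S"
    by (rule emeasure_density[symmetric]) measurable
  finally show "emeasure (restr plan (W \<times> W)) S = emeasure (density (mu \<Otimes>\<^sub>M nu) (\<lambda>p. kernel (fst p) (snd p) * indicator (W \<times> W) p)) S" .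
qed

lemma restr_plan_Aeq:
  "restr plan (Aeq mu nu \<times> Aeq mu nu) = distr (restr mu (Aeq mu nu)) (borel \<Otimes>\<^sub>M borel) (\<lambda>x. (x, x))"
proof (rule measure_eqI)
  let ?A = "Aeq mu nu"
  show "sets (restr plan (?A \<times> ?A)) = sets (distr (restr mu ?A) (borel \<Otimes>\<^sub>M borel) (\<lambda>x. (x, x)))"
    by (simp add: restr_def)
  fix S assume "S \<in> sets (restr plan (?A \<times> ?A))"
  then have [measurable]: "S \<in> sets (borel \<Otimes>\<^sub>M borel)"
    by (simp add: restr_def)
  have "emeasure (restr plan (?A \<times> ?A)) S = (\<integral>\<^sup>+p. indicator (?A \<times> ?A) p * indicator S p \<partial>plan)"
    unfolding restr_def by (rule emeasure_density) measurable
  also have "\<dots> = (\<integral>\<^sup>+x. indicator (?A \<times> ?A) (x, x) * indicator S (x, x) * indicator ?A x \<partial>mu)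
      + (\<integral>\<^sup>+p. kernel (fst p) (snd p) * (indicator (?A \<times> ?A) p * indicator S p) \<partial>(mu \<Otimes>\<^sub>M nu))"
    by (rule nn_integral_plan) measurable
  also have "(\<integral>\<^sup>+p. kernel (fst p) (snd p) * (indicator (?A \<times> ?A) p * indicator S p) \<partial>(mu \<Otimes>\<^sub>M nu)) = (\<integral>\<^sup>+p. 0 \<partial>(mu \<Otimes>\<^sub>M nu))"
    by (intro nn_integral_cong) (auto simp: indicator_def kernel_eq_0_Aeq)
  also have "(\<integral>\<^sup>+x. indicator (?A \<times> ?A) (x, x) * indicator S (x, x) * indicator ?A x \<partial>mu) + (\<integral>\<^sup>+p. 0 \<partial>(mu \<Otimes>\<^sub>M nu))
      = (\<integral>\<^sup>+x. indicator ?A x * indicator S (x, x) \<partial>mu)"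
    by (simp, intro nn_integral_cong) (auto simp: indicator_def)
  also have "\<dots> = (\<integral>\<^sup>+x. indicator S (x, x) \<partial>restr mu ?A)"
    unfolding restr_def by (rule nn_integral_density[symmetric]) measurable
  also have "\<dots> = (\<integral>\<^sup>+p. indicator S p \<partial>distr (restr mu ?A) (borel \<Otimes>\<^sub>M borel) (\<lambda>x. (x, x)))"
    by (rule nn_integral_distr[symmetric]) (simp_all add: restr_def)
  also have "\<dots> = emeasure (distr (restr mu ?A) (borel \<Otimes>\<^sub>M borel) (\<lambda>x. (x, x))) S"
    by simp
  finally show "emeasure (restr plan (?A \<times> ?A)) S = emeasure (distr (restr mu ?A) (borel \<Otimes>\<^sub>M borel) (\<lambda>x. (x, x))) S" .
qed

end

section \<open>Entropy\<close>


lemma enn2ereal_diff_mono: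
  fixes U N P L :: ennreal
  assumes le: "U + N \<le> P + L" and fin: "N < \<infinity>" "L < \<infinity>"
  shows "enn2ereal U - enn2ereal L \<le> enn2ereal P - enn2ereal N"
proof -
  obtain n where n: "N = ennreal n" "0 \<le> n"
    using fin by (cases N) auto
  obtain m where m: "L = ennreal m" "0 \<le> m"
    using fin by (cases L) auto
  show ?thesis
  proof (cases P)
    case (real v)
    have "U \<noteq> \<top>"
      using le real m by (auto simp: top_unique)
    then obtain w where w: "U = ennreal w" "0 \<le> w"
      by (cases U) auto
    have "ennreal (w + n) \<le> ennreal (v + m)"
      using le n m w real by simp
    then have "w + n \<le> v + m"
      using m real by (simp only: ennreal_le_iff add_nonneg_nonneg)
    then show ?thesis
      using n m w real by simp
  next
    case top
    then show ?thesis
      using n by simp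
  qed
qed

text \<open>Positive and negative parts are compared in the form \<open>u + N \<le> P + l\<close>, which only involves
  sums of nonnegative terms and so is meaningful for infinite integrals.\<close>
lemma Ent_ge:
  fixes u l k :: "'a \<Rightarrow> real"
  assumes rho: "prob_space rho" and gamma: "finite_measure gamma" and sets: "sets gamma = sets rho"
    and ac: "absolutely_continuous rho gamma"
    and [measurable]: "u \<in> borel_measurable rho" "l \<in> borel_measurable rho" "k \<in> borel_measurable rho"
    and ae: "AE x in gamma. 0 < k x \<and> 0 \<le> u x \<and> 0 \<le> l x \<and> ln (k x) = u x - l x"
    and k: "(\<integral>\<^sup>+x. ennreal (k x) \<partial>rho) \<le> emeasure gamma (space gamma)"
    and l: "(\<integral>\<^sup>+x. ennreal (l x) \<partial>gamma) < \<infinity>"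
  shows "enn2ereal (\<integral>\<^sup>+x. ennreal (u x) \<partial>gamma) - enn2ereal (\<integral>\<^sup>+x. ennreal (l x) \<partial>gamma) \<le> Ent gamma rho"
    and "gamma = density rho (\<lambda>x. ennreal (k x)) \<Longrightarrow>
      Ent gamma rho = enn2ereal (\<integral>\<^sup>+x. ennreal (u x) \<partial>gamma) - enn2ereal (\<integral>\<^sup>+x. ennreal (l x) \<partial>gamma)"
proof -
  interpret rho: prob_space rho by (rule rho)
  interpret gamma: finite_measure gamma by (rule gamma)
  note [measurable_cong] = sets
  define p where "p = RN_deriv rho gamma"
  have p [measurable]: "p \<in> borel_measurable rho" and dens: "density rho p = gamma"
    unfolding p_def using rho.density_RN_deriv[OF ac sets] by auto
  have fin: "AE x in rho. p x \<noteq> \<infinity>"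
    unfolding p_def by (rule rho.RN_deriv_finite[OF gamma.sigma_finite_measure_axioms ac sets])
  define h where "h x = ln (enn2real (p x))" for x
  have [measurable]: "h \<in> borel_measurable rho"
    unfolding h_def by measurable
  have ig: "(\<integral>\<^sup>+x. f x \<partial>gamma) = (\<integral>\<^sup>+x. p x * f x \<partial>rho)" if "f \<in> borel_measurable rho" for f
    unfolding dens[symmetric] using that by (subst nn_integral_density) auto
  have aep: "AE x in gamma. 0 < enn2real (p x)"
    unfolding dens[symmetric] using fin
    by (subst AE_density) (auto simp: enn2real_positive_iff top.not_eq_extremum)
  let ?P = "\<integral>\<^sup>+x. ennreal (h x) \<partial>gamma" and ?N = "\<integral>\<^sup>+x. ennreal (- h x) \<partial>gamma"
  let ?U = "\<integral>\<^sup>+x. ennreal (u x) \<partial>gamma" and ?L = "\<integral>\<^sup>+x. ennreal (l x) \<partial>gamma"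
  have Ent: "Ent gamma rho = enn2ereal ?P - enn2ereal ?N"
    using sets ac by (simp add: Ent_def Let_def h_def p_def)
  \<comment> \<open>The negative part of the entropy is finite: ln (1 / q) \<le> 1 / q - 1 gives - q
    ln q \<le> 1 - q, and \<open>rho\<close> has mass 1.\<close>
  have "?N = (\<integral>\<^sup>+x. p x * ennreal (- h x) \<partial>rho)"
    by (rule ig) measurable
  also have "\<dots> \<le> (\<integral>\<^sup>+x. 1 \<partial>rho)"
  proof (intro nn_integral_mono_AE, use fin in eventually_elim)
    case (elim x)
    define q where "q = enn2real (p x)"
    have px: "p x = ennreal q" "0 \<le> q"
      using elim by (auto simp: q_def less_top)
    show ?case
    proof (cases "q = 0")
      case False
      then have "q > 0" using px by simp
      have "- ln q \<le> 1 / q - 1"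
        using ln_le_minus_one[of "1 / q"] \<open>q > 0\<close> by (simp add: ln_div)
      then have "q * (- ln q) \<le> q * (1 / q - 1)"
        using \<open>q > 0\<close> by (intro mult_left_mono) auto
      also have "\<dots> = 1 - q"
        using \<open>q > 0\<close> by (simp add: field_simps)
      finally have "q * (- ln q) \<le> 1"
        using \<open>q > 0\<close> by linarith
      then have "ennreal (q * (- ln q)) \<le> 1"
        by (metis ennreal_1 ennreal_leI)
      then have "ennreal q * ennreal (- ln q) \<le> 1"
        using px(2) by (subst ennreal_mult'[symmetric])
      then show ?thesis
        using px by (simp only: h_def enn2real_ennreal)
    qed (simp add: px)
  qed
  also have "\<dots> = 1"
    by (simp add: rho.emeasure_space_1)
  finally have N: "?N < \<infinity>"
    by (auto simp: top.not_eq_extremum[symmetric] top_unique)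
  let ?M = "emeasure gamma (space gamma)"
  \<comment> \<open>The inequality ln (k / p) \<le> k / p - 1, integrated against
    \<open>gamma\<close> with negative terms moved to the other side; the 1 contributes the mass
    \<open>?M\<close>, cancelled at the end.\<close>
  have "?U + ?M + ?N = (\<integral>\<^sup>+x. ennreal (u x) + 1 + ennreal (- h x) \<partial>gamma)"
    by (subst nn_integral_add; simp?)+
  also have "\<dots> \<le> (\<integral>\<^sup>+x. ennreal (h x) + ennreal (l x) + ennreal (k x / enn2real (p x)) \<partial>gamma)"
  proof (intro nn_integral_mono_AE, use ae aep in eventually_elim)
    case (elim x)
    define q where "q = enn2real (p x)"
    have q: "0 < q" using elim by (simp add: q_def)
    have "ln (k x / q) \<le> k x / q - 1"
      using elim q by (intro ln_le_minus_one) auto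
    then have "u x + 1 - ln q \<le> l x + k x / q"
      using elim q by (simp add: ln_div)
    then have "u x + 1 + max 0 (- h x) \<le> max 0 (h x) + l x + k x / q"
      unfolding h_def q_def by (auto simp: max_def)
    then have "ennreal (u x + 1 + max 0 (- h x)) \<le> ennreal (max 0 (h x) + l x + k x / q)"
      by (rule ennreal_leI)
    then show ?case
      using elim q unfolding q_def[symmetric] by (simp add: ennreal_max_0 flip: ennreal_1)
  qed
  also have "\<dots> = ?P + ?L + (\<integral>\<^sup>+x. ennreal (k x / enn2real (p x)) \<partial>gamma)"
    by (subst nn_integral_add; simp?)+
  also have "(\<integral>\<^sup>+x. ennreal (k x / enn2real (p x)) \<partial>gamma) = (\<integral>\<^sup>+x. p x * ennreal (k x / enn2real (p x)) \<partial>rho)"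
    by (rule ig) measurable
  \<comment> \<open>Only an inequality: \<open>k\<close> may be positive where \<open>p\<close> is
    0, a set that \<open>gamma\<close> does not see.\<close>
  also have "\<dots> \<le> (\<integral>\<^sup>+x. ennreal (k x) \<partial>rho)"
  proof (intro nn_integral_mono_AE, use fin in eventually_elim)
    case (elim x)
    define q where "q = enn2real (p x)"
    have px: "p x = ennreal q" "0 \<le> q"
      using elim by (auto simp: q_def less_top)
    show ?case
    proof (cases "q = 0")
      case False
      have "ennreal q * ennreal (k x / q) = ennreal (q * (k x / q))"
        using px(2) by (rule ennreal_mult'[symmetric])
      also have "\<dots> = ennreal (k x)"
        using False by simp
      finally show ?thesis
        using px by (simp only: enn2real_ennreal)
    qed (simp add: px)
  qed
  also have "\<dots> \<le> ?M"
    by (rule k)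
  finally have "?M + (?U + ?N) \<le> ?M + (?P + ?L)"
    by (simp add: ac_simps add_left_mono)
  then have "?U + ?N \<le> ?P + ?L"
    using gamma.emeasure_finite by (simp add: ennreal_add_left_cancel_le)
  then show ge: "enn2ereal ?U - enn2ereal ?L \<le> Ent gamma rho"
    unfolding Ent using N l by (intro enn2ereal_diff_mono) auto
  assume eq: "gamma = density rho (\<lambda>x. ennreal (k x))"
  \<comment> \<open>In the equality case \<open>k\<close> is the Radon-Nikodym derivative itself, so
    h = u - l almost everywhere.\<close>
  have "AE x in rho. ennreal (k x) = p x"
    unfolding p_def by (rule rho.RN_deriv_unique) (auto simp: eq)
  then have "AE x in gamma. ennreal (k x) = p x"
    by (rule absolutely_continuous_AE[OF sets ac])
  then have "AE x in gamma. ennreal (h x) + ennreal (l x) = ennreal (u x) + ennreal (- h x)"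
    using ae
  proof eventually_elim
    case (elim x)
    then have "h x = u x - l x"
      unfolding h_def by (metis enn2real_ennreal less_imp_le)
    then have "max 0 (h x) + l x = u x + max 0 (- h x)"
      by (auto simp: max_def)
    then have "ennreal (max 0 (h x) + l x) = ennreal (u x + max 0 (- h x))"
      by simp
    then show ?case
      using elim by (simp add: ennreal_max_0)
  qed
  then have "(\<integral>\<^sup>+x. ennreal (h x) + ennreal (l x) \<partial>gamma) = (\<integral>\<^sup>+x. ennreal (u x) + ennreal (- h x) \<partial>gamma)"
    by (rule nn_integral_cong_AE)
  then have PL: "?P + ?L = ?U + ?N"
    by (subst (asm) nn_integral_add; simp?)+
  then have "enn2ereal ?P - enn2ereal ?N \<le> enn2ereal ?U - enn2ereal ?L"
    using N l by (intro enn2ereal_diff_mono) auto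
  then show "Ent gamma rho = enn2ereal ?U - enn2ereal ?L"
    using ge unfolding Ent by (rule antisym)
qed

context transport_pair
begin

text \<open>Unions of components of \<open>- Aeq mu nu\<close>: sets that an optimal plan cannot enter or leave.\<close>
definition saturated :: "real set \<Rightarrow> bool" where
  "saturated W \<longleftrightarrow> W \<in> sets borel \<and> W \<inter> Aeq mu nu = {} \<and>
     (\<forall>x y t. (x, y) \<in> admissible \<longrightarrow> min x y \<le> t \<longrightarrow> t \<le> max x y \<longrightarrow> (t \<in> W \<longleftrightarrow> x \<in> W))"

lemma saturated_compl_Aeq: "saturated (UNIV - Aeq mu nu)"
  unfolding saturated_def
proof (intro conjI allI impI)
  have "UNIV - Aeq mu nu = Aplus mu nu \<union> Aminus mu nu"
    by (auto simp: Aplus_iff Aminus_iff Aeq_iff)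
  then show "UNIV - Aeq mu nu \<in> sets borel"
    by simp
  fix x y t assume "(x, y) \<in> admissible" "min x y \<le> t" "t \<le> max x y"
  then have "x = t \<or> {x, t} \<subseteq> Aplus mu nu \<or> {x, t} \<subseteq> Aminus mu nu"
    by (cases x y rule: linorder_cases) (auto simp: admissible_def subset_eq)
  then show "t \<in> UNIV - Aeq mu nu \<longleftrightarrow> x \<in> UNIV - Aeq mu nu"
    by (auto simp: Aplus_iff Aminus_iff Aeq_iff)
qed auto

text \<open>A segment in A+ cannot pass the zeros \<open>a\<close> and \<open>b\<close>, and a
  segment in A- cannot meet an interval on which \<open>Fcal\<close> is positive.\<close>

lemma admissible_interval:
  assumes ab: "positivity_interval a b" and xy: "(x, y) \<in> admissible" and t: "min x y \<le> t" "t \<le> max x y"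
  shows "t \<in> {a<..<b} \<longleftrightarrow> x \<in> {a<..<b}"
proof -
  have "0 < Fcal mu nu s" if "s \<in> {a<..<b}" for s
    using ab that by (simp add: positivity_interval_def)
  then have *: "a \<notin> Aplus mu nu" "b \<notin> Aplus mu nu" "\<And>s. s \<in> {a<..<b} \<Longrightarrow> s \<notin> Aminus mu nu"
    using ab by (auto simp: positivity_interval_def Aplus_iff Aminus_iff not_less less_imp_le)
  show ?thesis
  proof (cases x y rule: linorder_cases)
    case less
    then have sub: "{x..y} \<subseteq> Aplus mu nu"
      using xy by (simp add: admissible_def)
    have "a \<notin> {x..y}" "b \<notin> {x..y}"
      using sub * by auto
    then show ?thesis
      using t less by auto
  next
    case greater
    then have "{y..x} \<subseteq> Aminus mu nu"
      using xy by (simp add: admissible_def)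
    moreover have "t \<in> {y..x}" "x \<in> {y..x}"
      using t greater by auto
    ultimately show ?thesis
      using * by blast
  qed (use t in auto)
qed

lemma saturated_interval:
  assumes "positivity_interval a b"
  shows "saturated {a<..<b}"
  unfolding saturated_def
proof (intro conjI allI impI)
  have "0 < Fcal mu nu s" if "s \<in> {a<..<b}" for s
    using assms that by (simp add: positivity_interval_def)
  then show "{a<..<b} \<inter> Aeq mu nu = {}"
    by (force simp: Aeq_iff)
qed (simp, rule admissible_interval[OF assms])

lemma saturated_swap:
  assumes "transport_pair.saturated nu mu W"
  shows "saturated W"
proof -
  interpret sw: transport_pair nu mu by (rule swap)
  have W: "W \<in> sets borel" "W \<inter> Aeq mu nu = {}"
    "\<And>x y t. (y, x) \<in> sw.admissible \<Longrightarrow> min y x \<le> t \<Longrightarrow> t \<le> max y x \<Longrightarrow> t \<in> W \<longleftrightarrow> y \<in> W"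
    using assms unfolding sw.saturated_def Aminus_swap(3)[symmetric] by blast+
  have "t \<in> W \<longleftrightarrow> x \<in> W" if "(x, y) \<in> admissible" "min x y \<le> t" "t \<le> max x y" for x y t
  proof -
    have "(y, x) \<in> sw.admissible"
      using that(1) by (auto simp: sw.admissible_def admissible_def Aminus_swap[symmetric])
    then show ?thesis
      using W(3)[of y x t] W(3)[of y x x] that by (simp add: min.commute max.commute)
  qed
  then show ?thesis
    unfolding saturated_def using W(1,2) by blast
qed

text \<open>The diagonal is admissible although the kernel is 0 there. A plan that is absolutely
  continuous with respect to the product measure gives it no mass, so the logarithm of the kernel
  can be used almost everywhere.\<close>

lemma null_diagonal: "{(x, y). x = y} \<in> null_sets (mu \<Otimes>\<^sub>M nu)"
proof -
  have "emeasure (mu \<Otimes>\<^sub>M nu) {(x, y). x = y} = (\<integral>\<^sup>+p. indicator {(x, y). x = y} p \<partial>(mu \<Otimes>\<^sub>M nu))"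
    using sets_diagonal by (simp add: sets_pair)
  also have "\<dots> = (\<integral>\<^sup>+x. (\<integral>\<^sup>+y. indicator {(x, y). x = y} (x, y) \<partial>nu) \<partial>mu)"
    by (rule nn_integral_pair_fst) measurable
  also have "\<dots> = (\<integral>\<^sup>+x. (\<integral>\<^sup>+y. indicator {x} y \<partial>nu) \<partial>mu)"
    by (intro nn_integral_cong) (auto simp: indicator_def)
  also have "\<dots> = 0"
    by (simp add: sets_nu atomless_nu)
  finally show ?thesis
    using sets_diagonal by (auto simp: null_sets_def sets_pair)
qed

lemma prob_space_pair: "prob_space (mu \<Otimes>\<^sub>M nu)"
proof -
  interpret pair_prob_space mu nu ..
  show ?thesis
    by (rule prob_space_axioms)
qed

end

section \<open>Entropy of an arbitrary optimal plan on a saturated set\<close>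

context optimal_pair
begin

lemma AE_saturated:
  assumes "saturated W"
  shows "AE p in g. \<forall>t. min (fst p) (snd p) \<le> t \<longrightarrow> t \<le> max (fst p) (snd p) \<longrightarrow> (t \<in> W \<longleftrightarrow> p \<in> W \<times> W)"
  using AE_admissible
proof eventually_elim
  case (elim p)
  then have "(fst p, snd p) \<in> admissible"
    by simp
  with assms have *: "t \<in> W \<longleftrightarrow> fst p \<in> W" if "min (fst p) (snd p) \<le> t" "t \<le> max (fst p) (snd p)" for t
    unfolding saturated_def using that by blast
  show ?case
  proof (intro allI impI)
    fix t assume "min (fst p) (snd p) \<le> t" "t \<le> max (fst p) (snd p)"
    then have "t \<in> W \<longleftrightarrow> fst p \<in> W"
      by (rule *)
    moreover have "snd p \<in> W \<longleftrightarrow> fst p \<in> W"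
      by (rule *) auto
    ultimately show "t \<in> W \<longleftrightarrow> p \<in> W \<times> W"
      by (simp only: mem_Times_iff) blast
  qed
qed

lemma nn_integral_restr:
  assumes [measurable]: "f \<in> borel_measurable (borel \<Otimes>\<^sub>M borel)" "W \<in> sets borel"
  shows "(\<integral>\<^sup>+p. f p \<partial>restr g (W \<times> W)) = (\<integral>\<^sup>+p. f p * indicator (W \<times> W) p \<partial>g)"
  unfolding restr_def by (subst nn_integral_density) (auto simp: mult.commute)

text \<open>An optimal plan moves no mass into or out of \<open>W\<close>, so its restriction to the
  square keeps \<open>mu\<close> on \<open>W\<close> as first marginal.\<close>

lemma nn_integral_restr_fst:
  assumes W: "saturated W" and f [measurable]: "f \<in> borel_measurable borel"
  shows "(\<integral>\<^sup>+p. f (fst p) \<partial>restr g (W \<times> W)) = (\<integral>\<^sup>+x. f x * indicator W x \<partial>mu)"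
proof -
  have [measurable]: "W \<in> sets borel"
    using W by (simp add: saturated_def)
  have "(\<integral>\<^sup>+p. f (fst p) \<partial>restr g (W \<times> W)) = (\<integral>\<^sup>+p. f (fst p) * indicator (W \<times> W) p \<partial>g)"
    by (rule nn_integral_restr) measurable
  also have "\<dots> = (\<integral>\<^sup>+p. f (fst p) * indicator W (fst p) \<partial>g)"
    using AE_saturated[OF W]
  proof (intro nn_integral_cong_AE, eventually_elim)
    case (elim p)
    then have "fst p \<in> W \<longleftrightarrow> p \<in> W \<times> W"
      by (meson min.cobounded1 max.cobounded1)
    then show ?case
      by (simp add: indicator_def)
  qed
  also have "\<dots> = (\<integral>\<^sup>+x. f x * indicator W x \<partial>mu)"
    by (rule nn_integral_fst) measurable
  finally show ?thesis .
qed

lemma emeasure_restr: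
  assumes W: "saturated W"
  shows "emeasure (restr g (W \<times> W)) (space (restr g (W \<times> W))) = emeasure mu W"
proof -
  have [measurable]: "W \<in> sets borel"
    using W by (simp add: saturated_def)
  show ?thesis
    using nn_integral_restr_fst[OF W, of "\<lambda>_. 1"] by (simp add: sets_mu)
qed

text \<open>Tonelli: a point \<open>t \<in> W\<close> is crossed by mass \<open>\<bar>Fcal mu nu t\<bar>\<close>, which cancels the weight in \<open>log_ratio\<close>.\<close>
lemma integral_log_ratio:
  assumes W: "saturated W"
  shows "(\<integral>\<^sup>+p. log_ratio (fst p) (snd p) \<partial>restr g (W \<times> W)) = emeasure mu W"
proof -
  interpret gm: pair_sigma_finite g mu ..
  have [measurable]: "W \<in> sets borel" and W0: "W \<inter> Aeq mu nu = {}"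
    using W by (auto simp: saturated_def)
  have [measurable]: "(\<lambda>(p, t). indicator (upcross t \<union> downcross t) p :: ennreal) \<in> borel_measurable (g \<Otimes>\<^sub>M mu)"
  proof -
    have "(\<lambda>(p, t). indicator (upcross t \<union> downcross t) p :: ennreal)
        = (\<lambda>z. if fst (fst z) \<le> snd z \<and> snd z < snd (fst z) \<or> snd (fst z) \<le> snd z \<and> snd z < fst (fst z) then 1 else 0)"
      by (auto simp: fun_eq_iff indicator_def upcross_def downcross_def)
    also have "\<dots> \<in> borel_measurable (g \<Otimes>\<^sub>M mu)"
      by measurable
    finally show ?thesis .
  qed
  have meas: "(\<lambda>(p, t). ennreal (1 / \<bar>Fcal mu nu t\<bar>) * indicator W t * indicator (upcross t \<union> downcross t) p)
      \<in> borel_measurable (g \<Otimes>\<^sub>M mu)"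
    by (simp add: split_beta')
  have "(\<integral>\<^sup>+p. log_ratio (fst p) (snd p) \<partial>restr g (W \<times> W)) = (\<integral>\<^sup>+p. log_ratio (fst p) (snd p) * indicator (W \<times> W) p \<partial>g)"
    by (rule nn_integral_restr) measurable
  also have "\<dots> = (\<integral>\<^sup>+p. (\<integral>\<^sup>+t. ennreal (1 / \<bar>Fcal mu nu t\<bar>) * indicator W t * indicator (upcross t \<union> downcross t) p \<partial>mu) \<partial>g)"
    using AE_saturated[OF W]
  proof (intro nn_integral_cong_AE, eventually_elim)
    case (elim p)
    have "log_ratio (fst p) (snd p) * indicator (W \<times> W) p
        = (\<integral>\<^sup>+t. ennreal (1 / \<bar>Fcal mu nu t\<bar>) * indicator ({fst p..<snd p} \<union> {snd p..<fst p}) t * indicator (W \<times> W) p \<partial>mu)"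
      unfolding log_ratio_def by (rule nn_integral_multc[symmetric]) measurable
    also have "\<dots> = (\<integral>\<^sup>+t. ennreal (1 / \<bar>Fcal mu nu t\<bar>) * indicator W t * indicator (upcross t \<union> downcross t) p \<partial>mu)"
    proof (intro nn_integral_cong)
      fix t
      show "ennreal (1 / \<bar>Fcal mu nu t\<bar>) * indicator ({fst p..<snd p} \<union> {snd p..<fst p}) t * indicator (W \<times> W) p
        = ennreal (1 / \<bar>Fcal mu nu t\<bar>) * indicator W t * indicator (upcross t \<union> downcross t) p"
      proof (cases "p \<in> upcross t \<union> downcross t")
        case True
        then have t: "t \<in> {fst p..<snd p} \<union> {snd p..<fst p}"
          by (auto simp: upcross_def downcross_def)
        then have "min (fst p) (snd p) \<le> t" "t \<le> max (fst p) (snd p)"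
          by auto
        then have "t \<in> W \<longleftrightarrow> p \<in> W \<times> W"
          using elim by blast
        with t show ?thesis
          using True by (simp add: indicator_def)
      next
        case False
        then have "t \<notin> {fst p..<snd p} \<union> {snd p..<fst p}"
          by (auto simp: upcross_def downcross_def)
        then show ?thesis
          using False by (simp add: indicator_def)
      qed
    qed
    finally show ?case .
  qed
  also have "\<dots> = (\<integral>\<^sup>+t. (\<integral>\<^sup>+p. ennreal (1 / \<bar>Fcal mu nu t\<bar>) * indicator W t * indicator (upcross t \<union> downcross t) p \<partial>g) \<partial>mu)"
    by (rule gm.Fubini'[symmetric]) (rule meas)
  also have "\<dots> = (\<integral>\<^sup>+t. indicator W t \<partial>mu)"
  proof (intro nn_integral_cong)
    fix t
    have "upcross t \<inter> downcross t = {}"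
      by (auto simp: upcross_def downcross_def)
    then have "emeasure g (upcross t \<union> downcross t) = ennreal \<bar>Fcal mu nu t\<bar>"
      by (simp add: g.emeasure_eq_measure g.finite_measure_Union optimal_cross_sum[OF optimal])
    then have "(\<integral>\<^sup>+p. ennreal (1 / \<bar>Fcal mu nu t\<bar>) * indicator W t * indicator (upcross t \<union> downcross t) p \<partial>g)
        = ennreal (1 / \<bar>Fcal mu nu t\<bar>) * indicator W t * ennreal \<bar>Fcal mu nu t\<bar>"
      by (subst nn_integral_cmult) simp_all
    also have "\<dots> = indicator W t"
    proof (cases "t \<in> W")
      case True
      then have "Fcal mu nu t \<noteq> 0"
        using W0 by (auto simp: Aeq_iff)
      then show ?thesis
        using True by (simp flip: ennreal_mult)
    qed simp
    finally show "(\<integral>\<^sup>+p. ennreal (1 / \<bar>Fcal mu nu t\<bar>) * indicator W t * indicator (upcross t \<union> downcross t) p \<partial>g) = indicator W t" .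
  qed
  also have "\<dots> = emeasure mu W"
    by (simp add: sets_mu)
  finally show ?thesis .
qed

text \<open>\<open>Ent_ge\<close> with the kernel as reference density. Its sign and finiteness
  conditions hold because u \<ge> 0 follows from |Fcal| \<le> 1, and the integral of l is the finite
  number \<open>mu W\<close>; the marginals of the kernel bound the total mass of k.\<close>

lemma Ent_restr_ge:
  assumes W: "saturated W"
  shows "enn2ereal (\<integral>\<^sup>+x\<in>W. ennreal (- ln \<bar>Fcal mu nu x\<bar>) \<partial>mu) - ereal (measure mu W) \<le> Ent (restr g (W \<times> W)) (mu \<Otimes>\<^sub>M nu)"
    and "restr g (W \<times> W) = density (mu \<Otimes>\<^sub>M nu) (\<lambda>p. kernel (fst p) (snd p) * indicator (W \<times> W) p) \<Longrightarrow>
      Ent (restr g (W \<times> W)) (mu \<Otimes>\<^sub>M nu)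
        = enn2ereal (\<integral>\<^sup>+x\<in>W. ennreal (- ln \<bar>Fcal mu nu x\<bar>) \<partial>mu) - ereal (measure mu W)"
proof -
  have [measurable]: "W \<in> sets borel" and W0: "W \<inter> Aeq mu nu = {}"
    using W by (auto simp: saturated_def)
  let ?g = "restr g (W \<times> W)" and ?r = "mu \<Otimes>\<^sub>M nu"
  define u where "u p = - ln \<bar>Fcal mu nu (fst p)\<bar>" for p :: "real \<times> real"
  define l where "l p = enn2real (log_ratio (fst p) (snd p))" for p
  define k where "k p = enn2real (kernel (fst p) (snd p) * indicator (W \<times> W) p)" for p
  have k': "ennreal (k p) = kernel (fst p) (snd p) * indicator (W \<times> W) p" for p
    unfolding k_def by (subst ennreal_enn2real) (auto simp: kernel_def indicator_def)
  have [measurable]: "u \<in> borel_measurable ?r" "l \<in> borel_measurable ?r" "k \<in> borel_measurable ?r"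
    "u \<in> borel_measurable (borel \<Otimes>\<^sub>M borel)" "l \<in> borel_measurable (borel \<Otimes>\<^sub>M borel)"
    unfolding u_def l_def k_def by measurable
  have sets_r: "sets ?g = sets ?r"
    by (simp add: restr_def sets_pair)
  \<comment> \<open>\<open>enn2real\<close> sends infinity to 0, so \<open>l\<close> represents
    \<open>log_ratio\<close> only where the latter is finite.\<close>
  have lfin: "AE p in ?g. log_ratio (fst p) (snd p) \<noteq> \<infinity>"
    by (rule nn_integral_PInf_AE) (simp_all add: restr_def integral_log_ratio[OF W, unfolded restr_def] mu.emeasure_eq_measure)
  have L: "(\<integral>\<^sup>+p. ennreal (l p) \<partial>?g) = emeasure mu W"
    unfolding integral_log_ratio[OF W, symmetric]
  proof (intro nn_integral_cong_AE, use lfin in eventually_elim)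
    case (elim p)
    then show ?case
      by (simp add: l_def less_top)
  qed
  have U: "(\<integral>\<^sup>+p. ennreal (u p) \<partial>?g) = (\<integral>\<^sup>+x\<in>W. ennreal (- ln \<bar>Fcal mu nu x\<bar>) \<partial>mu)"
    unfolding u_def by (rule nn_integral_restr_fst[OF W]) measurable
  have K: "(\<integral>\<^sup>+p. ennreal (k p) \<partial>?r) \<le> emeasure ?g (space ?g)"
  proof -
    have "(\<integral>\<^sup>+p. ennreal (k p) \<partial>?r) \<le> (\<integral>\<^sup>+p. indicator W (fst p) * kernel (fst p) (snd p) \<partial>?r)"
      unfolding k' by (intro nn_integral_mono) (auto simp: indicator_def)
    also have "\<dots> = (\<integral>\<^sup>+x. indicator W x * (\<integral>\<^sup>+y. kernel x y \<partial>nu) \<partial>mu)"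
      by (subst nn_integral_pair_fst) (simp_all add: nn_integral_cmult)
    also have "\<dots> \<le> (\<integral>\<^sup>+x. indicator W x \<partial>mu)"
      unfolding kernel_marginals by (intro nn_integral_mono) (auto simp: indicator_def)
    also have "\<dots> = emeasure ?g (space ?g)"
      by (simp add: emeasure_restr[OF W] sets_mu)
    finally show ?thesis .
  qed
  have fin: "finite_measure ?g"
    by (rule finite_measureI) (simp add: emeasure_restr[OF W])
  have ae: "AE p in ?g. 0 < k p \<and> 0 \<le> u p \<and> 0 \<le> l p \<and> ln (k p) = u p - l p" if ac: "absolutely_continuous ?r ?g"
  proof -
    have "AE p in ?r. p \<notin> {(x, y). x = y}"
      by (rule AE_not_in[OF null_diagonal])
    then have 1: "AE p in ?g. p \<notin> {(x, y). x = y}"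
      by (rule absolutely_continuous_AE[OF sets_r ac])
    have 2: "AE p in ?g. p \<in> W \<times> W \<and> p \<in> admissible"
      unfolding restr_def using AE_admissible by (subst AE_density) (auto simp: indicator_def)
    from 1 2 show ?thesis
    proof eventually_elim
      case (elim p)
      have F0: "Fcal mu nu (fst p) \<noteq> 0"
        using elim W0 by (auto simp: Aeq_iff)
      have "(fst p, snd p) \<in> admissible - {(x, y). x = y}"
        using elim by auto
      then have "kernel (fst p) (snd p) = ennreal (exp (- l p) / \<bar>Fcal mu nu (fst p)\<bar>)"
        by (simp add: kernel_def l_def)
      then have "k p = exp (- l p) / \<bar>Fcal mu nu (fst p)\<bar>"
        using elim by (simp add: k_def)
      moreover have "0 \<le> u p"
        using F0 abs_Fcal_le_1[of "fst p"] by (simp add: u_def ln_le_zero_iff)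
      ultimately show ?case
        using F0 by (simp add: ln_div u_def l_def)
    qed
  qed
  have Lfin: "(\<integral>\<^sup>+p. ennreal (l p) \<partial>?g) < \<infinity>"
    unfolding L by (simp add: mu.emeasure_eq_measure)
  have Lm: "enn2ereal (\<integral>\<^sup>+p. ennreal (l p) \<partial>?g) = ereal (measure mu W)"
    unfolding L by (simp add: mu.emeasure_eq_measure)
  show "enn2ereal (\<integral>\<^sup>+x\<in>W. ennreal (- ln \<bar>Fcal mu nu x\<bar>) \<partial>mu) - ereal (measure mu W) \<le> Ent ?g ?r"
  proof (cases "absolutely_continuous ?r ?g")
    case True
    show ?thesis
      using Ent_ge(1)[OF prob_space_pair fin sets_r True _ _ _ ae[OF True] K Lfin] unfolding U Lm by simp
  next
    case False
    then show ?thesis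
      by (simp add: Ent_def)
  qed
  assume eq: "?g = density ?r (\<lambda>p. kernel (fst p) (snd p) * indicator (W \<times> W) p)"
  have ac: "absolutely_continuous ?r ?g"
    unfolding eq by (rule absolutely_continuousI_density) measurable
  have eq': "?g = density ?r (\<lambda>p. ennreal (k p))"
    unfolding k' by (rule eq)
  show "Ent ?g ?r = enn2ereal (\<integral>\<^sup>+x\<in>W. ennreal (- ln \<bar>Fcal mu nu x\<bar>) \<partial>mu) - ereal (measure mu W)"
    using Ent_ge(2)[OF prob_space_pair fin sets_r ac _ _ _ ae[OF ac] K Lfin eq'] unfolding U Lm by simp
qed

end

section \<open>Restriction of the plan to components\<close>

lemma neg_data_iff: "neg_data mu nu a b r1 r2 F G \<longleftrightarrow> pos_data nu mu a b r2 r1 G F"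
proof -
  have "(\<forall>x\<in>{a<..<b}. F x > 0 \<and> G x > 0) \<longleftrightarrow> (\<forall>x\<in>{a<..<b}. G x > 0 \<and> F x > 0)"
    by blast
  then show ?thesis
    unfolding neg_data_def pos_data_def by argo
qed

context transport_pair
begin

lemma Ent_plan:
  assumes "saturated W"
  shows "Ent (restr plan (W \<times> W)) (mu \<Otimes>\<^sub>M nu)
    = enn2ereal (\<integral>\<^sup>+x\<in>W. ennreal (- ln \<bar>Fcal mu nu x\<bar>) \<partial>mu) - ereal (measure mu W)"
proof -
  have "W \<in> sets borel" "W \<inter> Aeq mu nu = {}"
    using assms unfolding saturated_def by blast+
  then show ?thesis
    by (intro optimal_pair.Ent_restr_ge(2)[OF optimal_pair_plan assms] restr_plan_off_Aeq)
qed

text \<open>Both sides have the kernel as density on the square, whichever solution of the system is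
  taken, so one plan serves all data.\<close>

lemma restr_plan_pos:
  assumes "{a<..<b} \<in> components (Aplus mu nu)" "pos_data mu nu a b r1 r2 F G"
  shows "restr plan ({a<..<b} \<times> {a<..<b}) = gamma0_pos r1 r2"
proof -
  have pos: "positivity_interval a b"
    using assms(1) by (rule component_positivity_interval)
  interpret interval_data mu nu a b r1 r2 F G
    using pos assms(2) by unfold_locales
  have "{a<..<b} \<inter> Aeq mu nu = {}"
    using saturated_interval[OF pos] by (simp add: saturated_def)
  then show ?thesis
    unfolding gamma0_pos_eq by (intro restr_plan_off_Aeq) auto
qed

text \<open>The component is a positivity interval of the exchanged pair, whose
  \<open>gamma0_neg_eq\<close> is a statement about the kernel of (\<open>mu\<close>,
  \<open>nu\<close>).\<close>

lemma restr_plan_neg: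
  assumes "{a<..<b} \<in> components (Aminus mu nu)" "neg_data mu nu a b r1 r2 F G"
  shows "restr plan ({a<..<b} \<times> {a<..<b}) = gamma0_neg r1 r2"
proof -
  interpret sw: transport_pair nu mu by (rule swap)
  have pos: "sw.positivity_interval a b"
    using assms(1) by (intro sw.component_positivity_interval) (simp add: Aminus_swap(1))
  interpret interval_data nu mu a b r2 r1 G F
    by unfold_locales (rule pos, rule iffD1[OF neg_data_iff assms(2)])
  have "{a<..<b} \<inter> Aeq mu nu = {}"
    using saturated_swap[OF sw.saturated_interval[OF pos]] by (simp add: saturated_def)
  then show ?thesis
    unfolding gamma0_neg_eq by (intro restr_plan_off_Aeq) auto
qed

lemma admissible_in_component:
  assumes "(x, y) \<in> admissible" "x \<noteq> y"
  shows "\<exists>I \<in> components (Aplus mu nu) \<union> components (Aminus mu nu). (x, y) \<in> I \<times> I"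
proof -
  have *: "\<exists>I \<in> components A. (x, y) \<in> I \<times> I" if "{min x y..max x y} \<subseteq> A" for A
  proof -
    have "connected_component A x x" "connected_component A x y" "x \<in> A"
      unfolding connected_component_def using that by (auto intro!: exI[of _ "{min x y..max x y}"])
    then show ?thesis
      by (intro bexI[of _ "connected_component_set A x"]) (auto simp: components_def)
  qed
  show ?thesis
  proof (cases "x < y")
    case True
    then show ?thesis
      using assms *[of "Aplus mu nu"] by (auto simp: admissible_def)
  next
    case False
    then show ?thesis
      using assms *[of "Aminus mu nu"] by (auto simp: admissible_def)
  qed
qed

text \<open>The segment of an admissible pair is connected, hence inside one component. The union
  over components is compared with the Borel set of admissible pairs, as
  \<open>emeasure_mono\<close> asks only the larger set to be measurable.\<close>

lemma plan_support:
  "emeasure plan (UNIV - (Aeq mu nu \<times> Aeq mu nu \<union>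
     \<Union>{I \<times> I | I. I \<in> components (Aplus mu nu) \<union> components (Aminus mu nu)})) = 0"
proof -
  have "admissible - {(x, y). x = y} \<subseteq> \<Union>{I \<times> I | I. I \<in> components (Aplus mu nu) \<union> components (Aminus mu nu)}"
    using admissible_in_component by blast
  then have "UNIV - (Aeq mu nu \<times> Aeq mu nu \<union> \<Union>{I \<times> I | I. I \<in> components (Aplus mu nu) \<union> components (Aminus mu nu)})
      \<subseteq> UNIV - (Aeq mu nu \<times> Aeq mu nu \<union> (admissible - {(x, y). x = y}))"
    by blast
  moreover have "space (borel \<Otimes>\<^sub>M borel) - (Aeq mu nu \<times> Aeq mu nu \<union> (admissible - {(x, y). x = y})) \<in> sets plan"
    unfolding sets_plan by measurable
  then have "UNIV - (Aeq mu nu \<times> Aeq mu nu \<union> (admissible - {(x, y). x = y})) \<in> sets plan"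
    by (simp only: space_pair_measure space_borel UNIV_Times_UNIV)
  ultimately have "emeasure plan (UNIV - (Aeq mu nu \<times> Aeq mu nu \<union> \<Union>{I \<times> I | I. I \<in> components (Aplus mu nu) \<union> components (Aminus mu nu)}))
      \<le> emeasure plan (UNIV - (Aeq mu nu \<times> Aeq mu nu \<union> (admissible - {(x, y). x = y})))"
    by (rule emeasure_mono)
  then show ?thesis
    by (simp only: plan_off_support le_zero_eq)
qed

end

section \<open>From the hypotheses to the locale, and the conclusion\<close>

lemma transport_pairI:
  assumes "prob_space mu" and "prob_space nu"
    and sets: "sets mu = sets borel" "sets nu = sets borel"
    and ac: "absolutely_continuous lborel mu" "absolutely_continuous lborel nu"
    and "\<exists>K. compact K \<and> emeasure mu (UNIV - K) = 0"
    and "\<exists>K. compact K \<and> emeasure nu (UNIV - K) = 0"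
  shows "transport_pair mu nu"
proof -
  have atomless: "emeasure rho {x} = 0" if "absolutely_continuous lborel rho" for rho :: "real measure" and x
  proof -
    have "{x} \<in> null_sets lborel"
      by (simp add: null_sets_def)
    then have "{x} \<in> null_sets rho"
      using that by (auto simp: absolutely_continuous_def)
    then show ?thesis
      by (rule null_setsD1)
  qed
  \<comment> \<open>Beyond a bounded set carrying the mass, every distribution function equals 0 on
    the left and 1 on the right; these values do not depend on the measure, so \<open>Fcal\<close>
    vanishes there.\<close>
  have tail: "\<exists>R. \<forall>t. R < \<bar>t\<bar> \<longrightarrow> cdf rho t = (if 0 < t then 1 else 0)"
    if rho: "prob_space rho" "sets rho = sets borel" "\<exists>K. compact K \<and> emeasure rho (UNIV - K) = 0"
    for rho :: "real measure"
  proof -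
    interpret prob_space rho by (rule rho)
    have space [simp]: "space rho = UNIV"
      using sets_eq_imp_space_eq[OF rho(2)] by simp
    obtain K where K: "compact K" "emeasure rho (UNIV - K) = 0"
      using rho(3) by blast
    obtain R where R: "\<And>t. t \<in> K \<Longrightarrow> \<bar>t\<bar> \<le> R"
      using compact_imp_bounded[OF K(1)] by (auto simp: bounded_iff)
    have null: "prob S = 0" if "S \<subseteq> UNIV - K" for S
    proof -
      have "emeasure rho S \<le> emeasure rho (UNIV - K)"
        by (rule emeasure_mono[OF that])
          (use K rho(2) in \<open>auto intro!: borel_open simp: compact_imp_closed Compl_eq_Diff_UNIV[symmetric]\<close>)
      then show ?thesis
        using K by (simp add: measure_def)
    qed
    have "cdf rho t = (if 0 < t then 1 else 0)" if t: "R < \<bar>t\<bar>" for t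
    proof (cases "0 < t")
      case True
      have "prob (space rho - {..t}) = 1 - prob {..t}"
        by (rule prob_compl) (simp add: rho)
      moreover have "prob (space rho - {..t}) = 0"
        by (rule null) (use R t True in force)
      ultimately show ?thesis
        using True by (simp add: cdf_def)
    next
      case False
      have "prob {..t} = 0"
        by (rule null) (use R t False in force)
      then show ?thesis
        using False by (simp add: cdf_def)
    qed
    then show ?thesis by blast
  qed
  obtain R where R: "\<And>t. R < \<bar>t\<bar> \<Longrightarrow> cdf mu t = (if 0 < t then 1 else 0)"
    using tail[of mu] assms by blast
  obtain R' where R': "\<And>t. R' < \<bar>t\<bar> \<Longrightarrow> cdf nu t = (if 0 < t then 1 else 0)"
    using tail[of nu] assms by blast
  show ?thesis
  proof (rule transport_pair.intro)
    show "\<exists>R. \<forall>t. R < \<bar>t\<bar> \<longrightarrow> Fcal mu nu t = 0"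
      using R R' by (intro exI[of _ "max R R'"]) (simp add: Fcal_def)
  qed (rule assms(1,2) sets atomless[OF ac(1)] atomless[OF ac(2)])+
qed

theorem mainTheorem13:
  fixes mu nu :: "real measure"
  assumes "prob_space mu" and "prob_space nu"
    and "sets mu = sets borel" and "sets nu = sets borel"
    and "absolutely_continuous lborel mu" and "absolutely_continuous lborel nu"
    and "\<exists>K. compact K \<and> emeasure mu (UNIV - K) = 0"
    and "\<exists>K. compact K \<and> emeasure nu (UNIV - K) = 0"
  shows
   "((\<exists>g\<in>O1 mu nu. Ent (restr g ((UNIV - Aeq mu nu) \<times> (UNIV - Aeq mu nu))) (mu \<Otimes>\<^sub>M nu) < \<infinity>)
      \<longleftrightarrow> (\<integral>\<^sup>+ x \<in> Aplus mu nu \<union> Aminus mu nu. ennreal (- ln \<bar>Fcal mu nu x\<bar>) \<partial>mu) < \<infinity>)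
    \<and> ((\<integral>\<^sup>+ x \<in> Aplus mu nu \<union> Aminus mu nu. ennreal (- ln \<bar>Fcal mu nu x\<bar>) \<partial>mu) < \<infinity> \<longrightarrow>
       (\<exists>g\<in>O1 mu nu.
          (\<forall>g'\<in>O1 mu nu.
             Ent (restr g ((UNIV - Aeq mu nu) \<times> (UNIV - Aeq mu nu))) (mu \<Otimes>\<^sub>M nu)
             \<le> Ent (restr g' ((UNIV - Aeq mu nu) \<times> (UNIV - Aeq mu nu))) (mu \<Otimes>\<^sub>M nu)) \<and>
          emeasure g (UNIV - (Aeq mu nu \<times> Aeq mu nu \<union>
             \<Union>{I \<times> I | I. I \<in> components (Aplus mu nu) \<union> components (Aminus mu nu)})) = 0 \<and>
          restr g (Aeq mu nu \<times> Aeq mu nu)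
            = distr (restr mu (Aeq mu nu)) (borel \<Otimes>\<^sub>M borel) (\<lambda>x. (x, x)) \<and>
          (\<forall>a b. {a<..<b} \<in> components (Aplus mu nu) \<longrightarrow>
             (\<forall>r1 r2 F G. pos_data mu nu a b r1 r2 F G \<longrightarrow>
                restr g ({a<..<b} \<times> {a<..<b}) = gamma0_pos r1 r2)) \<and>
          (\<forall>a b. {a<..<b} \<in> components (Aminus mu nu) \<longrightarrow>
             (\<forall>r1 r2 F G. neg_data mu nu a b r1 r2 F G \<longrightarrow>
                restr g ({a<..<b} \<times> {a<..<b}) = gamma0_neg r1 r2))))
    \<and> (\<forall>a b. {a<..<b} \<in> components (Aplus mu nu) \<longrightarrow>
          (\<exists>r1 r2 F G. pos_data mu nu a b r1 r2 F G) \<and>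
          (\<forall>r1 r2 F G. pos_data mu nu a b r1 r2 F G \<longrightarrow>
             Ent (gamma0_pos r1 r2) (mu \<Otimes>\<^sub>M nu)
             = enn2ereal (\<integral>\<^sup>+ x \<in> {a<..<b}. ennreal (- ln \<bar>Fcal mu nu x\<bar>) \<partial>mu)
               - ereal (measure mu {a<..<b})))
    \<and> (\<forall>a b. {a<..<b} \<in> components (Aminus mu nu) \<longrightarrow>
          (\<exists>r1 r2 F G. neg_data mu nu a b r1 r2 F G) \<and>
          (\<forall>r1 r2 F G. neg_data mu nu a b r1 r2 F G \<longrightarrow>
             Ent (gamma0_neg r1 r2) (mu \<Otimes>\<^sub>M nu)
             = enn2ereal (\<integral>\<^sup>+ x \<in> {a<..<b}. ennreal (- ln \<bar>Fcal mu nu x\<bar>) \<partial>mu)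
               - ereal (measure mu {a<..<b})))"
proof -
  interpret transport_pair mu nu
    using assms by (rule transport_pairI)
  interpret sw: transport_pair nu mu
    by (rule swap)
  let ?W = "UNIV - Aeq mu nu"
  let ?E = "\<lambda>g. Ent (restr g (?W \<times> ?W)) (mu \<Otimes>\<^sub>M nu)"
  let ?U = "\<integral>\<^sup>+ x \<in> Aplus mu nu \<union> Aminus mu nu. ennreal (- ln \<bar>Fcal mu nu x\<bar>) \<partial>mu"
  have W: "?W = Aplus mu nu \<union> Aminus mu nu"
    by (auto simp: Aplus_iff Aminus_iff Aeq_iff)
  have plan: "plan \<in> O1 mu nu"
    by (simp add: O1_iff optimal_pair_plan)
  have E_plan: "?E plan = enn2ereal ?U - ereal (measure mu ?W)"
    using Ent_plan[OF saturated_compl_Aeq] by (simp only: W)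
  have E_ge: "enn2ereal ?U - ereal (measure mu ?W) \<le> ?E g" if "g \<in> O1 mu nu" for g
  proof -
    interpret g: optimal_pair mu nu g
      using that by (simp add: O1_iff)
    show ?thesis
      using g.Ent_restr_ge(1)[OF saturated_compl_Aeq] by (simp only: W)
  qed
  \<comment> \<open>\<open>measure mu ?W\<close> is a real number, so subtracting it does not affect
    finiteness.\<close>
  have fin: "enn2ereal ?U - ereal (measure mu ?W) < \<infinity> \<longleftrightarrow> ?U < \<infinity>"
    by (cases ?U) auto
  have finite_iff: "(\<exists>g\<in>O1 mu nu. ?E g < \<infinity>) \<longleftrightarrow> ?U < \<infinity>"
  proof
    assume "\<exists>g\<in>O1 mu nu. ?E g < \<infinity>"
    then show "?U < \<infinity>"
      using E_ge fin le_less_trans by blast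
  next
    assume "?U < \<infinity>"
    then show "\<exists>g\<in>O1 mu nu. ?E g < \<infinity>"
      using E_plan fin plan by (intro bexI[of _ plan]) simp_all
  qed
  have minimal: "\<forall>g'\<in>O1 mu nu. ?E plan \<le> ?E g'"
    using E_ge E_plan by simp
  have ex_pos: "\<exists>r1 r2 F G. pos_data mu nu a b r1 r2 F G"
    if "{a<..<b} \<in> components (Aplus mu nu)" for a b
    by (rule pos_data_exists[OF component_positivity_interval[OF that]])
  have Ent_pos: "Ent (gamma0_pos r1 r2) (mu \<Otimes>\<^sub>M nu)
      = enn2ereal (\<integral>\<^sup>+ x \<in> {a<..<b}. ennreal (- ln \<bar>Fcal mu nu x\<bar>) \<partial>mu) - ereal (measure mu {a<..<b})"
    if "{a<..<b} \<in> components (Aplus mu nu)" "pos_data mu nu a b r1 r2 F G" for a b r1 r2 F G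
    unfolding restr_plan_pos[OF that, symmetric]
    by (rule Ent_plan[OF saturated_interval[OF component_positivity_interval[OF that(1)]]])
  have neg: "sw.positivity_interval a b" if "{a<..<b} \<in> components (Aminus mu nu)" for a b
    using that by (intro sw.component_positivity_interval) (simp add: Aminus_swap(1))
  have ex_neg: "\<exists>r1 r2 F G. neg_data mu nu a b r1 r2 F G"
    if "{a<..<b} \<in> components (Aminus mu nu)" for a b
    using sw.pos_data_exists[OF neg[OF that]] unfolding neg_data_iff by blast
  have Ent_neg: "Ent (gamma0_neg r1 r2) (mu \<Otimes>\<^sub>M nu)
      = enn2ereal (\<integral>\<^sup>+ x \<in> {a<..<b}. ennreal (- ln \<bar>Fcal mu nu x\<bar>) \<partial>mu) - ereal (measure mu {a<..<b})"
    if "{a<..<b} \<in> components (Aminus mu nu)" "neg_data mu nu a b r1 r2 F G" for a b r1 r2 F G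
    unfolding restr_plan_neg[OF that, symmetric]
    by (rule Ent_plan[OF saturated_swap[OF sw.saturated_interval[OF neg[OF that(1)]]]])
  show ?thesis
    by (intro conjI impI allI bexI[OF _ plan];
      rule finite_iff minimal plan_support restr_plan_Aeq restr_plan_pos restr_plan_neg ex_pos Ent_pos ex_neg Ent_neg;
      assumption)
qed

end
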